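(* Let $u\in\mathcal E'(Y)$ be a compactly supported distribution. Then the map $$\mathcal F^{d}_{\alpha,\varrho,\delta}(X,Y,\Xi)\to\mathcal D'(X),\qquad (\Phi,a)\mapsto A_{\Phi,a}[u],$$ is continuous when $\mathcal D'(X)$ carries the weak-$*$ topology. Here $A_{\Phi,a}[u]$ is defined by $$\langle A_{\Phi,a}[u],\psi\rangle=\langle u,{}^{\mathsf t}\!A_{\Phi,a}[\psi]\rangle,\qquad {}^{\mathsf t}\!A_{\Phi,a}[\psi](y)=\frac1{(2\pi)^{n_\Xi}}\int_\Xi\int_X e^{i\Phi(x,y,\xi)}a(x,y,\xi)\psi(x)\,dx\,d\xi,\quad \psi\in\mathcal D(X),$$ the last integral being understood as an oscillatory integral.
   Context: Let $n_X,n_Y,n_\Xi\ge 1$ be integers, $X\subset\mathbb R^{n_X}$ and $Y\subset\mathbb R^{n_Y}$ open, $\Xi=\mathbb R^{n_\Xi}\setminus\{0\}$, $\alpha>0$, $d\in\mathbb R$, $0\le\delta<1$, $0<\varrho\le 1$. Write $\langle\xi\rangle=(1+\|\xi\|^2)^{1/2}$. $\mathcal D(X)$ is the space of smooth compactly supported functions on $X$, $\mathcal D'(X)$ the space of distributions on $X$, $\mathcal E'(Y)$ the space of compactly supported distributions on $Y$. For $Z\subset\mathbb R^{k}$ open and $m\in\{1,2,\dots\}$ put $K_{Z,m}=\{x\in Z:\|x\|\le m,\ \mathrm{dist}(x,\mathbb R^{k}\setminus Z)\ge 1/m\}$. Phase functions. $\mathcal M_{hg}(X,Y,\Xi)$ is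 the space of smooth functions $\Phi:X\times Y\times\Xi\to\mathbb R$ that are positively homogeneous of degree $1$ in $\xi$, with the topology given by the seminorms $$p_m(\Phi)=\sup\{\|\xi\|^{|l|-1}|\partial_x^j\partial_y^k\partial_\xi^l\Phi(x,y,\xi)|: x\in K_{X,m},\,y\in K_{Y,m},\,\xi\in\Xi,\ |j|+|k|+|l|\le m\}$$ ($j,k,l$ multi-indices). $\mathcal M_\alpha(X,Y,\Xi)$ is the subset of those $\Phi\in\mathcal M_{hg}(X,Y,\Xi)$ such that for all $(x,y,\xi)\in X\times Y\times\Xi$ $$\|\xi\|^{-2}\|\nabla_x\Phi\|^2+\|\nabla_\xi\Phi\|^2\ge\alpha\quad\text{and}\quad \|\xi\|^{-2}\|\nabla_y\Phi\|^2+\|\nabla_\xi\Phi\|^2\ge\alpha .$$ Amplitudes. $S^d_{\varrho,\delta}(X\times Y\times\mathbb R^{n_\Xi})$ is the Hörmander class of smooth functions $a$ such that for all multi-indices $j,k,l$ and all compact $K\subset X\times Y$ there is $C$ with $|\partial_x^j\partial_y^k\partial_\xi^l a(x,y,\xi)|\le C\langle\xi\rangle^{d-\varrho|l|+\delta(|j|+|k|)}$ for $(x,y)\in K$, $\xi\in\mathbb R^{n_\Xi}$. $\mathcal S^d_{\varrho,\delta}(X,Y,\Xi)$ is the space of restrictions to $X\times Y\times\Xi$ of elements of $S^d_{\varrho,\delta}(X\times Y\times\mathbb R^{n_\Xi})$, with seminorms $$q_m(a)=\sup\{\langle\xi\rangle^{-d+\varrho|l|-\delta(|j|+|k|)}|\partial_x^j\partial_y^k\partial_\xi^l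 a(x,y,\xi)|: x\in K_{X,m},\,y\in K_{Y,m},\,\xi\in\Xi,\ |j|+|k|+|l|\le m\}.$$ $\mathcal F^d_{\alpha,\varrho,\delta}(X,Y,\Xi)=\mathcal M_\alpha(X,Y,\Xi)\times\mathcal S^d_{\varrho,\delta}(X,Y,\Xi)$ carries the product topology, induced by $\boldsymbol p_m(\Phi,a)=p_m(\Phi)+q_m(a)$. Oscillatory integral for the transpose. Fix $\chi\in\mathcal D(\mathbb R^{n_\Xi})$ with $\chi=1$ for $\|\xi\|<1$ and $\chi=0$ for $\|\xi\|>2$. For $\Phi\in\mathcal M_\alpha(X,Y,\Xi)$ let $r=\|\xi\|^2\|\nabla_\xi\Phi\|^2+\|\nabla_x\Phi\|^2$, $\underline\alpha_l=\frac{-i}{r}(1-\chi)\|\xi\|^2\partial_{\xi_l}\Phi$, $\underline\beta_k=\frac{-i}{r}(1-\chi)\partial_{x_k}\Phi$, $\underline\gamma=\chi$, and $Lf=-\sum_{l=1}^{n_\Xi}\partial_{\xi_l}(\underline\alpha_lf)-\sum_{k=1}^{n_X}\partial_{x_k}(\underline\beta_kf)+\underline\gamma f$ (its formal transpose fixes $e^{i\Phi}$). Then $${}^{\mathsf t}\!A_{\Phi,a}[\psi](y)=\frac1{(2\pi)^{n_\Xi}}\int_\Xi\int_X e^{i\Phi(x,y,\xi)}L^\kappa\big(a(x,y,\xi)\psi(x)\big)\,dx\,d\xi$$ for $\kappa\in\mathbb N$ large enough that the integral converges absolutely (e.g. $d-\kappa\min(\varrho,1-\delta)<-n_\Xi$);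 ${}^{\mathsf t}\!A_{\Phi,a}$ maps $\mathcal D(X)$ continuously into $\mathcal C^\infty(Y)$. *)

theory Defs
  imports "HOL-Analysis.Analysis"
begin

text \<open>
  The spaces $R^{n_X}$, $R^{n_Y}$, $R^{n_\Xi}$ are Euclidean spaces \<open>'x\<close>, \<open>'y\<close>, \<open>'z\<close> (so that
  every dimension is at least 1), and coordinates are taken with respect to \<open>Basis\<close>.  A derivative
  $\partial^j$ is indexed by the list of its coordinate directions; the order $|j|$ is the length of
  the list.  For smooth functions the order of the directions is irrelevant, so lists and
  multi-indices give the same family of derivatives.
\<close>

section \<open>Smooth functions\<close>

definition pderiv1 ::
  "'a::euclidean_space \<Rightarrow> ('a \<Rightarrow> 'b::real_normed_vector) \<Rightarrow> 'a \<Rightarrow> 'b"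
  where "pderiv1 v f z = frechet_derivative f (at z) v"

primrec pderivs ::
  "'a::euclidean_space list \<Rightarrow> ('a \<Rightarrow> 'b::real_normed_vector) \<Rightarrow> 'a \<Rightarrow> 'b"
  where
    "pderivs [] f = f"
  | "pderivs (v # vs) f = pderiv1 v (pderivs vs f)"

text \<open>Only meant for open \<open>S\<close>; the values of \<open>f\<close> outside \<open>S\<close> are then irrelevant.\<close>

definition smooth_on ::
  "'a::euclidean_space set \<Rightarrow> ('a \<Rightarrow> 'b::real_normed_vector) \<Rightarrow> bool"
  where "smooth_on S f \<longleftrightarrow>
    (\<forall>vs \<in> lists Basis. \<forall>z\<in>S. pderivs vs f differentiable (at z))"

definition pderivs3 ::
  "'x::euclidean_space list \<Rightarrow> 'y::euclidean_space list \<Rightarrow> 'z::euclidean_space list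
    \<Rightarrow> ('x \<times> 'y \<times> 'z \<Rightarrow> 'b::real_normed_vector) \<Rightarrow> 'x \<times> 'y \<times> 'z \<Rightarrow> 'b"
  where "pderivs3 js ks ls =
    pderivs (map (\<lambda>i. (i, 0, 0)) js @ map (\<lambda>i. (0, i, 0)) ks @ map (\<lambda>i. (0, 0, i)) ls)"

definition multi_indices3 ::
  "nat \<Rightarrow> ('x::euclidean_space list \<times> 'y::euclidean_space list \<times> 'z::euclidean_space list) set"
  where "multi_indices3 m =
    {(js, ks, ls). js \<in> lists Basis \<and> ks \<in> lists Basis \<and> ls \<in> lists Basis \<and>
       length js + length ks + length ls \<le> m}"

section \<open>Function spaces given by seminorms\<close>

text \<open>The condition on the complement says that the distance from \<open>x\<close> to it is at least \<open>1 / m\<close>,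
  the distance to the empty set being infinite (unlike for \<^const>\<open>infdist\<close>).\<close>

definition exhaust :: "'a::euclidean_space set \<Rightarrow> nat \<Rightarrow> 'a set"
  where "exhaust Z m = {x\<in>Z. norm x \<le> real m \<and> (\<forall>z \<in> - Z. dist x z \<ge> 1 / real m)}"

definition seminorm_topology ::
  "('a \<Rightarrow> 'b::real_normed_vector) set \<Rightarrow> (nat \<Rightarrow> ('a \<Rightarrow> 'b) \<Rightarrow> ennreal) \<Rightarrow> ('a \<Rightarrow> 'b) topology"
  where "seminorm_topology S p = topology_generated_by
    {{g\<in>S. p m (\<lambda>z. g z - f z) < ennreal \<epsilon>} | f m \<epsilon>. f \<in> S \<and> m \<ge> 1 \<and> \<epsilon> > 0}"

abbreviation (input) Xi :: "'z::euclidean_space set"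
  where "Xi \<equiv> - {0}"

abbreviation (input) phase_dom ::
  "'x set \<Rightarrow> 'y set \<Rightarrow> ('x \<times> 'y \<times> 'z::euclidean_space) set"
  where "phase_dom X Y \<equiv> X \<times> Y \<times> Xi"

section \<open>Phase functions\<close>

definition phases_hg ::
  "'x::euclidean_space set \<Rightarrow> 'y::euclidean_space set \<Rightarrow> ('x \<times> 'y \<times> 'z::euclidean_space \<Rightarrow> real) set"
  where "phases_hg X Y = {\<Phi> \<in> extensional (phase_dom X Y).
    smooth_on (phase_dom X Y) \<Phi> \<and>
    (\<forall>x\<in>X. \<forall>y\<in>Y. \<forall>\<xi>\<in>Xi. \<forall>t>0. \<Phi> (x, y, t *\<^sub>R \<xi>) = t * \<Phi> (x, y, \<xi>))}"

definition phase_seminorm ::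
  "'x::euclidean_space set \<Rightarrow> 'y::euclidean_space set \<Rightarrow> nat
    \<Rightarrow> ('x \<times> 'y \<times> 'z::euclidean_space \<Rightarrow> real) \<Rightarrow> ennreal"
  where "phase_seminorm X Y m \<Phi> =
    (SUP (js, ks, ls) \<in> multi_indices3 m. SUP (x, y, \<xi>) \<in> exhaust X m \<times> exhaust Y m \<times> Xi.
       ennreal (norm \<xi> powr (real (length ls) - 1) * \<bar>pderivs3 js ks ls \<Phi> (x, y, \<xi>)\<bar>))"

definition grad_x ::
  "('x::euclidean_space \<times> 'y::euclidean_space \<times> 'z::euclidean_space \<Rightarrow> real) \<Rightarrow> 'x \<times> 'y \<times> 'z \<Rightarrow> 'x"
  where "grad_x \<Phi> p = (\<Sum>i\<in>Basis. pderivs3 [i] [] [] \<Phi> p *\<^sub>R i)"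

definition grad_y ::
  "('x::euclidean_space \<times> 'y::euclidean_space \<times> 'z::euclidean_space \<Rightarrow> real) \<Rightarrow> 'x \<times> 'y \<times> 'z \<Rightarrow> 'y"
  where "grad_y \<Phi> p = (\<Sum>i\<in>Basis. pderivs3 [] [i] [] \<Phi> p *\<^sub>R i)"

definition grad_xi ::
  "('x::euclidean_space \<times> 'y::euclidean_space \<times> 'z::euclidean_space \<Rightarrow> real) \<Rightarrow> 'x \<times> 'y \<times> 'z \<Rightarrow> 'z"
  where "grad_xi \<Phi> p = (\<Sum>i\<in>Basis. pderivs3 [] [] [i] \<Phi> p *\<^sub>R i)"

definition phases ::
  "'x::euclidean_space set \<Rightarrow> 'y::euclidean_space set \<Rightarrow> real
    \<Rightarrow> ('x \<times> 'y \<times> 'z::euclidean_space \<Rightarrow> real) set"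
  where "phases X Y \<alpha> = {\<Phi> \<in> phases_hg X Y. \<forall>x\<in>X. \<forall>y\<in>Y. \<forall>\<xi>\<in>Xi.
    (norm (grad_x \<Phi> (x, y, \<xi>)))\<^sup>2 / (norm \<xi>)\<^sup>2 + (norm (grad_xi \<Phi> (x, y, \<xi>)))\<^sup>2 \<ge> \<alpha> \<and>
    (norm (grad_y \<Phi> (x, y, \<xi>)))\<^sup>2 / (norm \<xi>)\<^sup>2 + (norm (grad_xi \<Phi> (x, y, \<xi>)))\<^sup>2 \<ge> \<alpha>}"

definition phases_topology ::
  "'x::euclidean_space set \<Rightarrow> 'y::euclidean_space set \<Rightarrow> real
    \<Rightarrow> ('x \<times> 'y \<times> 'z::euclidean_space \<Rightarrow> real) topology"
  where "phases_topology X Y \<alpha> =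
    subtopology (seminorm_topology (phases_hg X Y) (phase_seminorm X Y)) (phases X Y \<alpha>)"

section \<open>Amplitudes\<close>

definition jbracket :: "'z::euclidean_space \<Rightarrow> real"
  where "jbracket \<xi> = sqrt (1 + (norm \<xi>)\<^sup>2)"

definition hoermander_class ::
  "'x::euclidean_space set \<Rightarrow> 'y::euclidean_space set \<Rightarrow> real \<Rightarrow> real \<Rightarrow> real
    \<Rightarrow> ('x \<times> 'y \<times> 'z::euclidean_space \<Rightarrow> complex) set"
  where "hoermander_class X Y d \<rho> \<delta> = {a. smooth_on (X \<times> Y \<times> UNIV) a \<and>
    (\<forall>js \<in> lists Basis. \<forall>ks \<in> lists Basis. \<forall>ls \<in> lists Basis.
     \<forall>K. compact K \<and> K \<subseteq> X \<times> Y \<longrightarrow>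
       (\<exists>C. \<forall>(x, y) \<in> K. \<forall>\<xi>. norm (pderivs3 js ks ls a (x, y, \<xi>)) \<le>
          C * jbracket \<xi> powr (d - \<rho> * real (length ls) + \<delta> * real (length js + length ks))))}"

definition amplitudes ::
  "'x::euclidean_space set \<Rightarrow> 'y::euclidean_space set \<Rightarrow> real \<Rightarrow> real \<Rightarrow> real
    \<Rightarrow> ('x \<times> 'y \<times> 'z::euclidean_space \<Rightarrow> complex) set"
  where "amplitudes X Y d \<rho> \<delta> =
    (\<lambda>a. restrict a (phase_dom X Y)) ` hoermander_class X Y d \<rho> \<delta>"

definition amplitude_seminorm ::
  "'x::euclidean_space set \<Rightarrow> 'y::euclidean_space set \<Rightarrow> real \<Rightarrow> real \<Rightarrow> real \<Rightarrow> nat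
    \<Rightarrow> ('x \<times> 'y \<times> 'z::euclidean_space \<Rightarrow> complex) \<Rightarrow> ennreal"
  where "amplitude_seminorm X Y d \<rho> \<delta> m a =
    (SUP (js, ks, ls) \<in> multi_indices3 m. SUP (x, y, \<xi>) \<in> exhaust X m \<times> exhaust Y m \<times> Xi.
       ennreal (jbracket \<xi> powr (- d + \<rho> * real (length ls) - \<delta> * real (length js + length ks))
         * norm (pderivs3 js ks ls a (x, y, \<xi>))))"

definition amplitudes_topology ::
  "'x::euclidean_space set \<Rightarrow> 'y::euclidean_space set \<Rightarrow> real \<Rightarrow> real \<Rightarrow> real
    \<Rightarrow> ('x \<times> 'y \<times> 'z::euclidean_space \<Rightarrow> complex) topology"
  where "amplitudes_topology X Y d \<rho> \<delta> =
    seminorm_topology (amplitudes X Y d \<rho> \<delta>) (amplitude_seminorm X Y d \<rho> \<delta>)"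

definition FIO_topology ::
  "'x::euclidean_space set \<Rightarrow> 'y::euclidean_space set \<Rightarrow> real \<Rightarrow> real \<Rightarrow> real \<Rightarrow> real
    \<Rightarrow> (('x \<times> 'y \<times> 'z::euclidean_space \<Rightarrow> real) \<times> ('x \<times> 'y \<times> 'z \<Rightarrow> complex)) topology"
  where "FIO_topology X Y \<alpha> d \<rho> \<delta> =
    prod_topology (phases_topology X Y \<alpha>) (amplitudes_topology X Y d \<rho> \<delta>)"

section \<open>Test functions and distributions\<close>

text \<open>Test functions are extended by zero to the whole space; the support is taken there.\<close>

definition supp :: "('a::euclidean_space \<Rightarrow> complex) \<Rightarrow> 'a set"
  where "supp \<psi> = closure {x. \<psi> x \<noteq> 0}"

definition test_functions :: "'a::euclidean_space set \<Rightarrow> ('a \<Rightarrow> complex) set"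
  where "test_functions X = {\<psi>. smooth_on UNIV \<psi> \<and> compact (supp \<psi>) \<and> supp \<psi> \<subseteq> X}"

text \<open>Continuity on test functions is expressed by the usual seminorm estimates on compact sets.
  Functionals are extensional so that the weak-* topology below is a subspace topology of a
  product topology.\<close>

definition distributions :: "'a::euclidean_space set \<Rightarrow> (('a \<Rightarrow> complex) \<Rightarrow> complex) set"
  where "distributions X = {u \<in> extensional (test_functions X).
    (\<forall>\<phi> \<in> test_functions X. \<forall>\<psi> \<in> test_functions X. u (\<lambda>x. \<phi> x + \<psi> x) = u \<phi> + u \<psi>) \<and>
    (\<forall>c. \<forall>\<psi> \<in> test_functions X. u (\<lambda>x. c * \<psi> x) = c * u \<psi>) \<and>
    (\<forall>K. compact K \<and> K \<subseteq> X \<longrightarrow>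
      (\<exists>C N. \<forall>\<psi> \<in> test_functions X. supp \<psi> \<subseteq> K \<longrightarrow>
        norm (u \<psi>) \<le> C * (\<Sum>vs | vs \<in> lists Basis \<and> length vs \<le> N. SUP x. norm (pderivs vs \<psi> x))))}"

definition weak_star_topology ::
  "'a::euclidean_space set \<Rightarrow> (('a \<Rightarrow> complex) \<Rightarrow> complex) topology"
  where "weak_star_topology X =
    subtopology (product_topology (\<lambda>_. euclidean) (test_functions X)) (distributions X)"

definition dist_supp :: "'a::euclidean_space set \<Rightarrow> (('a \<Rightarrow> complex) \<Rightarrow> complex) \<Rightarrow> 'a set"
  where "dist_supp X u = X - \<Union>{V. open V \<and> V \<subseteq> X \<and> (\<forall>\<psi> \<in> test_functions V. u \<psi> = 0)}"

definition compact_distributions ::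
  "'a::euclidean_space set \<Rightarrow> (('a \<Rightarrow> complex) \<Rightarrow> complex) set"
  where "compact_distributions X = {u \<in> distributions X. compact (dist_supp X u)}"

definition is_cutoff ::
  "'a::euclidean_space set \<Rightarrow> (('a \<Rightarrow> complex) \<Rightarrow> complex) \<Rightarrow> ('a \<Rightarrow> complex) \<Rightarrow> bool"
  where "is_cutoff Y u \<theta> \<longleftrightarrow>
    \<theta> \<in> test_functions Y \<and> (\<exists>V. open V \<and> dist_supp Y u \<subseteq> V \<and> (\<forall>y\<in>V. \<theta> y = 1))"

text \<open>The pairing of a compactly supported distribution with a function that is smooth on \<open>Y\<close>,
  via a cutoff that is 1 near the support; it does not depend on the choice of the cutoff.\<close>

definition pairing ::
  "'a::euclidean_space set \<Rightarrow> (('a \<Rightarrow> complex) \<Rightarrow> complex) \<Rightarrow> ('a \<Rightarrow> complex) \<Rightarrow> complex"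
  where "pairing Y u f = u (\<lambda>y. (SOME \<theta>. is_cutoff Y u \<theta>) y * f y)"

section \<open>The oscillatory integral and the operator\<close>

definition osc_r ::
  "('x::euclidean_space \<times> 'y::euclidean_space \<times> 'z::euclidean_space \<Rightarrow> real) \<Rightarrow> 'x \<times> 'y \<times> 'z \<Rightarrow> real"
  where "osc_r \<Phi> = (\<lambda>(x, y, \<xi>).
    (norm \<xi>)\<^sup>2 * (norm (grad_xi \<Phi> (x, y, \<xi>)))\<^sup>2 + (norm (grad_x \<Phi> (x, y, \<xi>)))\<^sup>2)"

definition osc_alpha ::
  "('z::euclidean_space \<Rightarrow> complex) \<Rightarrow> ('x::euclidean_space \<times> 'y::euclidean_space \<times> 'z \<Rightarrow> real)
    \<Rightarrow> 'z \<Rightarrow> 'x \<times> 'y \<times> 'z \<Rightarrow> complex"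
  where "osc_alpha chi \<Phi> l = (\<lambda>(x, y, \<xi>).
    - \<i> / of_real (osc_r \<Phi> (x, y, \<xi>)) * (1 - chi \<xi>)
      * of_real ((norm \<xi>)\<^sup>2 * pderivs3 [] [] [l] \<Phi> (x, y, \<xi>)))"

definition osc_beta ::
  "('z::euclidean_space \<Rightarrow> complex) \<Rightarrow> ('x::euclidean_space \<times> 'y::euclidean_space \<times> 'z \<Rightarrow> real)
    \<Rightarrow> 'x \<Rightarrow> 'x \<times> 'y \<times> 'z \<Rightarrow> complex"
  where "osc_beta chi \<Phi> k = (\<lambda>(x, y, \<xi>).
    - \<i> / of_real (osc_r \<Phi> (x, y, \<xi>)) * (1 - chi \<xi>) * of_real (pderivs3 [k] [] [] \<Phi> (x, y, \<xi>)))"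

definition osc_L ::
  "('z::euclidean_space \<Rightarrow> complex) \<Rightarrow> ('x::euclidean_space \<times> 'y::euclidean_space \<times> 'z \<Rightarrow> real)
    \<Rightarrow> ('x \<times> 'y \<times> 'z \<Rightarrow> complex) \<Rightarrow> 'x \<times> 'y \<times> 'z \<Rightarrow> complex"
  where "osc_L chi \<Phi> f = (\<lambda>(x, y, \<xi>).
    - (\<Sum>l\<in>Basis. pderivs3 [] [] [l] (\<lambda>p. osc_alpha chi \<Phi> l p * f p) (x, y, \<xi>))
    - (\<Sum>k\<in>Basis. pderivs3 [k] [] [] (\<lambda>p. osc_beta chi \<Phi> k p * f p) (x, y, \<xi>))
    + chi \<xi> * f (x, y, \<xi>))"

definition FIO_transpose ::
  "'x::euclidean_space set \<Rightarrow> ('z::euclidean_space \<Rightarrow> complex) \<Rightarrow> nat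
    \<Rightarrow> ('x \<times> 'y::euclidean_space \<times> 'z \<Rightarrow> real) \<Rightarrow> ('x \<times> 'y \<times> 'z \<Rightarrow> complex)
    \<Rightarrow> ('x \<Rightarrow> complex) \<Rightarrow> 'y \<Rightarrow> complex"
  where "FIO_transpose X chi \<kappa> \<Phi> a \<psi> y =
    of_real (1 / (2 * pi) ^ DIM('z)) *
    (LINT \<xi>:Xi|lborel. LINT x:X|lborel.
       exp (\<i> * of_real (\<Phi> (x, y, \<xi>))) *
       (osc_L chi \<Phi> ^^ \<kappa>) (\<lambda>(x, y, \<xi>). a (x, y, \<xi>) * \<psi> x) (x, y, \<xi>))"

definition FIO ::
  "'x::euclidean_space set \<Rightarrow> 'y::euclidean_space set \<Rightarrow> ('z::euclidean_space \<Rightarrow> complex) \<Rightarrow> nat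
    \<Rightarrow> ('x \<times> 'y \<times> 'z \<Rightarrow> real) \<Rightarrow> ('x \<times> 'y \<times> 'z \<Rightarrow> complex)
    \<Rightarrow> (('y \<Rightarrow> complex) \<Rightarrow> complex) \<Rightarrow> (('x \<Rightarrow> complex) \<Rightarrow> complex)"
  where "FIO X Y chi \<kappa> \<Phi> a u =
    (\<lambda>\<psi> \<in> test_functions X. pairing Y u (FIO_transpose X chi \<kappa> \<Phi> a \<psi>))"

end

theory Submission
  imports Defs
begin

text \<open>
For a fixed test function \<open>\<psi>\<close>, continuity at \<open>(\<Phi>, a)\<close> can be tested along sequences
\<open>(\<Phi>\<^sub>n, a\<^sub>n)\<close> whose distance to \<open>(\<Phi>, a)\<close> in the seminorms of index \<open>n + 1\<close> is below \<open>1 / (n + 1)\<close>,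
because the balls for these seminorms are open.  A compactly supported distribution \<open>u\<close> is
dominated by finitely many sup norms of derivatives over the compact support of a cutoff \<open>\<theta>\<close>.  So it is
enough that \<open>\<theta> \<cdot> \<^sup>tA\<^sub>n[\<psi>]\<close> converges uniformly, with all its derivatives, to
\<open>\<theta> \<cdot> \<^sup>tA[\<psi>]\<close>.

The difficulty is that every \<open>y\<close>-derivative of \<open>e\<^sup>i\<^sup>\<Phi>\<close> costs one power of \<open>\<xi>\<close>, whereas the
given \<open>\<kappa>\<close> only makes the undifferentiated integral converge.  The remedy is that the value of the
integral is the same for all larger \<open>\<kappa>\<close>: the transpose of \<open>L\<close> fixes \<open>e\<^sup>i\<^sup>\<Phi>\<close>, hence
\<open>e\<^sup>i\<^sup>\<Phi> (f - L f)\<close> is a divergence (\<open>divergence_identity\<close>), and an integrable divergence of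
integrable functions has integral zero (\<open>integral_pderiv1_eq_0\<close>, \<open>integral_by_parts\<close>).  As \<open>L\<close> lowers the order
of a symbol by \<open>min \<rho> (1 - \<delta>) > 0\<close> (\<open>osc_L_sym\<close>), a sufficiently large \<open>\<kappa>\<close> allows for any
prescribed number of \<open>y\<close>-derivatives under the integral sign.

Uniformity in \<open>n\<close> is obtained without estimating differences of oscillatory integrals.  A
sequence with its limit is one family indexed by the compact set \<open>{0} \<union> {1, 1/2, 1/3, \<dots>}\<close>, and
the symbol calculus is carried out for families that are jointly continuous in the parameter
and the point and satisfy bounds uniform in the parameter (\<open>symfam\<close>).  Such families are
closed under sums, products and inverses of elliptic symbols, and under composition with
\<open>s \<mapsto> e\<^sup>i\<^sup>s\<close> when derivatives are allowed to cost more; dominated convergence then gives that \<open>\<partial>\<^sup>k \<^sup>tA\<^sub>t[\<psi>\<^sub>t](y)\<close> is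
jointly continuous in \<open>(t, y)\<close> (\<open>FIO_transpose_family\<close>), and joint continuity on a compact set is
uniform.  The three ingredients enter the calculus separately: phases by homogeneity and
compactness of the sphere (\<open>phase_symfam\<close>), amplitudes by the Hoermander bounds
(\<open>amplitude_symfam\<close>), and test functions directly (\<open>test_symfam\<close>).

The test function is allowed to vary as well, for two further purposes.  The functional
\<open>A\<^bsub>\<Phi>,a\<^esub>[u]\<close> must be shown to be a distribution.  If its seminorm estimate failed on some
compact set, normalised counterexamples would be test functions that tend to zero although
their values under \<open>A\<^bsub>\<Phi>,a\<^esub>[u]\<close> are 1, against the same sequential continuity
(\<open>FIO_distribution\<close>).  Linearity in \<open>\<psi>\<close> is read off within a single family that contains
\<open>\<phi>\<close>, \<open>\<psi>\<close> and \<open>c \<phi> + \<psi>\<close> (\<open>pairing_linear\<close>).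
\<close>

section \<open>Partial derivatives\<close>

lemma pderiv1_has_derivative: "(f has_derivative f') (at z) \<Longrightarrow> pderiv1 v f z = f' v"
  unfolding pderiv1_def by (drule frechet_derivative_at) simp

lemma differentiable_cong_open:
  assumes "open S" "z \<in> S" "\<And>z. z \<in> S \<Longrightarrow> f z = g z"
  shows "f differentiable (at z) \<longleftrightarrow> g differentiable (at z)"
  using assms differentiable_transform_within by (metis has_derivative_transform_within_open differentiable_def)

lemma pderiv1_cong_open:
  assumes "open S" "z \<in> S" "\<And>z. z \<in> S \<Longrightarrow> f z = g z"
  shows "pderiv1 v f z = pderiv1 v g z"
proof (cases "f differentiable at z")
  case True
  then show ?thesis
    unfolding pderiv1_def
    using frechet_derivative_transform_within_open[OF _ assms(1,2)] assms(3) by metis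
next
  case False
  then have "\<not> g differentiable at z" using differentiable_cong_open[OF assms] by simp
  with False have "\<And>f'. \<not> (f has_derivative f') (at z)" "\<And>f'. \<not> (g has_derivative f') (at z)"
    by (auto simp: differentiable_def)
  then show ?thesis by (simp add: pderiv1_def frechet_derivative_def)
qed

lemma differentiable_has_pderiv1:
  "f differentiable (at z) \<Longrightarrow> (f has_derivative (\<lambda>v. pderiv1 v f z)) (at z)"
  unfolding pderiv1_def by (simp only: frechet_derivative_works)

lemma pderiv1_add:
  assumes "f differentiable (at z)" "g differentiable (at z)"
  shows "pderiv1 v (\<lambda>z. f z + g z) z = pderiv1 v f z + pderiv1 v g z"
  using pderiv1_has_derivative[OF has_derivative_add[OF assms[THEN differentiable_has_pderiv1]]] .

lemma pderiv1_mult: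
  fixes f g :: "_ \<Rightarrow> 'b::real_normed_algebra"
  assumes "f differentiable (at z)" "g differentiable (at z)"
  shows "pderiv1 v (\<lambda>z. f z * g z) z = f z * pderiv1 v g z + pderiv1 v f z * g z"
  using pderiv1_has_derivative[OF has_derivative_mult[OF assms[THEN differentiable_has_pderiv1]]] .

lemma pderiv1_const [simp]: "pderiv1 v (\<lambda>z. c) z = 0"
  by (simp add: pderiv1_def)

lemma pderiv1_zero_open:
  assumes "open S" "z \<in> S" "\<And>z. z \<in> S \<Longrightarrow> f z = 0"
  shows "pderiv1 v f z = 0"
  using pderiv1_cong_open[OF assms(1,2), of f "\<lambda>_. 0"] assms(3) by simp

lemma pderiv1_linear_comp:
  assumes "bounded_linear L" "f differentiable (at z)"
  shows "pderiv1 v (\<lambda>z. L (f z)) z = L (pderiv1 v f z)"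
  using pderiv1_has_derivative[OF bounded_linear.has_derivative[OF assms(1) differentiable_has_pderiv1[OF assms(2)]]] .

lemma differentiable_linear_comp:
  assumes "bounded_linear L" "f differentiable (at z)"
  shows "(\<lambda>z. L (f z)) differentiable (at z)"
  using bounded_linear.has_derivative[OF assms(1)] assms(2) unfolding differentiable_def by blast

lemma pderiv1_compose:
  assumes "(\<iota> has_derivative \<iota>') (at p)" "f differentiable (at (\<iota> p))"
  shows "pderiv1 v (\<lambda>p. f (\<iota> p)) p = pderiv1 (\<iota>' v) f (\<iota> p)"
    and "(\<lambda>p. f (\<iota> p)) differentiable (at p)"
proof -
  have *: "((\<lambda>p. f (\<iota> p)) has_derivative (\<lambda>v. pderiv1 (\<iota>' v) f (\<iota> p))) (at p)"
    using has_derivative_compose[OF assms(1) differentiable_has_pderiv1[OF assms(2)]] .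
  show "pderiv1 v (\<lambda>p. f (\<iota> p)) p = pderiv1 (\<iota>' v) f (\<iota> p)"
    using pderiv1_has_derivative[OF *] .
  show "(\<lambda>p. f (\<iota> p)) differentiable (at p)" using * differentiable_def by blast
qed

lemma pderivs_append: "pderivs (us @ vs) f = pderivs us (pderivs vs f)"
  by (induction us) auto

lemma pderivs_cong_open:
  assumes "open S" "z \<in> S" "\<And>z. z \<in> S \<Longrightarrow> f z = g z"
  shows "pderivs vs f z = pderivs vs g z"
  using assms(2)
proof (induction vs arbitrary: z)
  case (Cons v vs)
  show ?case by (simp, rule pderiv1_cong_open[OF assms(1) Cons.prems Cons.IH])
qed (simp add: assms)

lemma pderiv1_direction_diff:
  assumes "f differentiable (at z)"
  shows "linear (\<lambda>v. pderiv1 v f z)"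
  using assms differentiable_has_pderiv1 has_derivative_linear by blast

text \<open>Schwarz's theorem.  The second difference of \<open>f\<close> over a small parallelogram equals \<open>h\<^sup>2\<close> times
  either mixed derivative at some point of the parallelogram, by two applications of the mean
  value theorem in either order; continuity identifies the two limits.\<close>

lemma pderiv1_commute_real:
  fixes f :: "'a::euclidean_space \<Rightarrow> real"
  assumes S: "open S" "z \<in> S"
    and f: "\<And>z. z \<in> S \<Longrightarrow> f differentiable (at z)"
    and fu: "\<And>z. z \<in> S \<Longrightarrow> pderiv1 u f differentiable (at z)"
    and fv: "\<And>z. z \<in> S \<Longrightarrow> pderiv1 v f differentiable (at z)"
    and cuv: "continuous_on S (pderiv1 u (pderiv1 v f))"
    and cvu: "continuous_on S (pderiv1 v (pderiv1 u f))"
  shows "pderiv1 u (pderiv1 v f) z = pderiv1 v (pderiv1 u f) z"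
proof -
  have line: "((\<lambda>s. g (p + s *\<^sub>R a)) has_real_derivative pderiv1 a g (p + s *\<^sub>R a)) (at s)"
    if "g differentiable (at (p + s *\<^sub>R a))" for g :: "'a \<Rightarrow> real" and p s a
  proof -
    have "((\<lambda>s. p + s *\<^sub>R a) has_derivative (\<lambda>s. s *\<^sub>R a)) (at s)"
      by (auto intro!: derivative_eq_intros)
    from has_derivative_compose[OF this differentiable_has_pderiv1[OF that]]
    have "((\<lambda>s. g (p + s *\<^sub>R a)) has_derivative (\<lambda>r. pderiv1 (r *\<^sub>R a) g (p + s *\<^sub>R a))) (at s)" .
    moreover have "pderiv1 (r *\<^sub>R a) g (p + s *\<^sub>R a) = pderiv1 a g (p + s *\<^sub>R a) * r" for r
      using linear_cmul[OF pderiv1_direction_diff[OF that], of r a] by simp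
    ultimately show ?thesis by (simp add: has_field_derivative_def)
  qed
  have key: "\<exists>r\<in>{0<..<h}. \<exists>s\<in>{0<..<h}.
      f (z + h *\<^sub>R a + h *\<^sub>R b) - f (z + h *\<^sub>R a) - f (z + h *\<^sub>R b) + f z
        = h * h * pderiv1 b (pderiv1 a f) (z + r *\<^sub>R a + s *\<^sub>R b)"
    if h: "h > 0" and seg: "\<And>r s. 0 \<le> r \<Longrightarrow> r \<le> h \<Longrightarrow> 0 \<le> s \<Longrightarrow> s \<le> h \<Longrightarrow> z + r *\<^sub>R a + s *\<^sub>R b \<in> S"
      and fa: "\<And>z. z \<in> S \<Longrightarrow> pderiv1 a f differentiable (at z)" for h a b
  proof -
    define \<phi> where "\<phi> r = f (z + h *\<^sub>R b + r *\<^sub>R a) - f (z + r *\<^sub>R a)" for r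
    have "\<exists>r. 0 < r \<and> r < h \<and> \<phi> h - \<phi> 0 =
       (h - 0) * (pderiv1 a f (z + h *\<^sub>R b + r *\<^sub>R a) - pderiv1 a f (z + r *\<^sub>R a))"
    proof (rule MVT2[OF h])
      fix r assume r: "0 \<le> r" "r \<le> h"
      have "f differentiable at (z + h *\<^sub>R b + r *\<^sub>R a)" "f differentiable at (z + r *\<^sub>R a)"
        using f seg[OF r, of h] seg[OF r, of 0] h by (auto simp: algebra_simps)
      then show "(\<phi> has_real_derivative
          (pderiv1 a f (z + h *\<^sub>R b + r *\<^sub>R a) - pderiv1 a f (z + r *\<^sub>R a))) (at r)"
        unfolding \<phi>_def[abs_def] by (intro DERIV_diff line)
    qed
    then obtain r where r: "0 < r" "r < h" and e1: "\<phi> h - \<phi> 0 =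
       h * (pderiv1 a f (z + h *\<^sub>R b + r *\<^sub>R a) - pderiv1 a f (z + r *\<^sub>R a))" by auto
    have "\<exists>s. 0 < s \<and> s < h \<and>
        pderiv1 a f (z + r *\<^sub>R a + h *\<^sub>R b) - pderiv1 a f (z + r *\<^sub>R a + 0 *\<^sub>R b)
        = (h - 0) * pderiv1 b (pderiv1 a f) (z + r *\<^sub>R a + s *\<^sub>R b)"
      using r seg by (intro MVT2[OF h] line fa) auto
    then obtain s where s: "0 < s" "s < h" and
      e2: "pderiv1 a f (z + r *\<^sub>R a + h *\<^sub>R b) - pderiv1 a f (z + r *\<^sub>R a)
        = h * pderiv1 b (pderiv1 a f) (z + r *\<^sub>R a + s *\<^sub>R b)" by auto
    have "f (z + h *\<^sub>R a + h *\<^sub>R b) - f (z + h *\<^sub>R a) - f (z + h *\<^sub>R b) + f z = \<phi> h - \<phi> 0"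
      by (simp add: \<phi>_def algebra_simps)
    also have "\<dots> = h * h * pderiv1 b (pderiv1 a f) (z + r *\<^sub>R a + s *\<^sub>R b)"
      using e1 e2 by (simp add: algebra_simps)
    finally show ?thesis using r s by (intro bexI[of _ r] bexI[of _ s]) auto
  qed
  show ?thesis
  proof (rule ccontr)
    assume ne: "pderiv1 u (pderiv1 v f) z \<noteq> pderiv1 v (pderiv1 u f) z"
    define e where "e = \<bar>pderiv1 u (pderiv1 v f) z - pderiv1 v (pderiv1 u f) z\<bar> / 2"
    have e: "e > 0" using ne by (simp add: e_def)
    obtain d1 where d1: "d1 > 0" "\<And>z'. z' \<in> S \<Longrightarrow> dist z' z < d1 \<Longrightarrow>
        dist (pderiv1 u (pderiv1 v f) z') (pderiv1 u (pderiv1 v f) z) < e"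
      using cuv S e unfolding continuous_on_iff by metis
    obtain d2 where d2: "d2 > 0" "\<And>z'. z' \<in> S \<Longrightarrow> dist z' z < d2 \<Longrightarrow>
        dist (pderiv1 v (pderiv1 u f) z') (pderiv1 v (pderiv1 u f) z) < e"
      using cvu S e unfolding continuous_on_iff by metis
    obtain d3 where d3: "d3 > 0" "ball z d3 \<subseteq> S" using S open_contains_ball by blast
    define d where "d = Min {d1, d2, d3}"
    have d: "d > 0" "d \<le> d1" "d \<le> d2" "d \<le> d3" using d1 d2 d3 by (auto simp: d_def)
    define h where "h = d / (2 * (norm u + norm v + 1))"
    have N: "norm u + norm v + 1 > 0" by (smt (verit) norm_ge_zero)
    have h: "h > 0" using d N by (simp add: h_def)
    have nb: "dist (z + (r *\<^sub>R u + s *\<^sub>R v)) z < d" if "0 \<le> r" "r \<le> h" "0 \<le> s" "s \<le> h" for r s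
    proof -
      have "norm (r *\<^sub>R u + s *\<^sub>R v) \<le> h * norm u + h * norm v"
        using that by (intro norm_triangle_le add_mono) (auto simp: mult_right_mono)
      also have "\<dots> \<le> h * (norm u + norm v + 1)" using h by (simp add: algebra_simps)
      also have "\<dots> = d / 2" unfolding h_def times_divide_eq_left using N
        by (metis less_irrefl mult.commute nonzero_mult_divide_mult_cancel_left)
      also have "\<dots> < d" using d by simp
      finally show ?thesis by (simp add: dist_norm)
    qed
    have inS: "z + (r *\<^sub>R u + s *\<^sub>R v) \<in> S" if "0 \<le> r" "r \<le> h" "0 \<le> s" "s \<le> h" for r s
      using nb[OF that] d d3 by (auto simp: dist_commute subset_iff)
    obtain r s where rs: "r\<in>{0<..<h}" "s\<in>{0<..<h}" and
      1: "f (z + h *\<^sub>R u + h *\<^sub>R v) - f (z + h *\<^sub>R u) - f (z + h *\<^sub>R v) + f z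
        = h * h * pderiv1 v (pderiv1 u f) (z + r *\<^sub>R u + s *\<^sub>R v)"
      using key[OF h _ fu, of v] inS by (auto simp: add.assoc)
    obtain r' s' where rs': "r'\<in>{0<..<h}" "s'\<in>{0<..<h}" and
      2: "f (z + h *\<^sub>R v + h *\<^sub>R u) - f (z + h *\<^sub>R v) - f (z + h *\<^sub>R u) + f z
        = h * h * pderiv1 u (pderiv1 v f) (z + r' *\<^sub>R v + s' *\<^sub>R u)"
      using key[OF h _ fv, of u] inS by (auto simp: add.assoc add.commute[of "_ *\<^sub>R v" "_ *\<^sub>R u"])
    have eq: "pderiv1 v (pderiv1 u f) (z + (r *\<^sub>R u + s *\<^sub>R v)) = pderiv1 u (pderiv1 v f) (z + (s' *\<^sub>R u + r' *\<^sub>R v))"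
      using 1 2 h by (simp add: algebra_simps)
    have "dist (pderiv1 v (pderiv1 u f) (z + (r *\<^sub>R u + s *\<^sub>R v))) (pderiv1 v (pderiv1 u f) z) < e"
      using rs d nb[of r s] by (intro d2 inS) auto
    moreover have "dist (pderiv1 u (pderiv1 v f) (z + (s' *\<^sub>R u + r' *\<^sub>R v))) (pderiv1 u (pderiv1 v f) z) < e"
      using rs' d nb[of s' r'] by (intro d1 inS) auto
    ultimately show False
      unfolding eq e_def dist_real_def by (smt (verit) field_sum_of_halves)
  qed
qed

text \<open>The scalar case, applied to the coordinates of \<open>f\<close>.\<close>

lemma pderiv1_commute:
  fixes f :: "'a::euclidean_space \<Rightarrow> 'b::euclidean_space"
  assumes S: "open S" "z \<in> S"
    and f: "\<And>z. z \<in> S \<Longrightarrow> f differentiable (at z)"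
    and fu: "\<And>z. z \<in> S \<Longrightarrow> pderiv1 u f differentiable (at z)"
    and fv: "\<And>z. z \<in> S \<Longrightarrow> pderiv1 v f differentiable (at z)"
    and cuv: "continuous_on S (pderiv1 u (pderiv1 v f))"
    and cvu: "continuous_on S (pderiv1 v (pderiv1 u f))"
  shows "pderiv1 u (pderiv1 v f) z = pderiv1 v (pderiv1 u f) z"
proof (rule euclidean_eqI)
  fix b :: 'b assume "b \<in> Basis"
  have L: "bounded_linear (\<lambda>x::'b. x \<bullet> b)" by (rule bounded_linear_inner_left)
  let ?g = "\<lambda>z. f z \<bullet> b"
  have 1: "pderiv1 w ?g z = pderiv1 w f z \<bullet> b" if "z \<in> S" for w z
    by (rule pderiv1_linear_comp[OF L f[OF that]])
  have 2: "pderiv1 w (pderiv1 w' ?g) z = pderiv1 w (pderiv1 w' f) z \<bullet> b"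
    if "z \<in> S" "\<And>z. z \<in> S \<Longrightarrow> pderiv1 w' f differentiable (at z)" for w w' z
  proof -
    have "pderiv1 w (pderiv1 w' ?g) z = pderiv1 w (\<lambda>z. pderiv1 w' f z \<bullet> b) z"
      by (rule pderiv1_cong_open[OF S(1) that(1) 1])
    then show ?thesis using pderiv1_linear_comp[OF L that(2)[OF that(1)]] by simp
  qed
  have dw: "pderiv1 w' ?g differentiable (at z)"
    if "z \<in> S" "\<And>z. z \<in> S \<Longrightarrow> pderiv1 w' f differentiable (at z)" for w' z
    using differentiable_cong_open[OF S(1) that(1) 1] differentiable_linear_comp[OF L that(2)[OF that(1)]]
    by simp
  have "pderiv1 u (pderiv1 v ?g) z = pderiv1 v (pderiv1 u ?g) z"
  proof (rule pderiv1_commute_real[OF S])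
    show "continuous_on S (pderiv1 u (pderiv1 v ?g))"
      by (rule continuous_on_eq[OF continuous_on_inner[OF cuv continuous_on_const] 2[OF _ fv, symmetric]])
    show "continuous_on S (pderiv1 v (pderiv1 u ?g))"
      by (rule continuous_on_eq[OF continuous_on_inner[OF cvu continuous_on_const] 2[OF _ fu, symmetric]])
  qed (auto intro!: dw fu fv differentiable_linear_comp[OF L] f)
  then show "pderiv1 u (pderiv1 v f) z \<bullet> b = pderiv1 v (pderiv1 u f) z \<bullet> b"
    using 2[OF S(2) fv] 2[OF S(2) fu] by simp
qed

lemma smooth_on_pderivs:
  assumes "smooth_on S f" "vs \<in> lists Basis"
  shows "smooth_on S (pderivs vs f)"
  using assms unfolding smooth_on_def pderivs_append[symmetric] by auto

lemma smooth_on_pderiv1: "smooth_on S f \<Longrightarrow> v \<in> Basis \<Longrightarrow> smooth_on S (pderiv1 v f)"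
  using smooth_on_pderivs[of S f "[v]"] by simp

lemma smooth_on_differentiable: "smooth_on S f \<Longrightarrow> z \<in> S \<Longrightarrow> f differentiable (at z)"
  unfolding smooth_on_def by (metis lists.Nil pderivs.simps(1))

lemma smooth_on_continuous: "smooth_on S f \<Longrightarrow> continuous_on S f"
  by (meson continuous_at_imp_continuous_on differentiable_imp_continuous_within smooth_on_differentiable)

lemma smooth_on_subset: "smooth_on S f \<Longrightarrow> S' \<subseteq> S \<Longrightarrow> smooth_on S' f"
  unfolding smooth_on_def by blast

lemma smooth_on_cong:
  assumes "open S" "\<And>z. z \<in> S \<Longrightarrow> f z = g z"
  shows "smooth_on S f \<longleftrightarrow> smooth_on S g"
proof -
  have "pderivs vs f differentiable (at z) \<longleftrightarrow> pderivs vs g differentiable (at z)" if "z \<in> S" for vs z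
    by (rule differentiable_cong_open[OF assms(1) that pderivs_cong_open[OF assms(1) _ assms(2)]])
  then show ?thesis unfolding smooth_on_def by blast
qed

lemma pderivs_commute_1:
  fixes f :: "'a::euclidean_space \<Rightarrow> 'b::euclidean_space"
  assumes "open S" "z \<in> S" "smooth_on S f" "v \<in> Basis" "vs \<in> lists Basis"
  shows "pderivs (vs @ [v]) f z = pderivs (v # vs) f z"
  using assms(2,5)
proof (induction vs arbitrary: z)
  case (Cons a vs)
  have sm: "smooth_on S (pderivs vs f)" using smooth_on_pderivs assms Cons by auto
  have a: "a \<in> Basis" using Cons by simp
  have "pderivs ((a # vs) @ [v]) f z = pderiv1 a (pderivs (v # vs) f) z"
    using Cons by (auto intro!: pderiv1_cong_open[OF assms(1) \<open>z \<in> S\<close>])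
  also have "\<dots> = pderiv1 v (pderiv1 a (pderivs vs f)) z"
    unfolding pderivs.simps
    by (intro pderiv1_commute[OF assms(1) \<open>z \<in> S\<close>] smooth_on_continuous smooth_on_differentiable[of S]
         smooth_on_pderiv1 sm a assms)
  finally show ?case by simp
qed simp

text \<open>The seminorms take derivatives in the fixed order \<open>x\<close>, \<open>y\<close>, \<open>\<xi>\<close>, whereas iterating \<open>L\<close> produces
  derivatives in arbitrary order; this is the bridge between the two.\<close>

lemma pderivs_mset_eq:
  fixes f :: "'a::euclidean_space \<Rightarrow> 'b::euclidean_space"
  assumes "open S" "z \<in> S" "smooth_on S f" "vs \<in> lists Basis" "mset vs = mset us"
  shows "pderivs vs f z = pderivs us f z"
  using assms(2,4,5)
proof (induction vs arbitrary: us z)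
  case (Cons v vs)
  then have "v \<in> set us" by (metis list.set_intros(1) set_mset_mset)
  then obtain p q where us: "us = p @ v # q" by (meson split_list)
  have "set us = set (v # vs)" using Cons.prems(3) by (metis set_mset_mset)
  with Cons.prems(2) have uB: "us \<in> lists Basis" by (simp add: in_lists_conv_set)
  have eq: "mset vs = mset (p @ q)" using Cons.prems us by simp
  have "pderivs (v # vs) f z = pderiv1 v (pderivs (p @ q) f) z"
    unfolding pderivs.simps using Cons eq by (intro pderiv1_cong_open[OF assms(1) \<open>z \<in> S\<close>] Cons.IH) auto
  also have "\<dots> = pderivs (v # p) (pderivs q f) z" by (simp add: pderivs_append)
  also have "\<dots> = pderivs (p @ [v]) (pderivs q f) z"
    using uB us by (intro pderivs_commute_1[symmetric, OF assms(1) \<open>z \<in> S\<close>] smooth_on_pderivs assms) auto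
  also have "\<dots> = pderivs us f z" by (simp add: us pderivs_append)
  finally show ?case .
qed simp

lemma smooth_on_pderivs_differentiable:
  "smooth_on S f \<Longrightarrow> vs \<in> lists Basis \<Longrightarrow> z \<in> S \<Longrightarrow> pderivs vs f differentiable (at z)"
  by (simp add: smooth_on_def)

lemma pderivs_linear:
  fixes f g :: "'a::euclidean_space \<Rightarrow> 'b::real_normed_algebra"
  assumes S: "open S" and f: "smooth_on S f" and g: "smooth_on S g" and vs: "vs \<in> lists Basis" and z: "z \<in> S"
  shows "pderivs vs (\<lambda>z. c * f z + g z) z = c * pderivs vs f z + pderivs vs g z"
    and "pderivs vs (\<lambda>z. c * f z + g z) differentiable (at z)"
proof -
  have main: "\<forall>z\<in>S. pderivs vs (\<lambda>z. c * f z + g z) z = c * pderivs vs f z + pderivs vs g z"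
    if "vs \<in> lists Basis" for vs
    using that
  proof (induction vs)
    case (Cons v vs)
    show ?case
    proof
      fix z assume z: "z \<in> S"
      have d: "pderivs vs f differentiable (at z)" "pderivs vs g differentiable (at z)"
        using smooth_on_pderivs_differentiable[OF f Cons.hyps(2) z] smooth_on_pderivs_differentiable[OF g Cons.hyps(2) z] by auto
      have L: "bounded_linear ((*) c)" by (rule bounded_linear_mult_right)
      have "pderivs (v # vs) (\<lambda>z. c * f z + g z) z = pderiv1 v (\<lambda>z. c * pderivs vs f z + pderivs vs g z) z"
        using Cons by (auto intro!: pderiv1_cong_open[OF S z])
      also have "\<dots> = c * pderiv1 v (pderivs vs f) z + pderiv1 v (pderivs vs g) z"
        using d by (simp add: pderiv1_add differentiable_linear_comp[OF L] pderiv1_linear_comp[OF L])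
      finally show "pderivs (v # vs) (\<lambda>z. c * f z + g z) z = c * pderivs (v # vs) f z + pderivs (v # vs) g z"
        by simp
    qed
  qed simp
  then show "pderivs vs (\<lambda>z. c * f z + g z) z = c * pderivs vs f z + pderivs vs g z" using vs z by blast
  have d: "pderivs vs f differentiable (at z)" "pderivs vs g differentiable (at z)"
    using f g z vs by (auto simp: smooth_on_def)
  have "(\<lambda>z. c * pderivs vs f z + pderivs vs g z) differentiable (at z)"
    by (intro differentiable_add differentiable_linear_comp[OF bounded_linear_mult_right] d)
  then show "pderivs vs (\<lambda>z. c * f z + g z) differentiable (at z)"
    using differentiable_cong_open[OF S z, of "pderivs vs (\<lambda>z. c * f z + g z)"
        "\<lambda>z. c * pderivs vs f z + pderivs vs g z"] main[OF vs] by blast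
qed

lemma smooth_on_linear:
  fixes f g :: "'a::euclidean_space \<Rightarrow> 'b::real_normed_algebra"
  shows "open S \<Longrightarrow> smooth_on S f \<Longrightarrow> smooth_on S g \<Longrightarrow> smooth_on S (\<lambda>z. c * f z + g z)"
  unfolding smooth_on_def[of S "\<lambda>z. c * f z + g z"] using pderivs_linear(2) by blast

lemma pderivs_diff:
  fixes f g :: "'a::euclidean_space \<Rightarrow> 'b::real_normed_algebra_1"
  assumes "open S" "smooth_on S f" "smooth_on S g" "vs \<in> lists Basis" "z \<in> S"
  shows "pderivs vs (\<lambda>z. f z - g z) z = pderivs vs f z - pderivs vs g z"
  using pderivs_linear(1)[OF assms(1,3,2,4,5), of "-1"] by simp

lemma pderivs_zero: "pderivs vs (\<lambda>_. 0) = (\<lambda>_. 0)"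
proof (induction vs)
  case (Cons v vs)
  have "pderiv1 v (\<lambda>_. 0) = (\<lambda>_. 0)" by (rule ext) simp
  with Cons show ?case by simp
qed simp

section \<open>Parametrised families of symbols\<close>

text \<open>Joint continuity in the parameter and the point belongs to the bound: together they are the
  hypotheses of dominated convergence.\<close>

definition symbol_bound ::
  "'i::metric_space set \<Rightarrow> 'e::euclidean_space set \<Rightarrow> ('e \<Rightarrow> real) \<Rightarrow> real
    \<Rightarrow> ('i \<Rightarrow> 'e \<Rightarrow> 'b::real_normed_vector) \<Rightarrow> bool"
  where "symbol_bound T S J m f \<longleftrightarrow>
    continuous_on (T \<times> S) (\<lambda>(t, z). f t z) \<and>
    (\<exists>C. \<forall>t\<in>T. \<forall>z\<in>S. norm (f t z) \<le> C * J z powr m)"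

text \<open>A family of symbols: a derivative in direction \<open>b\<close> raises the order by \<open>w b\<close> with respect to the
  weight \<open>J\<close>, for up to \<open>k\<close> derivatives in directions from \<open>D\<close>.  The recursion on \<open>k\<close> (instead of bounds
  indexed by multi-indices) turns each closure property into an induction that uses the
  differentiation rule once, without Leibniz or Faa di Bruno formulas.

  With \<open>D = Basis\<close> and \<open>J = \<langle>\<xi>\<rangle>\<close> these are the usual symbol classes, the increments \<open>w\<close> being
  \<open>(\<delta>, -\<rho>)\<close> for amplitudes and \<open>(0, -1)\<close> for homogeneous functions away from \<open>\<xi> = 0\<close>.  When
  \<open>D\<close> consists of the \<open>y\<close>-directions, only derivatives under the integral sign are
  controlled.  The case \<open>J = 1\<close> gives bounded smooth families.\<close>

primrec symfam ::
  "'i::metric_space set \<Rightarrow> 'e::euclidean_space set \<Rightarrow> ('e \<Rightarrow> real) \<Rightarrow> 'e set \<Rightarrow> ('e \<Rightarrow> real)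
    \<Rightarrow> nat \<Rightarrow> real \<Rightarrow> ('i \<Rightarrow> 'e \<Rightarrow> 'b::real_normed_vector) \<Rightarrow> bool"
  where
    "symfam T S J D w 0 m f = symbol_bound T S J m f"
  | "symfam T S J D w (Suc k) m f =
      (symbol_bound T S J m f \<and> (\<forall>t\<in>T. \<forall>z\<in>S. f t differentiable (at z)) \<and>
       (\<forall>b\<in>D. symfam T S J D w k (m + w b) (\<lambda>t. pderiv1 b (f t))))"

abbreviation smooth_family ::
  "'i::metric_space set \<Rightarrow> 'e::euclidean_space set \<Rightarrow> nat \<Rightarrow> ('i \<Rightarrow> 'e \<Rightarrow> 'b::real_normed_vector) \<Rightarrow> bool"
  where "smooth_family T S k f \<equiv> symfam T S (\<lambda>_. 1) Basis (\<lambda>_. 0) k 0 f"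

lemma symfam_bound: "symfam T S J D w k m f \<Longrightarrow> symbol_bound T S J m f"
  by (cases k) auto

lemma symfam_differentiable:
  "symfam T S J D w (Suc k) m f \<Longrightarrow> t \<in> T \<Longrightarrow> z \<in> S \<Longrightarrow> f t differentiable (at z)"
  by simp

lemma symfam_pderiv1:
  "symfam T S J D w (Suc k) m f \<Longrightarrow> b \<in> D \<Longrightarrow> symfam T S J D w k (m + w b) (\<lambda>t. pderiv1 b (f t))"
  by simp

lemma symbol_boundE:
  assumes "symbol_bound T S J m f"
  obtains C where "C \<ge> 0" "\<And>t z. t \<in> T \<Longrightarrow> z \<in> S \<Longrightarrow> norm (f t z) \<le> C * J z powr m"
proof -
  obtain C where C: "\<forall>t\<in>T. \<forall>z\<in>S. norm (f t z) \<le> C * J z powr m"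
    using assms by (auto simp: symbol_bound_def)
  show thesis
  proof
    show "norm (f t z) \<le> max C 0 * J z powr m" if "t \<in> T" "z \<in> S" for t z
      using C that by (meson max.cobounded1 mult_right_mono order_trans powr_ge_zero)
  qed simp
qed

lemma symfam_Suc_imp: "symfam T S J D w (Suc k) m f \<Longrightarrow> symfam T S J D w k m f"
proof (induction k arbitrary: f m)
  case (Suc k)
  then show ?case by (metis symfam.simps(2))
qed simp

lemma symfam_le: "symfam T S J D w k m f \<Longrightarrow> k' \<le> k \<Longrightarrow> symfam T S J D w k' m f"
  by (induction k) (auto simp: le_Suc_eq simp del: symfam.simps dest: symfam_Suc_imp)

lemma symbol_bound_subset:
  assumes "symbol_bound T S J m f" "T' \<subseteq> T" "S' \<subseteq> S"
  shows "symbol_bound T' S' J m f"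
  using assms unfolding symbol_bound_def
  by (meson Sigma_mono continuous_on_subset subset_iff)

lemma symfam_subset:
  assumes "symfam T S J D w k m f" "T' \<subseteq> T" "S' \<subseteq> S" "D' \<subseteq> D"
  shows "symfam T' S' J D' w k m f"
  using assms(1)
proof (induction k arbitrary: f m)
  case 0 then show ?case using symbol_bound_subset assms by auto
next
  case (Suc k)
  then show ?case using symbol_bound_subset[of T S J m f T' S'] assms by (auto simp: subset_iff)
qed

lemma symbol_bound_Un:
  assumes "symbol_bound T S J m f" "symbol_bound T S' J m f" "open S" "open S'"
  shows "symbol_bound T (S \<union> S') J m f"
proof -
  obtain C where C: "C \<ge> 0" "\<And>t z. t \<in> T \<Longrightarrow> z \<in> S \<Longrightarrow> norm (f t z) \<le> C * J z powr m"
    using assms symbol_boundE by blast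
  obtain C' where C': "C' \<ge> 0" "\<And>t z. t \<in> T \<Longrightarrow> z \<in> S' \<Longrightarrow> norm (f t z) \<le> C' * J z powr m"
    using assms symbol_boundE by blast
  have "norm (f t z) \<le> (C + C') * J z powr m" if "t \<in> T" "z \<in> S \<union> S'" for t z
  proof -
    have "C * J z powr m \<le> (C + C') * J z powr m" "C' * J z powr m \<le> (C + C') * J z powr m"
      using C C' by (auto simp: distrib_right)
    then show ?thesis using that C C' by (meson UnE order_trans)
  qed
  moreover have "continuous_on (T \<times> S \<union> T \<times> S') (\<lambda>(t, z). f t z)"
  proof -
    have *: "\<exists>A. open A \<and> A \<inter> (T \<times> S \<union> T \<times> S') = T \<times> U" if "open U" "U \<subseteq> S \<union> S'" for U
      using that by (intro exI[of _ "UNIV \<times> U"]) (auto intro: open_Times)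
    have "openin (top_of_set (T \<times> S \<union> T \<times> S')) (T \<times> S)"
      "openin (top_of_set (T \<times> S \<union> T \<times> S')) (T \<times> S')"
      using *[of S] *[of S'] assms(3,4) by (auto simp: openin_open)
    then show ?thesis
      using assms(1,2) unfolding symbol_bound_def by (blast intro: continuous_on_Un_local_open)
  qed
  ultimately show ?thesis unfolding symbol_bound_def by (auto simp: Sigma_Un_distrib2)
qed

text \<open>Phases are singular at \<open>\<xi> = 0\<close> while the coefficients of \<open>L\<close> vanish there, so symbols are
  estimated separately near and away from the origin.\<close>

lemma symfam_Un:
  assumes "symfam T S J D w k m f" "symfam T S' J D w k m f" "open S" "open S'"
  shows "symfam T (S \<union> S') J D w k m f"
  using assms(1,2)
proof (induction k arbitrary: f m)
  case 0 then show ?case using symbol_bound_Un assms by auto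
next
  case (Suc k)
  then show ?case using symbol_bound_Un[of T S J m f S'] assms by auto
qed

locale weighted_region =
  fixes T :: "'i::metric_space set" and S :: "'e::euclidean_space set"
    and J :: "'e \<Rightarrow> real" and D :: "'e set"
  assumes open_S: "open S" and J_ge1: "\<And>z. z \<in> S \<Longrightarrow> 1 \<le> J z"
begin

abbreviation "bnd \<equiv> symbol_bound T S J"
abbreviation "symb \<equiv> symfam T S J D"

lemma bnd_mono:
  assumes "bnd m f" "m \<le> m'" shows "bnd m' f"
proof -
  obtain C where C: "C \<ge> 0" "\<And>t z. t \<in> T \<Longrightarrow> z \<in> S \<Longrightarrow> norm (f t z) \<le> C * J z powr m"
    using assms symbol_boundE by blast
  have "norm (f t z) \<le> C * J z powr m'" if "t \<in> T" "z \<in> S" for t z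
    using C(2)[OF that] C(1) powr_mono[OF assms(2) J_ge1[OF that(2)]]
    by (meson mult_left_mono order_trans)
  then show ?thesis using assms unfolding symbol_bound_def by blast
qed

lemma sym_mono:
  assumes "symb w k m f" "m \<le> m'" "\<And>b. b \<in> D \<Longrightarrow> w b \<le> w' b"
  shows "symb w' k m' f"
  using assms(1,2)
proof (induction k arbitrary: f m m')
  case 0 then show ?case using bnd_mono by auto
next
  case (Suc k)
  have "symb w' k (m' + w' b) (\<lambda>t. pderiv1 b (f t))" if "b \<in> D" for b
    using Suc.prems that assms(3)[OF that] by (intro Suc.IH[of "m + w b"]) auto
  then show ?case using Suc.prems bnd_mono by auto
qed

lemma bnd_cong:
  assumes "\<And>t z. t \<in> T \<Longrightarrow> z \<in> S \<Longrightarrow> f t z = g t z"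
  shows "bnd m f \<longleftrightarrow> bnd m g"
proof -
  have "continuous_on (T \<times> S) (\<lambda>(t, z). f t z) \<longleftrightarrow> continuous_on (T \<times> S) (\<lambda>(t, z). g t z)"
    using assms by (intro continuous_on_cong) auto
  then show ?thesis using assms by (simp add: symbol_bound_def)
qed

lemma sym_cong_imp:
  assumes "symb w k m f" "\<And>t z. t \<in> T \<Longrightarrow> z \<in> S \<Longrightarrow> f t z = g t z"
  shows "symb w k m g"
  using assms
proof (induction k arbitrary: f g m)
  case 0 then show ?case using bnd_cong[of f g m] by auto
next
  case (Suc k)
  have "symb w k (m + w b) (\<lambda>t. pderiv1 b (g t))" if "b \<in> D" for b
  proof (rule Suc.IH[OF symfam_pderiv1[OF Suc.prems(1) that]])
    show "pderiv1 b (f t) z = pderiv1 b (g t) z" if "t \<in> T" "z \<in> S" for t z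
      using Suc.prems(2) that by (intro pderiv1_cong_open[OF open_S]) auto
  qed
  moreover have "g t differentiable at z" if "t \<in> T" "z \<in> S" for t z
    using Suc.prems that differentiable_cong_open[OF open_S that(2), of "f t" "g t"] by auto
  ultimately show ?case using Suc.prems bnd_cong[of f g m] by auto
qed

lemma sym_zero: "symb w k m (\<lambda>t z. 0::'c::real_normed_vector)"
proof (induction k arbitrary: m)
  case 0 show ?case by (auto simp: symbol_bound_def intro!: exI[of _ 0])
next
  case (Suc k)
  have "pderiv1 b (\<lambda>z. 0::'c) = (\<lambda>z. 0)" for b :: 'e by auto
  then show ?case using Suc by (auto simp: symbol_bound_def intro!: exI[of _ 0])
qed

lemma sym_const: "0 \<le> m \<Longrightarrow> symb w k m (\<lambda>t z. c)"
proof -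
  have b: "bnd 0 (\<lambda>t z. c)"
    using J_ge1 by (fastforce simp: symbol_bound_def intro!: exI[of _ "norm c"])
  have "symb w k 0 (\<lambda>t z. c)"
  proof (cases k)
    case (Suc k')
    have "pderiv1 b (\<lambda>z. c) = (\<lambda>z. 0)" for b :: 'e by auto
    then show ?thesis using Suc b by (simp add: sym_zero)
  qed (use b in simp)
  then show "0 \<le> m \<Longrightarrow> symb w k m (\<lambda>t z. c)" using sym_mono by blast
qed

lemma bnd_add:
  assumes "bnd m f" "bnd m g" shows "bnd m (\<lambda>t z. f t z + g t z)"
proof -
  obtain C where C: "C \<ge> 0" "\<And>t z. t \<in> T \<Longrightarrow> z \<in> S \<Longrightarrow> norm (f t z) \<le> C * J z powr m"
    using assms symbol_boundE by blast
  obtain C' where C': "C' \<ge> 0" "\<And>t z. t \<in> T \<Longrightarrow> z \<in> S \<Longrightarrow> norm (g t z) \<le> C' * J z powr m"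
    using assms symbol_boundE by blast
  have "norm (f t z + g t z) \<le> (C + C') * J z powr m" if "t \<in> T" "z \<in> S" for t z
    using norm_triangle_mono[OF C(2)[OF that] C'(2)[OF that]] by (simp add: distrib_right)
  moreover have "continuous_on (T \<times> S) (\<lambda>(t, z). f t z + g t z)"
    using assms continuous_on_add[of "T \<times> S" "\<lambda>(t, z). f t z" "\<lambda>(t, z). g t z"]
    by (auto simp: symbol_bound_def case_prod_unfold)
  ultimately show ?thesis unfolding symbol_bound_def by blast
qed

lemma sym_add:
  "symb w k m f \<Longrightarrow> symb w k m g \<Longrightarrow> symb w k m (\<lambda>t z. f t z + g t z)"
proof (induction k arbitrary: f g m)
  case 0 then show ?case using bnd_add by auto
next
  case (Suc k)
  have "symb w k (m + w b) (\<lambda>t. pderiv1 b (\<lambda>z. f t z + g t z))" if "b \<in> D" for b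
    by (rule sym_cong_imp[OF Suc.IH[of "m + w b" "\<lambda>t. pderiv1 b (f t)" "\<lambda>t. pderiv1 b (g t)"]])
      (use Suc.prems that in \<open>auto simp: pderiv1_add\<close>)
  then show ?case using Suc.prems bnd_add by auto
qed

lemma bnd_mult:
  fixes f g :: "'i \<Rightarrow> 'e \<Rightarrow> 'b::real_normed_algebra"
  assumes "bnd m f" "bnd m' g" shows "bnd (m + m') (\<lambda>t z. f t z * g t z)"
proof -
  obtain C where C: "C \<ge> 0" "\<And>t z. t \<in> T \<Longrightarrow> z \<in> S \<Longrightarrow> norm (f t z) \<le> C * J z powr m"
    using assms symbol_boundE by blast
  obtain C' where C': "C' \<ge> 0" "\<And>t z. t \<in> T \<Longrightarrow> z \<in> S \<Longrightarrow> norm (g t z) \<le> C' * J z powr m'"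
    using assms symbol_boundE by blast
  have "norm (f t z * g t z) \<le> (C * C') * J z powr (m + m')" if "t \<in> T" "z \<in> S" for t z
  proof -
    have "norm (f t z * g t z) \<le> (C * J z powr m) * (C' * J z powr m')"
      using C(2)[OF that] C'(2)[OF that] C(1)
      by (meson mult_mono' norm_ge_zero norm_mult_ineq order_trans)
    then show ?thesis by (simp add: powr_add mult_ac)
  qed
  moreover have "continuous_on (T \<times> S) (\<lambda>(t, z). f t z * g t z)"
    using assms continuous_on_mult[of "T \<times> S" "\<lambda>(t, z). f t z" "\<lambda>(t, z). g t z"]
    by (auto simp: symbol_bound_def case_prod_unfold)
  ultimately show ?thesis unfolding symbol_bound_def by blast
qed

lemma sym_mult:
  fixes f g :: "'i \<Rightarrow> 'e \<Rightarrow> 'b::real_normed_algebra"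
  shows "symb w k m f \<Longrightarrow> symb w k m' g \<Longrightarrow> symb w k (m + m') (\<lambda>t z. f t z * g t z)"
proof (induction k arbitrary: f g m m')
  case 0 then show ?case using bnd_mult by auto
next
  case (Suc k)
  have "symb w k (m + m' + w b) (\<lambda>t. pderiv1 b (\<lambda>z. f t z * g t z))" if "b \<in> D" for b
  proof (rule sym_cong_imp[OF sym_add])
    show "symb w k (m + m' + w b) (\<lambda>t z. f t z * pderiv1 b (g t) z)"
      using Suc.IH[OF symfam_Suc_imp[OF Suc.prems(1)] symfam_pderiv1[OF Suc.prems(2) that]]
      by (simp add: add.assoc)
    show "symb w k (m + m' + w b) (\<lambda>t z. pderiv1 b (f t) z * g t z)"
      using Suc.IH[OF symfam_pderiv1[OF Suc.prems(1) that] symfam_Suc_imp[OF Suc.prems(2)]]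
      by (simp add: ac_simps)
  qed (use Suc.prems in \<open>auto simp: pderiv1_mult\<close>)
  then show ?case using Suc.prems bnd_mult by auto
qed

lemma sym_mult':
  fixes f g :: "'i \<Rightarrow> 'e \<Rightarrow> 'b::real_normed_algebra"
  shows "symb w k m f \<Longrightarrow> symb w k m' g \<Longrightarrow> n = m + m' \<Longrightarrow> symb w k n (\<lambda>t z. f t z * g t z)"
  using sym_mult by blast

lemma sym_linear:
  assumes L: "bounded_linear L"
  shows "symb w k m f \<Longrightarrow> symb w k m (\<lambda>t z. L (f t z))"
proof (induction k arbitrary: f m)
  case 0
  obtain C where C: "C \<ge> 0" "\<And>t z. t \<in> T \<Longrightarrow> z \<in> S \<Longrightarrow> norm (f t z) \<le> C * J z powr m"
    using 0 symbol_boundE by (metis symfam.simps(1))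
  obtain B where B: "B \<ge> 0" "\<And>x. norm (L x) \<le> norm x * B"
    using bounded_linear.nonneg_bounded[OF L] by blast
  have "norm (L (f t z)) \<le> (C * B) * J z powr m" if "t \<in> T" "z \<in> S" for t z
    using B(2)[of "f t z"] mult_right_mono[OF C(2)[OF that] B(1)] by (simp add: mult_ac)
  moreover have "continuous_on (T \<times> S) (\<lambda>(t, z). L (f t z))"
    using 0 bounded_linear.continuous_on[OF L, of "T \<times> S" "\<lambda>(t, z). f t z"]
    by (auto simp: symbol_bound_def case_prod_unfold)
  ultimately show ?case unfolding symfam.simps symbol_bound_def by blast
next
  case (Suc k)
  have "symfam T S J D w k (m + w b) (\<lambda>t. pderiv1 b (\<lambda>z. L (f t z)))" if "b \<in> D" for b
    by (rule sym_cong_imp[OF Suc.IH[of "m + w b" "\<lambda>t. pderiv1 b (f t)"]])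
      (use Suc.prems that in \<open>auto simp: pderiv1_linear_comp[OF L]\<close>)
  moreover have "bnd m (\<lambda>t z. L (f t z))"
    using symfam_bound[OF Suc.IH[OF symfam_Suc_imp[OF Suc.prems]]] .
  ultimately show ?case using Suc.prems by (auto intro: differentiable_linear_comp[OF L])
qed

lemma sym_uminus: "symb w k m f \<Longrightarrow> symb w k m (\<lambda>t z. - f t z)"
  by (rule sym_linear[OF bounded_linear_minus[OF bounded_linear_ident]])

lemma sym_diff: "symb w k m f \<Longrightarrow> symb w k m g \<Longrightarrow> symb w k m (\<lambda>t z. f t z - g t z)"
  using sym_add[OF _ sym_uminus] by fastforce

lemma sym_sum:
  assumes "\<And>i. i \<in> I \<Longrightarrow> symb w k m (f i)"
  shows "symb w k m (\<lambda>t z. \<Sum>i\<in>I. f i t z)"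
  using assms by (induction I rule: infinite_finite_induct) (auto intro: sym_zero sym_add)

text \<open>The derivative of \<open>1 / f\<close> is \<open>- f' \<cdot> (1 / f)\<^sup>2\<close>, which expresses the induction step through the
  induction hypothesis and products.\<close>

lemma sym_inverse:
  fixes f :: "'i \<Rightarrow> 'e \<Rightarrow> real"
  assumes "symb w k m f" "c > 0" and lb: "\<And>t z. t \<in> T \<Longrightarrow> z \<in> S \<Longrightarrow> c * J z powr m \<le> f t z"
  shows "symb w k (- m) (\<lambda>t z. inverse (f t z))"
proof -
  have pos: "f t z > 0" if "t \<in> T" "z \<in> S" for t z
    using lb[OF that] J_ge1[OF that(2)] assms(2) by (smt (verit) mult_pos_pos powr_gt_zero)
  have b: "bnd (- m) (\<lambda>t z. inverse (f t z))" if "bnd m f"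
  proof -
    have "norm (inverse (f t z)) \<le> inverse c * J z powr (- m)" if "t \<in> T" "z \<in> S" for t z
    proof -
      have "inverse (f t z) \<le> inverse (c * J z powr m)"
        using lb[OF that] J_ge1[OF that(2)] assms(2) by (intro le_imp_inverse_le) auto
      then show ?thesis using pos[OF that] by (simp add: powr_minus)
    qed
    moreover have "continuous_on (T \<times> S) (\<lambda>(t, z). inverse (f t z))"
      using that pos continuous_on_inverse[of "T \<times> S" "\<lambda>(t, z). f t z"]
      by (force simp: symbol_bound_def case_prod_unfold)
    ultimately show ?thesis unfolding symbol_bound_def by blast
  qed
  show ?thesis using assms(1)
  proof (induction k)
    case 0 then show ?case using b by simp
  next
    case (Suc k)
    have hd: "((\<lambda>z. inverse (f t z)) has_derivative
        (\<lambda>v. - (inverse (f t z) * pderiv1 v (f t) z * inverse (f t z)))) (at z)"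
      if "t \<in> T" "z \<in> S" for t z
      using pos[OF that] Suc.prems that
      by (intro Deriv.has_derivative_inverse differentiable_has_pderiv1) auto
    have "symb w k (- m + w b') (\<lambda>t. pderiv1 b' (\<lambda>z. inverse (f t z)))" if "b' \<in> D" for b'
    proof (rule sym_cong_imp)
      have i: "symb w k (- m) (\<lambda>t z. inverse (f t z))" using Suc symfam_Suc_imp by blast
      have "symb w k (- m + (m + w b') + - m) (\<lambda>t z. inverse (f t z) * pderiv1 b' (f t) z * inverse (f t z))"
        by (intro sym_mult i symfam_pderiv1[OF Suc.prems that])
      then show "symb w k (- m + w b') (\<lambda>t z. - (inverse (f t z) * pderiv1 b' (f t) z * inverse (f t z)))"
        using sym_uminus by (simp add: algebra_simps)
    qed (use pderiv1_has_derivative[OF hd] in auto)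
    moreover have "(\<lambda>z. inverse (f t z)) differentiable at z" if "t \<in> T" "z \<in> S" for t z
      using hd[OF that] differentiable_def by blast
    ultimately show ?case using b Suc.prems by auto
  qed
qed

text \<open>The exponential reproduces itself: \<open>\<partial>\<^sub>b e\<^sup>i\<^sup>\<Phi> = i \<partial>\<^sub>b\<Phi> e\<^sup>i\<^sup>\<Phi>\<close>, so the order grows in direction
  \<open>b\<close> by the order of \<open>\<partial>\<^sub>b\<Phi>\<close>.\<close>

lemma sym_cis:
  fixes \<Phi> :: "'i \<Rightarrow> 'e \<Rightarrow> real"
  assumes cont: "continuous_on (T \<times> S) (\<lambda>(t, z). \<Phi> t z)"
    and diff: "\<And>t z. t \<in> T \<Longrightarrow> z \<in> S \<Longrightarrow> \<Phi> t differentiable (at z)"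
    and der: "\<And>b. b \<in> D \<Longrightarrow> symb w k (w b) (\<lambda>t. pderiv1 b (\<Phi> t))"
  shows "symb w (Suc k) 0 (\<lambda>t z. exp (\<i> * of_real (\<Phi> t z)))"
proof -
  let ?e = "\<lambda>t z. exp (\<i> * of_real (\<Phi> t z))"
  have b: "bnd 0 ?e"
  proof -
    have "continuous_on (T \<times> S) (\<lambda>(t, z). ?e t z)"
      using cont by (auto simp: case_prod_unfold intro!: continuous_intros)
    moreover have "norm (?e t z) \<le> 1 * J z powr 0" if "z \<in> S" for t z
      using J_ge1[OF that] by simp
    ultimately show ?thesis unfolding symbol_bound_def by blast
  qed
  have hd: "((\<lambda>z. ?e t z) has_derivative (\<lambda>v. \<i> * of_real (pderiv1 v (\<Phi> t) z) * ?e t z)) (at z)"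
    if "t \<in> T" "z \<in> S" for t z
  proof -
    have "((\<lambda>z. \<i> * of_real (\<Phi> t z)) has_derivative (\<lambda>v. \<i> * of_real (pderiv1 v (\<Phi> t) z))) (at z)"
      by (intro has_derivative_mult_right has_derivative_of_real differentiable_has_pderiv1 diff that)
    from has_derivative_compose[OF this DERIV_exp[unfolded has_field_derivative_def]]
    show ?thesis by (simp add: mult_ac)
  qed
  have d: "?e t differentiable at z" if "t \<in> T" "z \<in> S" for t z
    using hd[OF that] differentiable_def by blast
  have "symb w j 0 ?e" if "j \<le> Suc k" for j
    using that
  proof (induction j)
    case 0 then show ?case using b by simp
  next
    case (Suc j)
    have "symb w j (w b) (\<lambda>t. pderiv1 b (?e t))" if "b \<in> D" for b
    proof (rule sym_cong_imp)
      have "symb w j (0 + w b + 0) (\<lambda>t z. \<i> * of_real (pderiv1 b (\<Phi> t) z) * ?e t z)"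
        using Suc by (intro sym_mult sym_const sym_linear[OF bounded_linear_of_real] symfam_le[OF der[OF that]]) auto
      then show "symb w j (w b) (\<lambda>t z. \<i> * of_real (pderiv1 b (\<Phi> t) z) * ?e t z)" by simp
    qed (simp add: pderiv1_has_derivative[OF hd])
    then show ?case using b d by (subst symfam.simps) auto
  qed
  then show ?thesis by blast
qed

text \<open>Seminorms control all mixed derivatives at once; this converts such bounds into the recursive
  form.\<close>

lemma sym_pderivsI:
  assumes "\<And>vs. vs \<in> lists D \<Longrightarrow> bnd (m + sum_list (map w vs)) (\<lambda>t. pderivs vs (f t))"
    and "\<And>vs t z. vs \<in> lists D \<Longrightarrow> t \<in> T \<Longrightarrow> z \<in> S \<Longrightarrow> pderivs vs (f t) differentiable (at z)"
  shows "symb w k m f"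
  using assms
proof (induction k arbitrary: f m)
  case 0
  then show ?case using "0.prems"(1)[of "[]"] by simp
next
  case (Suc k)
  have "symb w k (m + w b) (\<lambda>t. pderiv1 b (f t))" if "b \<in> D" for b
  proof (rule Suc.IH)
    show "bnd (m + w b + sum_list (map w vs)) (\<lambda>t. pderivs vs (pderiv1 b (f t)))" if "vs \<in> lists D" for vs
      using Suc.prems(1)[of "vs @ [b]"] that \<open>b \<in> D\<close> by (simp add: pderivs_append algebra_simps)
    show "pderivs vs (pderiv1 b (f t)) differentiable (at z)" if "vs \<in> lists D" "t \<in> T" "z \<in> S" for vs t z
      using Suc.prems(2)[of "vs @ [b]"] that \<open>b \<in> D\<close> by (simp add: pderivs_append)
  qed
  then show ?case using Suc.prems(1)[of "[]"] Suc.prems(2)[of "[]"] by auto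
qed

lemma sym_pderivsD:
  assumes "symb w k m f" "vs \<in> lists D" "length vs \<le> k"
  shows "symb w (k - length vs) (m + sum_list (map w vs)) (\<lambda>t. pderivs vs (f t))"
  using assms
proof (induction vs)
  case (Cons v vs)
  then have 1: "symb w (k - length vs) (m + sum_list (map w vs)) (\<lambda>t. pderivs vs (f t))" by auto
  obtain j where j: "k - length vs = Suc j"
    using Cons.prems by (metis Suc_diff_Suc Suc_le_lessD length_Cons)
  have "symb w j (m + sum_list (map w vs) + w v) (\<lambda>t. pderiv1 v (pderivs vs (f t)))"
    using 1 Cons.prems unfolding j by auto
  moreover have "k - length (v # vs) = j" using j by simp
  ultimately show ?case by (simp add: algebra_simps)
qed simp

lemma sym_smooth_on:
  assumes "\<And>k. symb w k m f" "D = Basis" "t \<in> T"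
  shows "smooth_on S (f t)"
  unfolding smooth_on_def
proof (intro ballI)
  fix vs :: "'e list" and z assume vs: "vs \<in> lists Basis" and z: "z \<in> S"
  have "symb w (Suc (length vs) - length vs) (m + sum_list (map w vs)) (\<lambda>t. pderivs vs (f t))"
    using vs assms(2) by (intro sym_pderivsD assms(1)) auto
  then show "pderivs vs (f t) differentiable at z" using assms z by (simp add: Suc_diff_le)
qed

end

section \<open>Integrals depending on a parameter\<close>

lemma continuous_on_parametric_integral:
  fixes g :: "'p::metric_space \<Rightarrow> 'a \<Rightarrow> 'b::{banach, second_countable_topology}"
  assumes w: "integrable M w"
    and meas: "\<And>p. p \<in> P \<Longrightarrow> g p \<in> borel_measurable M"
    and bnd: "\<And>p a. p \<in> P \<Longrightarrow> a \<in> space M \<Longrightarrow> norm (g p a) \<le> w a"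
    and cont: "\<And>a. a \<in> space M \<Longrightarrow> continuous_on P (\<lambda>p. g p a)"
  shows "continuous_on P (\<lambda>p. \<integral>a. g p a \<partial>M)"
proof (rule continuous_on_sequentiallyI)
  fix u p assume u: "\<forall>n. u n \<in> P" and p: "p \<in> P" and lim: "u \<longlonglongrightarrow> p"
  show "(\<lambda>n. \<integral>a. g (u n) a \<partial>M) \<longlonglongrightarrow> (\<integral>a. g p a \<partial>M)"
  proof (rule integral_dominated_convergence[where w = w])
    show "AE a in M. (\<lambda>n. g (u n) a) \<longlonglongrightarrow> g p a"
    proof (rule AE_I2)
      fix a assume "a \<in> space M"
      from cont[OF this] have "(\<lambda>n. ((\<lambda>p. g p a) \<circ> u) n) \<longlonglongrightarrow> g p a"
        using u p lim unfolding continuous_on_sequentially by blast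
      then show "(\<lambda>n. g (u n) a) \<longlonglongrightarrow> g p a" by simp
    qed
  qed (use u p in \<open>auto intro!: meas bnd w\<close>)
qed

text \<open>Difference quotients are dominated through the mean value inequality on a ball, with the
  bound on the partial derivatives as Lipschitz constant; dominated convergence does the rest.\<close>

lemma has_derivative_parametric_integral:
  fixes g :: "'y::euclidean_space \<Rightarrow> 'a \<Rightarrow> 'b::{banach, second_countable_topology}"
  assumes Y: "open Y" "y0 \<in> Y" and w: "integrable M w"
    and int: "\<And>y. y \<in> Y \<Longrightarrow> integrable M (g y)"
    and diff: "\<And>y a. y \<in> Y \<Longrightarrow> a \<in> space M \<Longrightarrow> (\<lambda>y. g y a) differentiable (at y)"
    and meas: "\<And>b. b \<in> Basis \<Longrightarrow> (\<lambda>a. pderiv1 b (\<lambda>y. g y a) y0) \<in> borel_measurable M"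
    and bnd: "\<And>b y a. b \<in> Basis \<Longrightarrow> y \<in> Y \<Longrightarrow> a \<in> space M \<Longrightarrow> norm (pderiv1 b (\<lambda>y. g y a) y) \<le> w a"
  shows "((\<lambda>y. \<integral>a. g y a \<partial>M) has_derivative
    (\<lambda>v. \<Sum>b\<in>Basis. (v \<bullet> b) *\<^sub>R (\<integral>a. pderiv1 b (\<lambda>y. g y a) y0 \<partial>M))) (at y0)"
proof -
  define D where "D v a y = pderiv1 v (\<lambda>y. g y a) y" for v a y
  have Dsum: "D v a y = (\<Sum>b\<in>Basis. (v \<bullet> b) *\<^sub>R D b a y)" if "y \<in> Y" "a \<in> space M" for v a y
  proof -
    have l: "linear (\<lambda>v. D v a y)"
      unfolding D_def using pderiv1_direction_diff[OF diff[OF that]] .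
    have "D v a y = D (\<Sum>b\<in>Basis. (v \<bullet> b) *\<^sub>R b) a y" by (simp add: euclidean_representation)
    also have "\<dots> = (\<Sum>b\<in>Basis. (v \<bullet> b) *\<^sub>R D b a y)"
      using linear_sum[OF l, of "\<lambda>b. (v \<bullet> b) *\<^sub>R b" Basis] linear_cmul[OF l] by simp
    finally show ?thesis .
  qed
  have Dint: "integrable M (\<lambda>a. D b a y0)" if "b \<in> Basis" for b
    using meas[OF that] bnd[OF that Y(2)] unfolding D_def
    by (intro Bochner_Integration.integrable_bound[OF w]) (auto intro!: AE_I2 order_trans[OF bnd] Y that)
  have Dvint: "integrable M (\<lambda>a. D v a y0)" for v
  proof -
    have "integrable M (\<lambda>a. \<Sum>b\<in>Basis. (v \<bullet> b) *\<^sub>R D b a y0)" using Dint by auto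
    then show ?thesis by (rule Bochner_Integration.integrable_cong[THEN iffD1, rotated -1]) (auto intro!: Dsum[OF Y(2)] Dsum[OF Y(2), symmetric])
  qed
  have Dval: "(\<integral>a. D v a y0 \<partial>M) = (\<Sum>b\<in>Basis. (v \<bullet> b) *\<^sub>R (\<integral>a. D b a y0 \<partial>M))" for v
  proof -
    have "(\<integral>a. D v a y0 \<partial>M) = (\<integral>a. (\<Sum>b\<in>Basis. (v \<bullet> b) *\<^sub>R D b a y0) \<partial>M)"
      by (rule Bochner_Integration.integral_cong) (auto intro!: Dsum[OF Y(2)] Dsum[OF Y(2), symmetric])
    also have "\<dots> = (\<Sum>b\<in>Basis. (v \<bullet> b) *\<^sub>R (\<integral>a. D b a y0 \<partial>M))"
      using Dint by (simp add: Bochner_Integration.integral_sum)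
    finally show ?thesis .
  qed
  let ?n = "real DIM('y)"
  have Dbound: "norm (D v a y) \<le> ?n * w a * norm v" if "y \<in> Y" "a \<in> space M" for v a y
  proof -
    have "norm (D v a y) \<le> (\<Sum>b\<in>Basis. norm ((v \<bullet> b) *\<^sub>R D b a y))"
      by (subst Dsum[OF that]) (rule norm_sum)
    also have "\<dots> \<le> (\<Sum>b\<in>(Basis::'y set). norm v * w a)"
      using bnd that unfolding D_def
      by (intro sum_mono) (auto intro!: mult_mono Basis_le_norm)
    finally show ?thesis by (simp add: mult_ac)
  qed
  obtain e where e: "e > 0" "ball y0 e \<subseteq> Y" using Y open_contains_ball by blast
  have Lip: "norm (g y a - g y0 a) \<le> ?n * w a * norm (y - y0)" if "y \<in> ball y0 e" "a \<in> space M" for y a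
  proof (rule differentiable_bound[where S = "ball y0 e" and f' = "\<lambda>y v. D v a y"])
    fix x assume x: "x \<in> ball y0 e"
    then have "x \<in> Y" using e by blast
    show "((\<lambda>y. g y a) has_derivative (\<lambda>v. D v a x)) (at x within ball y0 e)"
      unfolding D_def
      using differentiable_has_pderiv1[OF diff[OF \<open>x \<in> Y\<close> that(2)]] has_derivative_at_withinI by blast
    show "onorm (\<lambda>v. D v a x) \<le> ?n * w a"
      using Dbound[OF \<open>x \<in> Y\<close> that(2)] by (rule onorm_le)
  qed (use that e in auto)
  show ?thesis unfolding D_def[symmetric] Dval[symmetric]
    unfolding has_derivative_at_within
  proof
    show "bounded_linear (\<lambda>v. \<integral>a. D v a y0 \<partial>M)"
      by (subst Dval) (intro bounded_linear_sum bounded_linear_scaleR_const bounded_linear_inner_left)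
    (* The remainder in the definition of the total derivative, before integration. *)
    define q where "q y a = inverse (norm (y - y0)) *\<^sub>R (g y a - g y0 a - D (y - y0) a y0)" for y a
    have "((\<lambda>y. \<integral>a. q y a \<partial>M) \<longlongrightarrow> (\<integral>a. 0 \<partial>M)) (at y0)"
      unfolding tendsto_at_iff_sequentially
    proof (intro allI impI, goal_cases)
      case (1 u)
      then have u: "\<And>i. u i \<noteq> y0" "u \<longlonglongrightarrow> y0" by auto
      from u(2) e have "eventually (\<lambda>i. u i \<in> ball y0 e) sequentially"
        by (metis Elementary_Metric_Spaces.open_ball centre_in_ball topological_tendstoD)
      then obtain N where N: "\<And>i. i \<ge> N \<Longrightarrow> u i \<in> ball y0 e" by (auto simp: eventually_sequentially)
      have "(\<lambda>i. \<integral>a. q (u (i + N)) a \<partial>M) \<longlonglongrightarrow> (\<integral>a. 0 \<partial>M)"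
      proof (rule integral_dominated_convergence[where w = "\<lambda>a. 2 * ?n * w a"])
        show "AE a in M. (\<lambda>i. q (u (i + N)) a) \<longlonglongrightarrow> 0"
        proof (rule AE_I2)
          fix a assume a: "a \<in> space M"
          have "((\<lambda>y. q y a) \<longlongrightarrow> 0) (at y0)"
            using differentiable_has_pderiv1[OF diff[OF Y(2) a]]
            unfolding has_derivative_at_within q_def D_def by simp
          then have "((\<lambda>y. q y a) \<circ> u) \<longlonglongrightarrow> 0"
            using u unfolding tendsto_at_iff_sequentially by auto
          then show "(\<lambda>i. q (u (i + N)) a) \<longlonglongrightarrow> 0"
            using LIMSEQ_ignore_initial_segment[of "(\<lambda>y. q y a) \<circ> u" 0 N] by (simp add: o_def)
        qed
        show "AE a in M. norm (q (u (i + N)) a) \<le> 2 * ?n * w a" for i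
        proof (rule AE_I2)
          fix a assume a: "a \<in> space M"
          let ?y = "u (i + N)"
          have pos: "norm (?y - y0) > 0" using u by simp
          have "norm (g ?y a - g y0 a - D (?y - y0) a y0)
              \<le> ?n * w a * norm (?y - y0) + ?n * w a * norm (?y - y0)"
            using N[of "i + N"]
            by (intro order_trans[OF norm_triangle_ineq4 add_mono] Lip a Dbound Y) auto
          then show "norm (q ?y a) \<le> 2 * ?n * w a"
            using pos unfolding q_def norm_scaleR by (simp add: field_simps del: scaleR_diff_right)
        qed
        show "(\<lambda>a. q (u (i + N)) a) \<in> borel_measurable M" for i
          using N[of "i + N"] e int Dvint Y(2) unfolding q_def
          by (intro borel_measurable_scaleR borel_measurable_diff borel_measurable_const
              borel_measurable_integrable) auto
      qed (use w in auto)
      then show ?case using LIMSEQ_offset[of "(\<lambda>i. \<integral>a. q (u i) a \<partial>M)" N] by (simp add: o_def)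
    qed
    moreover have "eventually (\<lambda>y. (\<integral>a. q y a \<partial>M) =
        inverse (norm (y - y0)) *\<^sub>R ((\<integral>a. g y a \<partial>M) - (\<integral>a. g y0 a \<partial>M) - (\<integral>a. D (y - y0) a y0 \<partial>M))) (at y0)"
      using eventually_at_in_open'[OF Y]
    proof eventually_elim
      case (elim y)
      then show ?case unfolding q_def using int[OF elim] int[OF Y(2)] Dvint by simp
    qed
    ultimately show "((\<lambda>y. inverse (norm (y - y0)) *\<^sub>R
       ((\<integral>a. g y a \<partial>M) - (\<integral>a. g y0 a \<partial>M) - (\<integral>a. D (y - y0) a y0 \<partial>M))) \<longlongrightarrow> 0) (at y0)"
      by (simp add: tendsto_cong)
  qed
qed

text \<open>By translation invariance \<open>\<integral> (h(z + b) - h(z)) dz = 0\<close>.  The integrand is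
  \<open>\<integral>\<^sub>0\<^sup>1 \<partial>\<^sub>b h(z + s b) ds\<close>, and after exchanging the integrals, translation invariance
  turns the double integral into \<open>\<integral> \<partial>\<^sub>b h\<close>.\<close>

lemma integral_pderiv1_eq_0:
  fixes h :: "'e::euclidean_space \<Rightarrow> complex"
  assumes diff: "\<And>z. h differentiable (at z)"
    and cont: "continuous_on UNIV (pderiv1 b h)"
    and int: "integrable lborel h" and int': "integrable lborel (pderiv1 b h)"
  shows "(\<integral>z. pderiv1 b h z \<partial>lborel) = 0"
proof -
  let ?D = "pderiv1 b h"
  have shift: "(\<integral>z. f (z + c) \<partial>lborel) = (\<integral>z. f z \<partial>lborel)"
    "integrable lborel f \<Longrightarrow> integrable lborel (\<lambda>z. f (z + c))"
    if "f \<in> borel_measurable borel" for f :: "'e \<Rightarrow> complex" and c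
  proof -
    have e: "lborel = distr lborel borel ((+) c)" using lborel_distr_plus by metis
    show "(\<integral>z. f (z + c) \<partial>lborel) = (\<integral>z. f z \<partial>lborel)"
      by (subst (2) e, subst integral_distr) (use that in \<open>auto simp: add.commute\<close>)
    show "integrable lborel f \<Longrightarrow> integrable lborel (\<lambda>z. f (z + c))"
      by (subst (asm) e, subst (asm) integrable_distr_eq) (use that in \<open>auto simp: add.commute\<close>)
  qed
  have hm: "h \<in> borel_measurable borel" using int borel_measurable_integrable by fastforce
  have Dm: "?D \<in> borel_measurable borel" using cont borel_measurable_continuous_onI by blast
  have nn: "(\<integral>\<^sup>+z. ennreal (norm (?D (z + c))) \<partial>lborel) = (\<integral>\<^sup>+z. ennreal (norm (?D z)) \<partial>lborel)" for c
  proof -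
    have e: "lborel = distr lborel borel ((+) c)" using lborel_distr_plus by metis
    show ?thesis by (subst (2) e, subst nn_integral_distr) (use Dm in \<open>auto simp: add.commute\<close>)
  qed
  define F where "F = (\<lambda>(s::real, z). indicator {0..1} s *\<^sub>R ?D (z + s *\<^sub>R b))"
  have F_meas: "F \<in> borel_measurable (lborel \<Otimes>\<^sub>M lborel)"
  proof -
    have "(\<lambda>(s::real, z). z + s *\<^sub>R b) \<in> borel_measurable borel"
      by (intro borel_measurable_continuous_onI) (auto simp: case_prod_unfold intro!: continuous_intros)
    then have "(\<lambda>p::real \<times> 'e. ?D (snd p + fst p *\<^sub>R b)) \<in> borel_measurable borel"
      using Dm by (simp add: case_prod_unfold measurable_compose)
    then have "F \<in> borel_measurable borel" unfolding F_def case_prod_unfold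
      by (intro borel_measurable_scaleR borel_measurable_indicator')
        (auto intro!: borel_closed closed_Collect_conj closed_Collect_le continuous_intros)
    then show ?thesis by (simp add: lborel_prod)
  qed
  have F_int: "integrable (lborel \<Otimes>\<^sub>M lborel) F"
  proof (rule integrableI_bounded[OF F_meas])
    have "(\<integral>\<^sup>+p. ennreal (norm (F p)) \<partial>(lborel \<Otimes>\<^sub>M lborel))
        = (\<integral>\<^sup>+s. \<integral>\<^sup>+z. ennreal (norm (F (s, z))) \<partial>lborel \<partial>lborel)"
      using F_meas by (intro lborel.nn_integral_fst[symmetric]) auto
    also have "\<dots> = (\<integral>\<^sup>+s. indicator {0..1::real} s * (\<integral>\<^sup>+z. ennreal (norm (?D z)) \<partial>lborel) \<partial>lborel)"
      by (intro nn_integral_cong) (auto simp: F_def nn split: split_indicator)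
    also have "\<dots> = (\<integral>\<^sup>+z. ennreal (norm (?D z)) \<partial>lborel)"
      by (simp add: nn_integral_multc)
    also have "\<dots> < \<infinity>" using int' by (simp add: integrable_iff_bounded)
    finally show "(\<integral>\<^sup>+p. ennreal (norm (F p)) \<partial>(lborel \<Otimes>\<^sub>M lborel)) < \<infinity>" .
  qed
  have "(\<integral>s. (\<integral>z. F (s, z) \<partial>lborel) \<partial>lborel) = (\<integral>s. indicator {0..1::real} s *\<^sub>R (\<integral>z. ?D z \<partial>lborel) \<partial>lborel)"
    by (intro Bochner_Integration.integral_cong) (auto simp: F_def shift(1)[OF Dm] split: split_indicator)
  also have "\<dots> = (\<integral>z. ?D z \<partial>lborel)" by simp
  finally have 1: "(\<integral>s. (\<integral>z. F (s, z) \<partial>lborel) \<partial>lborel) = (\<integral>z. ?D z \<partial>lborel)" .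
  have "(\<integral>s. F (s, z) \<partial>lborel) = h (z + b) - h z" for z
  proof -
    have "(\<integral>s. indicator {0..1::real} s *\<^sub>R ?D (z + s *\<^sub>R b) \<partial>lborel)
        = h (z + 1 *\<^sub>R b) - h (z + 0 *\<^sub>R b)"
    proof (rule integral_FTC_atLeastAtMost)
      fix s :: real
      have "((\<lambda>s. z + s *\<^sub>R b) has_derivative (\<lambda>s. s *\<^sub>R b)) (at s within {0..1})"
        by (auto intro!: derivative_eq_intros)
      from has_derivative_compose[OF this differentiable_has_pderiv1[OF diff]]
      have "((\<lambda>s. h (z + s *\<^sub>R b)) has_derivative (\<lambda>r. pderiv1 (r *\<^sub>R b) h (z + s *\<^sub>R b))) (at s within {0..1})" .
      moreover have "pderiv1 (r *\<^sub>R b) h (z + s *\<^sub>R b) = r *\<^sub>R ?D (z + s *\<^sub>R b)" for r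
        using linear_cmul[OF pderiv1_direction_diff[OF diff], of r b] by simp
      ultimately show "((\<lambda>s. h (z + s *\<^sub>R b)) has_vector_derivative ?D (z + s *\<^sub>R b)) (at s within {0..1})"
        by (simp add: has_vector_derivative_def)
    next
      show "continuous_on {0..1} (\<lambda>s. ?D (z + s *\<^sub>R b))"
        by (rule continuous_on_compose2[OF cont]) (auto intro!: continuous_intros)
    qed simp
    then show ?thesis by (simp add: F_def)
  qed
  then have "(\<integral>z. (\<integral>s. F (s, z) \<partial>lborel) \<partial>lborel) = (\<integral>z. h (z + b) \<partial>lborel) - (\<integral>z. h z \<partial>lborel)"
    using int shift(2)[OF hm int] by simp
  also have "\<dots> = 0" using shift(1)[OF hm] by simp
  finally have 2: "(\<integral>z. (\<integral>s. F (s, z) \<partial>lborel) \<partial>lborel) = 0" .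
  have "(\<integral>z. (\<integral>s. F (s, z) \<partial>lborel) \<partial>lborel) = (\<integral>s. (\<integral>z. F (s, z) \<partial>lborel) \<partial>lborel)"
    using lborel_pair.Fubini_integral[of "\<lambda>s z. F (s, z)"] F_int by simp
  then show ?thesis using 1 2 by simp
qed

lemma jbracket_ge1: "1 \<le> jbracket \<xi>"
  by (simp add: jbracket_def)

lemma jbracket_bounds: "norm \<xi> \<le> jbracket \<xi>" "jbracket \<xi> \<le> 1 + norm \<xi>"
proof -
  show "norm \<xi> \<le> jbracket \<xi>" unfolding jbracket_def by (simp add: real_le_rsqrt)
  show "jbracket \<xi> \<le> 1 + norm \<xi>" unfolding jbracket_def
    by (rule real_le_lsqrt) (auto simp: power2_eq_square algebra_simps)
qed

lemma continuous_jbracket: "continuous_on S jbracket"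
  unfolding jbracket_def[abs_def] by (auto intro!: continuous_intros)

text \<open>Dyadic decomposition: where \<open>2\<^sup>j \<le> \<langle>\<xi>\<rangle> < 2\<^sup>j\<^sup>+\<^sup>1\<close> the integrand is at most \<open>2\<^sup>m\<^sup>j\<close>, and this set lies in a
  ball of volume proportional to \<open>2\<^sup>n\<^sup>j\<close>, so that a geometric series of ratio
  \<open>2\<^sup>m\<^sup>+\<^sup>n < 1\<close> dominates.\<close>

lemma integrable_jbracket_powr:
  assumes m: "m < - real DIM('z)"
  shows "integrable lborel (\<lambda>\<xi>::'z::euclidean_space. jbracket \<xi> powr m)"
proof (rule integrableI_bounded)
  have "continuous_on UNIV (\<lambda>\<xi>::'z. jbracket \<xi> powr m)"
    by (intro continuous_on_powr continuous_on_const continuous_jbracket)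
      (simp add: jbracket_def add_nonneg_eq_0_iff)
  then show "(\<lambda>\<xi>::'z. jbracket \<xi> powr m) \<in> borel_measurable lborel"
    using borel_measurable_continuous_onI by auto
  let ?n = "DIM('z)"
  define V where "V = unit_ball_vol (real ?n) * 2 ^ ?n"
  have V: "V \<ge> 0" by (simp add: V_def)
  define r where "r = 2 powr (m + real ?n)"
  have r: "r < 1" "r > 0" using m by (auto simp: r_def powr_less_one)
  have pw: "(2 powr m) ^ j * V * (2 ^ j) ^ ?n = V * r ^ j" for j
    by (simp add: r_def powr_add powr_realpow power_mult_distrib mult_ac flip: power_mult)
  have suminf_ge: "f j \<le> (\<Sum>j. f j)" for f :: "nat \<Rightarrow> ennreal" and j
    using sum_le_suminf[of f "{j}"] by simp
  have le: "ennreal (norm (jbracket \<xi> powr m)) \<le> (\<Sum>j. ennreal ((2 powr m) ^ j) * indicator (cball 0 (2 * 2 ^ j)) \<xi>)" for \<xi> :: 'z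
  proof -
    define j where "j = nat \<lfloor>log 2 (jbracket \<xi>)\<rfloor>"
    have l0: "log 2 (jbracket \<xi>) \<ge> 0" using jbracket_ge1[of \<xi>] by simp
    then have j: "real j \<le> log 2 (jbracket \<xi>)" "log 2 (jbracket \<xi>) < real j + 1"
      unfolding j_def by linarith+
    have pos: "jbracket \<xi> > 0" using jbracket_ge1[of \<xi>] by linarith
    have 1: "2 ^ j \<le> jbracket \<xi>" using j(1) pos by (simp add: le_log_iff powr_realpow)
    have "jbracket \<xi> < 2 powr (real j + 1)" using j(2) pos by (simp add: log_less_iff)
    then have 2: "jbracket \<xi> < 2 * 2 ^ j" by (simp add: powr_add powr_realpow)
    have "jbracket \<xi> powr m \<le> (2 ^ j) powr m"
      using 1 m by (intro powr_mono2') auto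
    also have "\<dots> = (2 powr m) ^ j"
      by (simp add: powr_powr flip: powr_realpow) (simp add: mult.commute powr_powr flip: powr_realpow)
    finally have "ennreal (norm (jbracket \<xi> powr m)) \<le> ennreal ((2 powr m) ^ j) * indicator (cball 0 (2 * 2 ^ j)) \<xi>"
      using 2 jbracket_bounds(1)[of \<xi>] by (auto simp: ennreal_leI split: split_indicator)
    also have "\<dots> \<le> (\<Sum>j. ennreal ((2 powr m) ^ j) * indicator (cball 0 (2 * 2 ^ j)) \<xi>)"
      by (rule suminf_ge)
    finally show ?thesis .
  qed
  have "(\<integral>\<^sup>+\<xi>. ennreal (norm (jbracket (\<xi>::'z) powr m)) \<partial>lborel)
      \<le> (\<integral>\<^sup>+\<xi>. (\<Sum>j. ennreal ((2 powr m) ^ j) * indicator (cball (0::'z) (2 * 2 ^ j)) \<xi>) \<partial>lborel)"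
    by (intro nn_integral_mono le)
  also have "\<dots> = (\<Sum>j. \<integral>\<^sup>+\<xi>. ennreal ((2 powr m) ^ j) * indicator (cball (0::'z) (2 * 2 ^ j)) \<xi> \<partial>lborel)"
    by (rule nn_integral_suminf)
      (intro borel_measurable_times_ennreal borel_measurable_const borel_measurable_indicator, simp)
  also have "\<dots> = (\<Sum>j. ennreal (V * r ^ j))"
  proof (rule suminf_cong)
    fix j
    have "(\<integral>\<^sup>+\<xi>. ennreal ((2 powr m) ^ j) * indicator (cball (0::'z) (2 * 2 ^ j)) \<xi> \<partial>lborel)
        = ennreal ((2 powr m) ^ j) * emeasure lborel (cball (0::'z) (2 * 2 ^ j))"
      by (simp add: nn_integral_cmult_indicator)
    also have "\<dots> = ennreal ((2 powr m) ^ j * (unit_ball_vol (real ?n) * (2 * 2 ^ j) ^ ?n))"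
      by (simp add: emeasure_cball ennreal_mult)
    also have "(2 powr m) ^ j * (unit_ball_vol (real ?n) * (2 * 2 ^ j) ^ ?n) = V * r ^ j"
      using pw[of j] by (simp add: V_def power_mult_distrib mult_ac)
    finally show "(\<integral>\<^sup>+\<xi>. ennreal ((2 powr m) ^ j) * indicator (cball (0::'z) (2 * 2 ^ j)) \<xi> \<partial>lborel) = ennreal (V * r ^ j)" .
  qed
  also have "\<dots> = ennreal (\<Sum>j. V * r ^ j)"
    using r V by (intro suminf_ennreal2) (auto intro!: summable_mult summable_geometric)
  also have "\<dots> < \<infinity>" by simp
  finally show "(\<integral>\<^sup>+\<xi>. ennreal (norm (jbracket (\<xi>::'z) powr m)) \<partial>lborel) < \<infinity>" .
qed

section \<open>Symbols in the frequency variable\<close>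

definition J3 :: "'x::euclidean_space \<times> 'y::euclidean_space \<times> 'z::euclidean_space \<Rightarrow> real"
  where "J3 p = jbracket (snd (snd p))"

text \<open>The order increments: \<open>\<mu>\<close> for a derivative in \<open>x\<close> or \<open>y\<close>, \<open>\<nu>\<close> for a derivative in \<open>\<xi>\<close>.\<close>

definition wt :: "real \<Rightarrow> real \<Rightarrow> 'x::euclidean_space \<times> 'y::euclidean_space \<times> 'z::euclidean_space \<Rightarrow> real"
  where "wt \<mu> \<nu> b = (if snd (snd b) = 0 then \<mu> else \<nu>)"

lemma wt_simps [simp]: "wt \<mu> \<nu> (i, j, 0) = \<mu>" "l \<noteq> 0 \<Longrightarrow> wt \<mu> \<nu> (i, j, l) = \<nu>"
  by (auto simp: wt_def)

lemma Basis3_cases: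
  assumes "b \<in> (Basis :: ('x::euclidean_space \<times> 'y::euclidean_space \<times> 'z::euclidean_space) set)"
  obtains (x) i where "i \<in> Basis" "b = (i, 0, 0)"
    | (y) i where "i \<in> Basis" "b = (0, i, 0)"
    | (xi) i where "i \<in> Basis" "b = (0, 0, i)"
  using assms unfolding Basis_prod_def by (auto simp: zero_prod_def)

lemma Basis3_mem [simp]:
  "(i, 0, 0) \<in> (Basis :: ('x::euclidean_space \<times> 'y::euclidean_space \<times> 'z::euclidean_space) set) \<longleftrightarrow> i \<in> Basis"
  "(0, j, 0) \<in> (Basis :: ('x \<times> 'y \<times> 'z) set) \<longleftrightarrow> j \<in> Basis"
  "(0, 0, l) \<in> (Basis :: ('x \<times> 'y \<times> 'z) set) \<longleftrightarrow> l \<in> Basis"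
  unfolding Basis_prod_def by (auto simp: zero_prod_def image_iff)

lemma pderivs3_single [simp]:
  "pderivs3 [i] [] [] f = pderiv1 (i, 0, 0) f"
  "pderivs3 [] [j] [] f = pderiv1 (0, j, 0) f"
  "pderivs3 [] [] [l] f = pderiv1 (0, 0, l) f"
  by (auto simp: pderivs3_def)

lemma norm_sum_Basis_sq: "(norm (\<Sum>i\<in>Basis. c i *\<^sub>R i :: 'a::euclidean_space))\<^sup>2 = (\<Sum>i\<in>Basis. (c i)\<^sup>2)"
  unfolding power2_norm_eq_inner
  by (subst euclidean_inner) (simp add: power2_eq_square)

lemma norm_sq_Basis: "(norm (\<xi>::'a::euclidean_space))\<^sup>2 = (\<Sum>b\<in>Basis. (\<xi> \<bullet> b)\<^sup>2)"
  unfolding power2_norm_eq_inner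
  by (subst euclidean_inner) (simp add: power2_eq_square)

lemma osc_r_eq:
  "osc_r \<Phi> p = (norm (snd (snd p)))\<^sup>2 * (\<Sum>l\<in>Basis. (pderiv1 (0, 0, l) \<Phi> p)\<^sup>2)
     + (\<Sum>k\<in>Basis. (pderiv1 (k, 0, 0) \<Phi> p)\<^sup>2)"
  by (cases p) (simp add: osc_r_def grad_x_def grad_xi_def norm_sum_Basis_sq)

lemma osc_alpha_eq: "osc_alpha chi \<Phi> l p =
    - \<i> * of_real (inverse (osc_r \<Phi> p)) * (1 - chi (snd (snd p)))
      * of_real ((norm (snd (snd p)))\<^sup>2 * pderiv1 (0, 0, l) \<Phi> p)"
  by (cases p) (simp add: osc_alpha_def divide_inverse)

lemma osc_beta_eq: "osc_beta chi \<Phi> k p =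
    - \<i> * of_real (inverse (osc_r \<Phi> p)) * (1 - chi (snd (snd p))) * of_real (pderiv1 (k, 0, 0) \<Phi> p)"
  by (cases p) (simp add: osc_beta_def divide_inverse)

lemma osc_L_eq: "osc_L chi \<Phi> f p =
    - (\<Sum>l\<in>Basis. pderiv1 (0, 0, l) (\<lambda>p. osc_alpha chi \<Phi> l p * f p) p)
    - (\<Sum>k\<in>Basis. pderiv1 (k, 0, 0) (\<lambda>p. osc_beta chi \<Phi> k p * f p) p)
    + chi (snd (snd p)) * f p"
  by (cases p) (simp add: osc_L_def)

lemma J3_ge1: "1 \<le> J3 p"
  by (simp add: J3_def jbracket_ge1)

lemma weighted_region_J3: "open S \<Longrightarrow> weighted_region S J3"
  by unfold_locales (simp_all add: J3_ge1)

lemma pderiv1_zero_dir: "f differentiable (at z) \<Longrightarrow> pderiv1 0 f z = 0"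
  by (rule linear_0[OF pderiv1_direction_diff])

lemma has_derivative_snd_snd: "((\<lambda>p. snd (snd p)) has_derivative (\<lambda>p. snd (snd p))) (at p)"
  by (auto intro!: derivative_eq_intros)

lemma has_derivative_fst': "(fst has_derivative fst) (at p)"
  by (auto intro!: derivative_eq_intros)

text \<open>On the support of \<open>h\<close> the weight lies between 1 and 3, so all orders are equivalent.\<close>

lemma symfam_of_xi:
  fixes h :: "'z::euclidean_space \<Rightarrow> 'b::real_normed_vector"
    and S :: "('x::euclidean_space \<times> 'y::euclidean_space \<times> 'z) set"
  assumes h: "smooth_on UNIV h" "\<And>\<xi>. norm \<xi> > 2 \<Longrightarrow> h \<xi> = 0" and S: "open S"
  shows "symfam T S J3 Basis w k m (\<lambda>t p. h (snd (snd p)))"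
  using h
proof (induction k arbitrary: h m)
  have b: "symbol_bound T S J3 m (\<lambda>t p. h (snd (snd p)))"
    if h: "smooth_on UNIV h" "\<And>\<xi>. norm \<xi> > 2 \<Longrightarrow> h \<xi> = 0" for h :: "'z \<Rightarrow> 'b" and m
  proof -
    have c: "continuous_on UNIV h" by (rule smooth_on_continuous[OF h(1)])
    have "compact (h ` cball 0 2)"
      by (intro compact_continuous_image continuous_on_subset[OF c]) auto
    then obtain B where "\<forall>\<eta>\<in>h ` cball 0 2. norm \<eta> \<le> B" and B0: "B > 0"
      using bounded_pos[of "h ` cball 0 2"] compact_imp_bounded by blast
    then have B: "norm (h \<xi>) \<le> B" if "norm \<xi> \<le> 2" for \<xi>
      using that by auto
    have "norm (h (snd (snd p))) \<le> (B * 3 powr \<bar>m\<bar>) * J3 p powr m" for p :: "'x \<times> 'y \<times> 'z"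
    proof (cases "norm (snd (snd p)) \<le> 2")
      case True
      then have J: "J3 p \<le> 3" using jbracket_bounds(2)[of "snd (snd p)"] by (simp add: J3_def)
      have "3 powr (- \<bar>m\<bar>) \<le> J3 p powr (- \<bar>m\<bar>)"
        using J J3_ge1[of p] by (intro powr_mono2') auto
      also have "\<dots> \<le> J3 p powr m" using J3_ge1[of p] by (intro powr_mono) auto
      finally have "1 \<le> 3 powr \<bar>m\<bar> * J3 p powr m"
        by (simp add: powr_minus field_simps)
      then have "B * 1 \<le> B * (3 powr \<bar>m\<bar> * J3 p powr m)" using B0 by (intro mult_left_mono) auto
      then show ?thesis using B[OF True] by (simp add: mult.assoc)
    qed (use h B0 in auto)
    moreover have "continuous_on (T \<times> S) (\<lambda>(t, p). h (snd (snd p)))"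
      unfolding case_prod_unfold by (rule continuous_on_compose2[OF c]) (auto intro!: continuous_intros)
    ultimately show ?thesis unfolding symbol_bound_def by blast
  qed
  case 0 then show ?case using b by simp
next
  case (Suc k)
  interpret weighted_region T S J3 Basis using weighted_region_J3[OF S] .
  have d: "h differentiable (at \<xi>)" for \<xi> using smooth_on_differentiable[OF Suc.prems(1)] by simp
  note comp = pderiv1_compose[OF has_derivative_snd_snd d]
  have "symb w k (m + w b) (\<lambda>t. pderiv1 b (\<lambda>p. h (snd (snd p))))" if "b \<in> Basis" for b
    using that
  proof (cases rule: Basis3_cases)
    case (xi i)
    have z: "pderiv1 i h \<xi> = 0" if "norm \<xi> > 2" for \<xi>
      by (rule pderiv1_zero_open[of "- cball 0 2"]) (use that Suc.prems in auto)
    show ?thesis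
      by (rule sym_cong_imp[OF Suc.IH[OF smooth_on_pderiv1[OF Suc.prems(1) xi(1)] z]])
        (auto simp: comp xi)
  qed (auto simp: comp pderiv1_zero_dir[OF d] intro!: sym_cong_imp[OF sym_zero])
  then show ?case using symfam_bound[OF Suc.IH[OF Suc.prems]] comp(2) by auto
qed

lemma symfam_of_x:
  fixes h :: "'i::metric_space \<Rightarrow> 'x::euclidean_space \<Rightarrow> 'b::real_normed_vector"
    and S :: "('x \<times> 'y::euclidean_space \<times> 'z::euclidean_space) set"
  assumes "smooth_family T X k h" and S: "open S" "S \<subseteq> X \<times> UNIV"
    and w: "\<And>i. i \<in> Basis \<Longrightarrow> 0 \<le> w (i, 0, 0)"
  shows "symfam T S J3 Basis w k 0 (\<lambda>t p. h t (fst p))"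
  using assms(1)
proof (induction k arbitrary: h)
  have b: "symbol_bound T S J3 0 (\<lambda>t p. h t (fst p))"
    if hb: "symbol_bound T X (\<lambda>_. 1) 0 h" for h :: "'i \<Rightarrow> 'x \<Rightarrow> 'b"
  proof -
    obtain C where C: "C \<ge> 0" "\<And>t x. t \<in> T \<Longrightarrow> x \<in> X \<Longrightarrow> norm (h t x) \<le> C * 1 powr 0"
      using symbol_boundE[OF hb] by metis
    then have "norm (h t (fst p)) \<le> C * J3 p powr 0" if "t \<in> T" "p \<in> S" for t p
    proof -
      have "fst p \<in> X" using that(2) S(2) by (metis SigmaE fst_conv subsetD)
      then show ?thesis using C(2)[OF that(1)] J3_ge1[of p] by simp
    qed
    moreover have "continuous_on (T \<times> S) (\<lambda>q. (\<lambda>(t, x). h t x) (fst q, fst (snd q)))"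
      by (rule continuous_on_compose2[of "T \<times> X"])
        (use hb S in \<open>auto simp: symbol_bound_def intro!: continuous_intros\<close>)
    ultimately show ?thesis
      unfolding symbol_bound_def case_prod_unfold fst_conv snd_conv by blast
  qed
  {
    case 0 then show ?case using b by simp
  next
    case (Suc k)
    interpret weighted_region T S J3 Basis using weighted_region_J3[OF S(1)] .
    have d: "h t differentiable (at (fst p))" if "t \<in> T" "p \<in> S" for t p
      using Suc.prems that S by auto
    note comp = pderiv1_compose[OF has_derivative_fst' d]
    have "symb w k (0 + w b) (\<lambda>t. pderiv1 b (\<lambda>p. h t (fst p)))" if "b \<in> Basis" for b
      using that
    proof (cases rule: Basis3_cases)
      case (x i)
      have "smooth_family T X k (\<lambda>t. pderiv1 i (h t))"
        using Suc.prems x by auto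
      from Suc.IH[OF this] have "symb w k (0 + w b) (\<lambda>t p. pderiv1 i (h t) (fst p))"
        by (rule sym_mono) (use w x in auto)
      then show ?thesis by (rule sym_cong_imp) (auto simp: comp x)
    qed (rule sym_cong_imp[OF sym_zero], simp add: comp pderiv1_zero_dir[OF d])+
    then show ?case using b[OF symfam_bound[OF Suc.prems]] comp(2) by auto
  }
qed

lemma symfam_xi_component:
  fixes S :: "('x::euclidean_space \<times> 'y::euclidean_space \<times> 'z::euclidean_space) set"
  assumes S: "open S" and b: "b \<in> Basis"
  shows "symfam T S J3 Basis (wt 0 (-1)) k 1 (\<lambda>t p. snd (snd p) \<bullet> b)"
proof -
  interpret weighted_region T S J3 Basis using weighted_region_J3[OF S] .
  have hd: "((\<lambda>p::'x \<times> 'y \<times> 'z. snd (snd p) \<bullet> b) has_derivative (\<lambda>p. snd (snd p) \<bullet> b)) (at p)" for p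
    by (auto intro!: derivative_eq_intros)
  have bound: "bnd 1 (\<lambda>t p. snd (snd p) \<bullet> b)"
  proof -
    have "norm (snd (snd p) \<bullet> b) \<le> 1 * J3 p powr 1" for p :: "'x \<times> 'y \<times> 'z"
      using Basis_le_norm[OF b, of "snd (snd p)"] jbracket_bounds(1)[of "snd (snd p)"] J3_ge1[of p]
      by (simp add: J3_def)
    moreover have "continuous_on (T \<times> S) (\<lambda>(t, p). snd (snd p) \<bullet> b)"
      by (auto simp: case_prod_unfold intro!: continuous_intros)
    ultimately show ?thesis unfolding symbol_bound_def by blast
  qed
  show ?thesis
  proof (cases k)
    case (Suc k')
    have "symb (wt 0 (-1)) k' (1 + wt 0 (-1) c) (\<lambda>t. pderiv1 c (\<lambda>p. snd (snd p) \<bullet> b))" if "c \<in> Basis" for c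
      using that
    proof (cases rule: Basis3_cases)
      case (xi i)
      have "symb (wt 0 (-1)) k' 0 (\<lambda>t p. i \<bullet> b)" by (rule sym_const) simp
      moreover have "1 + wt 0 (-1) c = 0" using xi(2) nonzero_Basis[OF xi(1)] by simp
      ultimately show ?thesis by (auto simp: pderiv1_has_derivative[OF hd] xi elim!: sym_cong_imp)
    qed (auto simp: pderiv1_has_derivative[OF hd] intro!: sym_cong_imp[OF sym_zero])
    moreover have "(\<lambda>p. snd (snd p) \<bullet> b) differentiable (at p)" for p :: "'x \<times> 'y \<times> 'z"
      using hd differentiable_def by blast
    ultimately show ?thesis using bound Suc by auto
  qed (use bound in simp)
qed

lemma symfam_xi_norm_sq:
  fixes S :: "('x::euclidean_space \<times> 'y::euclidean_space \<times> 'z::euclidean_space) set"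
  assumes S: "open S"
  shows "symfam T S J3 Basis (wt 0 (-1)) k 2 (\<lambda>t p. (norm (snd (snd p)))\<^sup>2)"
proof -
  interpret weighted_region T S J3 Basis using weighted_region_J3[OF S] .
  have "symb (wt 0 (-1)) k 2 (\<lambda>t p. \<Sum>b\<in>Basis. (snd (snd p) \<bullet> b) * (snd (snd p) \<bullet> b))"
    by (intro sym_sum sym_mult'[of _ _ 1 _ 1] symfam_xi_component S) auto
  then show ?thesis
    by (rule sym_cong_imp) (simp add: norm_sq_Basis flip: power2_eq_square)
qed

section \<open>The operator L\<close>

text \<open>The regions \<open>X\<close> and \<open>Y\<close> are thought of as relatively compact subsets of the original open sets;
  this is why all bounds are uniform over them.  Two kinds of information on the phase are kept:
  full symbol bounds away from \<open>\<xi> = 0\<close>, for the coefficients of \<open>L\<close>, and bounds for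
  \<open>y\<close>-derivatives up to \<open>\<xi> = 0\<close>, for differentiation under the integral sign.\<close>

locale fio_family =
  fixes T :: "'i::metric_space set"
    and X :: "'x::euclidean_space set" and Y :: "'y::euclidean_space set" and K :: "'x set"
    and chi :: "'z::euclidean_space \<Rightarrow> complex" and \<alpha> d \<rho> \<delta> :: real
    and \<Phi> :: "'i \<Rightarrow> 'x \<times> 'y \<times> 'z \<Rightarrow> real" and a :: "'i \<Rightarrow> 'x \<times> 'y \<times> 'z \<Rightarrow> complex"
    and \<psi> :: "'i \<Rightarrow> 'x \<Rightarrow> complex"
  assumes open_X: "open X" and open_Y: "open Y" and compact_K: "compact K" and K_subset: "K \<subseteq> X"
    and \<alpha>_pos: "\<alpha> > 0" and \<delta>: "0 \<le> \<delta>" "\<delta> < 1" and \<rho>: "0 < \<rho>" "\<rho> \<le> 1"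
    and chi_smooth: "smooth_on UNIV chi"
    and chi_1: "\<And>\<xi>. norm \<xi> < 1 \<Longrightarrow> chi \<xi> = 1" and chi_0: "\<And>\<xi>. norm \<xi> > 2 \<Longrightarrow> chi \<xi> = 0"
    and \<Phi>_smooth: "\<And>t. t \<in> T \<Longrightarrow> smooth_on (phase_dom X Y) (\<Phi> t)"
    and \<Phi>_sym: "\<And>k. symfam T (X \<times> Y \<times> {\<xi>. 1/2 < norm \<xi>}) J3 Basis (wt 0 (-1)) k 1 \<Phi>"
    and \<Phi>_y: "\<And>k. symfam T (phase_dom X Y) J3 ((\<lambda>i. (0, i, 0)) ` Basis) (\<lambda>_. 0) k 1 \<Phi>"
    and ellip: "\<And>t x y \<xi>. t \<in> T \<Longrightarrow> x \<in> X \<Longrightarrow> y \<in> Y \<Longrightarrow> \<xi> \<noteq> 0 \<Longrightarrow>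
      \<alpha> \<le> (norm (grad_x (\<Phi> t) (x, y, \<xi>)))\<^sup>2 / (norm \<xi>)\<^sup>2 + (norm (grad_xi (\<Phi> t) (x, y, \<xi>)))\<^sup>2"
    and a_sym: "\<And>k. symfam T (phase_dom X Y) J3 Basis (wt \<delta> (-\<rho>)) k d a"
    and \<psi>_sym: "\<And>k. smooth_family T X k \<psi>"
    and \<psi>_supp: "\<And>t x. t \<in> T \<Longrightarrow> x \<notin> K \<Longrightarrow> \<psi> t x = 0"
begin

abbreviation "S \<equiv> phase_dom X Y :: ('x \<times> 'y \<times> 'z) set"
abbreviation "S1 \<equiv> X \<times> Y \<times> {\<xi>. 1/2 < norm \<xi>} :: ('x \<times> 'y \<times> 'z) set"
abbreviation "S2 \<equiv> X \<times> Y \<times> (ball 0 1 - {0}) :: ('x \<times> 'y \<times> 'z) set"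

lemma open_regions: "open S" "open S1" "open S2"
proof -
  have "open {\<xi>::'z. 1/2 < norm \<xi>}" by (intro open_Collect_less continuous_intros)
  then show "open S" "open S1" "open S2"
    using open_X open_Y by (auto intro!: open_Times open_delete)
qed

lemma S_Un: "S1 \<union> S2 = S" by auto

sublocale R: weighted_region T S J3 Basis by (rule weighted_region_J3[OF open_regions(1)])
sublocale R1: weighted_region T S1 J3 Basis by (rule weighted_region_J3[OF open_regions(2)])
sublocale R2: weighted_region T S2 J3 Basis by (rule weighted_region_J3[OF open_regions(3)])

text \<open>Where \<open>\<parallel>\<xi>\<parallel> > 1/2\<close> one has \<open>\<langle>\<xi>\<rangle>\<^sup>2 \<le> 5 \<parallel>\<xi>\<parallel>\<^sup>2\<close>; the lower bound imposed on the
  gradients of the phase thus makes \<open>r\<close> elliptic of order 2.\<close>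

lemma osc_r_lower:
  assumes "t \<in> T" "p \<in> S1"
  shows "\<alpha> / 5 * J3 p powr 2 \<le> osc_r (\<Phi> t) p"
proof -
  obtain x y \<xi> where p: "p = (x, y, \<xi>)" "x \<in> X" "y \<in> Y" "1/2 < norm \<xi>" using assms by auto
  then have "\<xi> \<noteq> 0" by auto
  have n: "(norm \<xi>)\<^sup>2 > 1/4" using p(4) power_strict_mono[of "1/2" "norm \<xi>" 2] by (simp add: power2_eq_square)
  have "J3 p powr 2 = 1 + (norm \<xi>)\<^sup>2"
    using J3_ge1[of p] by (simp add: p J3_def jbracket_def add_nonneg_pos)
  also have "\<dots> \<le> 5 * (norm \<xi>)\<^sup>2" using n by simp
  finally have "\<alpha> / 5 * J3 p powr 2 \<le> \<alpha> / 5 * (5 * (norm \<xi>)\<^sup>2)" using \<alpha>_pos by (intro mult_left_mono) auto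
  also have "\<dots> = (norm \<xi>)\<^sup>2 * \<alpha>" by simp
  also have "\<dots> \<le> (norm \<xi>)\<^sup>2 * ((norm (grad_x (\<Phi> t) (x, y, \<xi>)))\<^sup>2 / (norm \<xi>)\<^sup>2 + (norm (grad_xi (\<Phi> t) (x, y, \<xi>)))\<^sup>2)"
    using ellip[OF assms(1) p(2,3) \<open>\<xi> \<noteq> 0\<close>] by (intro mult_left_mono) auto
  also have "\<dots> = osc_r (\<Phi> t) p" using \<open>\<xi> \<noteq> 0\<close> by (simp add: p osc_r_def algebra_simps)
  finally show ?thesis .
qed

lemma \<Phi>_deriv_sym:
  "l \<in> Basis \<Longrightarrow> R1.symb (wt 0 (-1)) k 0 (\<lambda>t. pderiv1 (0, 0, l) (\<Phi> t))"
  "i \<in> Basis \<Longrightarrow> R1.symb (wt 0 (-1)) k 1 (\<lambda>t. pderiv1 (i, 0, 0) (\<Phi> t))"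
  "j \<in> Basis \<Longrightarrow> R1.symb (wt 0 (-1)) k 1 (\<lambda>t. pderiv1 (0, j, 0) (\<Phi> t))"
  using symfam_pderiv1[OF \<Phi>_sym[of "Suc k"], of "(0, 0, l)"]
    symfam_pderiv1[OF \<Phi>_sym[of "Suc k"], of "(i, 0, 0)"]
    symfam_pderiv1[OF \<Phi>_sym[of "Suc k"], of "(0, j, 0)"] by (auto simp: nonzero_Basis)

lemma inverse_r_sym: "R1.symb (wt 0 (-1)) k (-2) (\<lambda>t p. inverse (osc_r (\<Phi> t) p))"
proof (rule R1.sym_inverse[where c = "\<alpha> / 5"])
  have "R1.symb (wt 0 (-1)) k 2 (\<lambda>t p. (norm (snd (snd p)))\<^sup>2
      * (\<Sum>l\<in>Basis. pderiv1 (0, 0, l) (\<Phi> t) p * pderiv1 (0, 0, l) (\<Phi> t) p)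
     + (\<Sum>k\<in>Basis. pderiv1 (k, 0, 0) (\<Phi> t) p * pderiv1 (k, 0, 0) (\<Phi> t) p))"
    by (intro R1.sym_add R1.sym_sum R1.sym_mult'[of _ _ 2 _ 0 _ 2] R1.sym_mult'[of _ _ 1 _ 1 _ 2]
      R1.sym_mult'[of _ _ 0 _ 0 _ 0] \<Phi>_deriv_sym symfam_xi_norm_sq open_regions) simp_all
  then show "R1.symb (wt 0 (-1)) k 2 (\<lambda>t. osc_r (\<Phi> t))"
    by (rule R1.sym_cong_imp) (simp add: osc_r_eq power2_eq_square)
qed (use \<alpha>_pos osc_r_lower in auto)

lemma one_minus_chi_sym: "R1.symb w k 0 (\<lambda>t p. 1 - chi (snd (snd p)))"
  by (intro R1.sym_diff R1.sym_const symfam_of_xi chi_smooth chi_0 open_regions) auto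

lemma symfam_glue:
  assumes "R1.symb w k m f" "\<And>t p. t \<in> T \<Longrightarrow> p \<in> S2 \<Longrightarrow> f t p = 0"
  shows "R.symb w k m f"
proof -
  have "R2.symb w k m f" by (rule R2.sym_cong_imp[OF R2.sym_zero]) (use assms in auto)
  then show ?thesis using symfam_Un[OF assms(1) _ open_regions(2,3)] by (simp only: S_Un)
qed

lemma alpha_sym:
  assumes "l \<in> Basis" shows "R.symb (wt 0 (-1)) k 0 (\<lambda>t. osc_alpha chi (\<Phi> t) l)"
proof (rule symfam_glue)
  have "R1.symb (wt 0 (-1)) k (0 + -2 + 0 + (2 + 0)) (\<lambda>t p. - \<i> * of_real (inverse (osc_r (\<Phi> t) p)) * (1 - chi (snd (snd p)))
      * of_real ((norm (snd (snd p)))\<^sup>2 * pderiv1 (0, 0, l) (\<Phi> t) p))" (is "R1.symb _ _ _ ?F")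
    using assms by (intro R1.sym_mult R1.sym_const R1.sym_linear[OF bounded_linear_of_real] inverse_r_sym
      one_minus_chi_sym symfam_xi_norm_sq \<Phi>_deriv_sym open_regions) auto
  then have "R1.symb (wt 0 (-1)) k 0 ?F" by (rule R1.sym_mono) simp_all
  then show "R1.symb (wt 0 (-1)) k 0 (\<lambda>t. osc_alpha chi (\<Phi> t) l)"
    by (rule R1.sym_cong_imp) (simp only: osc_alpha_eq)
  show "osc_alpha chi (\<Phi> t) l p = 0" if "p \<in> S2" for t p
    using chi_1 that by (auto simp: osc_alpha_eq)
qed

lemma beta_sym:
  assumes "i \<in> Basis" shows "R.symb (wt 0 (-1)) k (-1) (\<lambda>t. osc_beta chi (\<Phi> t) i)"
proof (rule symfam_glue)
  have "R1.symb (wt 0 (-1)) k (0 + -2 + 0 + 1) (\<lambda>t p. - \<i> * of_real (inverse (osc_r (\<Phi> t) p)) * (1 - chi (snd (snd p)))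
      * of_real (pderiv1 (i, 0, 0) (\<Phi> t) p))" (is "R1.symb _ _ _ ?F")
    using assms by (intro R1.sym_mult R1.sym_const R1.sym_linear[OF bounded_linear_of_real] inverse_r_sym
      one_minus_chi_sym symfam_xi_norm_sq \<Phi>_deriv_sym open_regions) auto
  then have "R1.symb (wt 0 (-1)) k (-1) ?F" by (rule R1.sym_mono) simp_all
  then show "R1.symb (wt 0 (-1)) k (-1) (\<lambda>t. osc_beta chi (\<Phi> t) i)"
    by (rule R1.sym_cong_imp) (simp only: osc_beta_eq)
  show "osc_beta chi (\<Phi> t) i p = 0" if "p \<in> S2" for t p
    using chi_1 that by (auto simp: osc_beta_eq)
qed

abbreviation "wS \<equiv> wt \<delta> (- \<rho>) :: 'x \<times> 'y \<times> 'z \<Rightarrow> real"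

text \<open>Homogeneous symbols are symbols of type \<open>(\<rho>, \<delta>)\<close>, and these in turn may be multiplied with
  \<open>e\<^sup>i\<^sup>\<Phi>\<close> at the price of the increments \<open>(1, 0)\<close>.\<close>

lemma wt_le: "wt 0 (-1) b \<le> wt \<delta> (- \<rho>) b" "wt \<delta> (- \<rho>) b \<le> wt 1 0 b"
  using \<delta> \<rho> by (auto simp: wt_def)

lemma alpha_mult_sym:
  "l \<in> Basis \<Longrightarrow> R.symb wS k m f \<Longrightarrow> R.symb wS k m (\<lambda>t p. osc_alpha chi (\<Phi> t) l p * f t p)"
  using R.sym_mult[OF R.sym_mono[OF alpha_sym order_refl wt_le(1)]] by fastforce

lemma beta_mult_sym:
  "i \<in> Basis \<Longrightarrow> R.symb wS k m f \<Longrightarrow> R.symb wS k (m - 1) (\<lambda>t p. osc_beta chi (\<Phi> t) i p * f t p)"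
  using R.sym_mult[OF R.sym_mono[OF beta_sym order_refl wt_le(1)]] by fastforce

definition gain :: real where "gain = min \<rho> (1 - \<delta>)"

lemma gain_pos: "gain > 0" using \<rho> \<delta> by (simp add: gain_def)

text \<open>A \<open>\<xi>\<close>-derivative gains \<open>\<rho>\<close> and has a coefficient of order 0; an \<open>x\<close>-derivative loses \<open>\<delta>\<close> but
  has a coefficient of order \<open>-1\<close>; the last term is compactly supported in \<open>\<xi>\<close>.\<close>

lemma osc_L_sym:
  assumes f: "R.symb wS (Suc k) m f"
  shows "R.symb wS k (m - gain) (\<lambda>t. osc_L chi (\<Phi> t) (f t))"
  unfolding osc_L_eq
proof (intro R.sym_add R.sym_diff R.sym_uminus R.sym_sum)
  fix l :: 'z assume l: "l \<in> Basis"
  have "R.symb wS k (m + wS (0, 0, l)) (\<lambda>t. pderiv1 (0, 0, l) (\<lambda>p. osc_alpha chi (\<Phi> t) l p * f t p))"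
    by (rule symfam_pderiv1[OF alpha_mult_sym[OF l f]]) (simp add: l)
  then show "R.symb wS k (m - gain) (\<lambda>t. pderiv1 (0, 0, l) (\<lambda>p. osc_alpha chi (\<Phi> t) l p * f t p))"
    by (rule R.sym_mono) (use l in \<open>auto simp: gain_def nonzero_Basis\<close>)
next
  fix i :: 'x assume i: "i \<in> Basis"
  have "R.symb wS k (m - 1 + wS (i, 0, 0)) (\<lambda>t. pderiv1 (i, 0, 0) (\<lambda>p. osc_beta chi (\<Phi> t) i p * f t p))"
    by (rule symfam_pderiv1[OF beta_mult_sym[OF i f]]) (simp add: i)
  then show "R.symb wS k (m - gain) (\<lambda>t. pderiv1 (i, 0, 0) (\<lambda>p. osc_beta chi (\<Phi> t) i p * f t p))"
    by (rule R.sym_mono) (auto simp: gain_def)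
next
  have "R.symb wS k (- gain + m) (\<lambda>t p. chi (snd (snd p)) * f t p)"
    by (intro R.sym_mult symfam_Suc_imp[OF f] symfam_of_xi chi_smooth chi_0 open_regions)
  then show "R.symb wS k (m - gain) (\<lambda>t p. chi (snd (snd p)) * f t p)" by simp
qed

end

lemma osc_L_zero:
  assumes "open U" "\<And>p. p \<in> U \<Longrightarrow> f p = 0" "p \<in> U"
  shows "osc_L chi \<Phi> f p = 0"
proof -
  have "pderiv1 v (\<lambda>p. c p * f p) p = 0" for v and c :: "_ \<Rightarrow> complex"
    by (rule pderiv1_zero_open[OF assms(1,3)]) (simp add: assms)
  then show ?thesis unfolding osc_L_eq by (simp add: assms)
qed

lemma osc_L_pow_zero:
  assumes "open U" "\<And>p. p \<in> U \<Longrightarrow> f p = 0" "p \<in> U"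
  shows "(osc_L chi \<Phi> ^^ n) f p = 0"
  using assms(3)
proof (induction n arbitrary: p)
  case (Suc n) then show ?case using osc_L_zero[OF assms(1)] by simp
qed (use assms in simp)

context fio_family begin

definition amp :: "'i \<Rightarrow> 'x \<times> 'y \<times> 'z \<Rightarrow> complex"
  where "amp t = (\<lambda>(x, y, \<xi>). a t (x, y, \<xi>) * \<psi> t x)"

lemma amp_sym: "R.symb wS k d amp"
proof (rule R.sym_cong_imp)
  have "R.symb wS k (d + 0) (\<lambda>t p. a t p * \<psi> t (fst p))"
    by (intro R.sym_mult a_sym symfam_of_x[OF \<psi>_sym] open_regions) (use \<delta> in auto)
  then show "R.symb wS k d (\<lambda>t p. a t p * \<psi> t (fst p))" by simp
qed (auto simp: amp_def)

text \<open>The integrand of the oscillatory integral without its exponential factor.\<close>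

definition amp_iter where "amp_iter \<kappa> t = (osc_L chi (\<Phi> t) ^^ \<kappa>) (amp t)"

lemma amp_iter_sym: "R.symb wS k (d - real \<kappa> * gain) (amp_iter \<kappa>)"
proof (induction \<kappa> arbitrary: k)
  case 0 then show ?case using amp_sym by (simp add: amp_iter_def)
next
  case (Suc \<kappa>)
  from osc_L_sym[OF Suc] show ?case by (simp add: amp_iter_def algebra_simps)
qed

lemma amp_iter_supp: "t \<in> T \<Longrightarrow> fst p \<notin> K \<Longrightarrow> amp_iter \<kappa> t p = 0"
  unfolding amp_iter_def
proof (rule osc_L_pow_zero[of "(- K) \<times> UNIV"])
  show "open ((- K) \<times> (UNIV::('y \<times> 'z) set))" using compact_K by (auto intro!: open_Times compact_imp_closed)
  show "p \<in> (- K) \<times> UNIV" if "fst p \<notin> K" using that by (simp add: mem_Times_iff)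
qed (auto simp: amp_def \<psi>_supp)

end

section \<open>The oscillatory integral\<close>

context fio_family begin

abbreviation "Ydirs \<equiv> (\<lambda>i. (0, i, 0)) ` (Basis :: 'y set) :: ('x \<times> 'y \<times> 'z) set"

sublocale RY: weighted_region T S J3 Ydirs by (rule weighted_region_J3[OF open_regions(1)])

text \<open>The function to be integrated for fixed \<open>y\<close>, extended by zero to the whole space.\<close>

definition slice :: "('x \<times> 'y \<times> 'z \<Rightarrow> complex) \<Rightarrow> 'y \<Rightarrow> 'x \<times> 'z \<Rightarrow> complex"
  where "slice h y p = (if p \<in> X \<times> - {0} then h (fst p, y, snd p) else 0)"

definition majorant :: "real \<Rightarrow> 'x \<times> 'z \<Rightarrow> real"
  where "majorant m p = indicator K (fst p) * jbracket (snd p) powr m"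

lemma majorant_nonneg: "0 \<le> majorant m p" by (simp add: majorant_def)

lemma majorant_integrable:
  assumes "m < - real DIM('z)" shows "integrable lborel (majorant m)"
proof -
  have K: "K \<in> sets borel" using compact_K by (simp add: borel_closed compact_imp_closed)
  have c: "continuous_on UNIV (\<lambda>\<xi>::'z. jbracket \<xi> powr m)"
    by (intro continuous_on_powr continuous_on_const continuous_jbracket)
      (simp add: jbracket_def add_nonneg_eq_0_iff)
  have f1: "(\<lambda>p. indicator K (fst p) :: real) \<in> borel_measurable ((lborel::'x measure) \<Otimes>\<^sub>M (lborel :: 'z measure))"
    using K by measurable
  have f2: "(\<lambda>p. jbracket (snd p) powr m) \<in> borel_measurable ((lborel::'x measure) \<Otimes>\<^sub>M (lborel :: 'z measure))"
    using borel_measurable_continuous_onI[OF c] by (rule measurable_compose[rotated]) simp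
  have "integrable ((lborel::'x measure) \<Otimes>\<^sub>M (lborel :: 'z measure)) (majorant m)"
  proof (rule lborel_pair.Fubini_integrable)
    show "majorant m \<in> borel_measurable (lborel \<Otimes>\<^sub>M lborel)"
      unfolding majorant_def[abs_def] by (intro borel_measurable_times f1 f2)
    have i: "integrable lborel (\<lambda>\<xi>::'z. jbracket \<xi> powr m)" by (rule integrable_jbracket_powr[OF assms])
    have iK: "integrable lborel (indicator K :: 'x \<Rightarrow> real)"
      using K emeasure_compact_finite[OF compact_K] by (intro integrable_real_indicator) auto
    have "(\<integral>\<xi>. norm (majorant m (x, \<xi>)) \<partial>lborel) = indicator K x * (\<integral>\<xi>. jbracket (\<xi>::'z) powr m \<partial>lborel)" for x
      by (simp add: majorant_def)
    then show "integrable lborel (\<lambda>x. \<integral>\<xi>. norm (majorant m (x, \<xi>)) \<partial>lborel)"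
      using iK by simp
    show "AE x in lborel. integrable lborel (\<lambda>\<xi>. majorant m (x, \<xi>))"
      using i by (simp add: majorant_def)
  qed
  then show ?thesis by (simp add: lborel_prod)
qed

lemma open_XZ: "open (X \<times> - {0::'z})"
  using open_X by (auto intro!: open_Times)

lemma slice_bound:
  assumes "symbol_bound T S J3 m h" "\<And>t p. t \<in> T \<Longrightarrow> p \<in> S \<Longrightarrow> fst p \<notin> K \<Longrightarrow> h t p = 0"
  obtains C where "C \<ge> 0" "\<And>t y p. t \<in> T \<Longrightarrow> y \<in> Y \<Longrightarrow> norm (slice (h t) y p) \<le> C * majorant m p"
proof -
  obtain C where C: "C \<ge> 0" "\<And>t z. t \<in> T \<Longrightarrow> z \<in> S \<Longrightarrow> norm (h t z) \<le> C * J3 z powr m"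
    using symbol_boundE[OF assms(1)] by metis
  have "norm (slice (h t) y p) \<le> C * majorant m p" if "t \<in> T" "y \<in> Y" for t y p
  proof (cases "p \<in> X \<times> - {0} \<and> fst p \<in> K")
    case True
    then have "(fst p, y, snd p) \<in> S" using that by (simp add: mem_Times_iff)
    from C(2)[OF that(1) this] True show ?thesis by (simp add: slice_def majorant_def J3_def)
  next
    case False
    then have "slice (h t) y p = 0" using assms(2)[OF that(1), of "(fst p, y, snd p)"] that
      by (auto simp: slice_def mem_Times_iff)
    then show ?thesis using C(1) majorant_nonneg by simp
  qed
  with C(1) show thesis using that by blast
qed

lemma slice_continuous:
  assumes "symbol_bound T S J3 m h" "t \<in> T" "y \<in> Y"
  shows "continuous_on (X \<times> - {0}) (slice (h t) y)"
proof -
  have c: "continuous_on (T \<times> S) (\<lambda>(t, z). h t z)" using assms by (simp add: symbol_bound_def)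
  have "continuous_on (X \<times> - {0}) (\<lambda>p. (\<lambda>(t, z). h t z) (t, (fst p, y, snd p)))"
    by (rule continuous_on_compose2[OF c]) (use assms in \<open>auto intro!: continuous_intros\<close>)
  then show ?thesis by (rule continuous_on_eq) (auto simp: slice_def)
qed

lemma slice_measurable:
  assumes "symbol_bound T S J3 m h" "t \<in> T" "y \<in> Y"
  shows "slice (h t) y \<in> borel_measurable borel"
proof -
  have "(\<lambda>p. indicator (X \<times> - {0}) p *\<^sub>R slice (h t) y p) \<in> borel_measurable borel"
    by (intro borel_measurable_continuous_on_indicator slice_continuous[OF assms] borel_open open_XZ)
  moreover have "(\<lambda>p. indicator (X \<times> - {0}) p *\<^sub>R slice (h t) y p) = slice (h t) y"
    by (auto simp: slice_def fun_eq_iff split: split_indicator)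
  ultimately show ?thesis by simp
qed

lemma slice_integrable:
  assumes "symbol_bound T S J3 m h" "m < - real DIM('z)"
    and "\<And>t p. t \<in> T \<Longrightarrow> p \<in> S \<Longrightarrow> fst p \<notin> K \<Longrightarrow> h t p = 0" and "t \<in> T" "y \<in> Y"
  shows "integrable lborel (slice (h t) y)"
proof -
  obtain C where "C \<ge> 0" "\<And>t y p. t \<in> T \<Longrightarrow> y \<in> Y \<Longrightarrow> norm (slice (h t) y p) \<le> C * majorant m p"
    using slice_bound[OF assms(1,3)] by blast
  then have "norm (slice (h t) y p) \<le> norm (C * majorant m p)" for p
    using assms(4,5) majorant_nonneg by simp
  moreover have "integrable lborel (\<lambda>p. C * majorant m p)" using majorant_integrable[OF assms(2)] by simp
  moreover have "slice (h t) y \<in> borel_measurable lborel" using slice_measurable[OF assms(1,4,5)] by simp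
  ultimately show ?thesis using Bochner_Integration.integrable_bound by blast
qed

lemma slice_pderiv1_y:
  assumes "\<And>p. p \<in> S \<Longrightarrow> h differentiable (at p)" "y \<in> Y"
  shows "(\<lambda>y. slice h y p) differentiable (at y)"
    and "pderiv1 b (\<lambda>y. slice h y p) y = slice (pderiv1 (0, b, 0) h) y p"
proof -
  have hd: "((\<lambda>y. (fst p, y, snd p)) has_derivative (\<lambda>y. (0, y, 0))) (at y)"
    by (auto intro!: derivative_eq_intros)
  have "(\<lambda>y. slice h y p) differentiable (at y) \<and>
    pderiv1 b (\<lambda>y. slice h y p) y = slice (pderiv1 (0, b, 0) h) y p"
  proof (cases "p \<in> X \<times> - {0}")
    case True
    then have "h differentiable (at (fst p, y, snd p))" using assms by (simp add: mem_Times_iff)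
    from pderiv1_compose[OF hd this] True show ?thesis by (simp add: slice_def)
  qed (simp add: slice_def)
  then show "(\<lambda>y. slice h y p) differentiable (at y)"
    "pderiv1 b (\<lambda>y. slice h y p) y = slice (pderiv1 (0, b, 0) h) y p" by auto
qed

lemma pderiv1_supp:
  assumes "\<And>p. p \<in> S \<Longrightarrow> fst p \<notin> K \<Longrightarrow> h p = 0" "p \<in> S" "fst p \<notin> K"
  shows "pderiv1 v h p = 0"
proof (rule pderiv1_zero_open[of "S \<inter> (- K) \<times> UNIV"])
  show "open (S \<inter> (- K) \<times> UNIV)"
    using open_regions(1) compact_K by (auto intro!: open_Int open_Times compact_imp_closed)
qed (use assms in \<open>auto simp: mem_Times_iff\<close>)

text \<open>Differentiation under the integral sign.  Each \<open>y\<close>-derivative raises the order by one, so an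
  order below \<open>- n - k\<close> leaves all derivatives up to \<open>k\<close> absolutely integrable.\<close>

lemma integral_family:
  assumes "symfam T S J3 Ydirs (\<lambda>_. 1) k m h" "m + real k < - real DIM('z)"
    and "\<And>t p. t \<in> T \<Longrightarrow> p \<in> S \<Longrightarrow> fst p \<notin> K \<Longrightarrow> h t p = 0"
  shows "smooth_family T Y k (\<lambda>t y. \<integral>p. slice (h t) y p \<partial>lborel)"
  using assms
proof (induction k arbitrary: m h)
  have base: "symbol_bound T Y (\<lambda>_. 1) 0 (\<lambda>t y. \<integral>p. slice (h t) y p \<partial>lborel)"
    if b: "symbol_bound T S J3 m h" and m: "m < - real DIM('z)"
      and z: "\<And>t p. t \<in> T \<Longrightarrow> p \<in> S \<Longrightarrow> fst p \<notin> K \<Longrightarrow> h t p = 0" for m h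
  proof -
    obtain C where C: "C \<ge> 0" "\<And>t y p. t \<in> T \<Longrightarrow> y \<in> Y \<Longrightarrow> norm (slice (h t) y p) \<le> C * majorant m p"
      using slice_bound[OF b z] by blast
    have i: "integrable lborel (\<lambda>p. C * majorant m p)" using majorant_integrable[OF m] by simp
    have c: "continuous_on (T \<times> S) (\<lambda>(t, z). h t z)" using b by (simp add: symbol_bound_def)
    have "continuous_on (T \<times> Y) (\<lambda>q. \<integral>p. slice (h (fst q)) (snd q) p \<partial>lborel)"
    proof (rule continuous_on_parametric_integral[OF i])
      fix p :: "'x \<times> 'z"
      show "continuous_on (T \<times> Y) (\<lambda>q. slice (h (fst q)) (snd q) p)"
      proof (cases "p \<in> X \<times> - {0}")
        case True
        have "continuous_on (T \<times> Y) (\<lambda>q. (\<lambda>(t, z). h t z) (fst q, (fst p, snd q, snd p)))"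
          by (rule continuous_on_compose2[OF c]) (use True in \<open>auto intro!: continuous_intros\<close>)
        with True show ?thesis by (simp add: slice_def)
      qed (simp add: slice_def)
    qed (use slice_measurable[OF b] C in auto)
    moreover have "norm (\<integral>p. slice (h t) y p \<partial>lborel) \<le> (\<integral>p. C * majorant m p \<partial>lborel) * 1 powr 0"
      if "t \<in> T" "y \<in> Y" for t y
    proof -
      have "norm (\<integral>p. slice (h t) y p \<partial>lborel) \<le> (\<integral>p. norm (slice (h t) y p) \<partial>lborel)"
        by (rule integral_norm_bound)
      also have "\<dots> \<le> (\<integral>p. C * majorant m p \<partial>lborel)"
        using C(2)[OF that]
        by (intro integral_mono integrable_norm slice_integrable[OF b m z that] i) auto
      finally show ?thesis by simp
    qed
    ultimately show ?thesis unfolding symbol_bound_def by (auto simp: case_prod_unfold)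
  qed
  {
    case 0 then show ?case using base by simp
  next
    case (Suc k)
    note b = symfam_bound[OF Suc.prems(1)]
    have m: "m < - real DIM('z)" using Suc.prems(2) by simp
    have hdiff: "h t differentiable (at p)" if "t \<in> T" "p \<in> S" for t p
      using symfam_differentiable[OF Suc.prems(1) that] .
    have hb: "symfam T S J3 Ydirs (\<lambda>_. 1) k (m + 1) (\<lambda>t. pderiv1 (0, b, 0) (h t))" if "b \<in> Basis" for b
      using Suc.prems(1) that by auto
    have zb: "pderiv1 (0, b, 0) (h t) p = 0" if "t \<in> T" "p \<in> S" "fst p \<notin> K" for b t p
      using that pderiv1_supp[of "h t" p] Suc.prems(3)[OF that(1)] by blast
    have m1: "m + 1 + real k < - real DIM('z)" "m + 1 < - real DIM('z)" using Suc.prems(2) by auto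
    have "\<forall>b\<in>Basis. \<exists>C. C \<ge> 0 \<and> (\<forall>t\<in>T. \<forall>y\<in>Y. \<forall>p. norm (slice (pderiv1 (0, b, 0) (h t)) y p) \<le> C * majorant (m + 1) p)"
      using slice_bound[OF symfam_bound[OF hb] zb] by metis
    then obtain C where C: "\<And>b. b \<in> Basis \<Longrightarrow> C b \<ge> 0"
      "\<And>b t y p. b \<in> Basis \<Longrightarrow> t \<in> T \<Longrightarrow> y \<in> Y \<Longrightarrow>
        norm (slice (pderiv1 (0, b, 0) (h t)) y p) \<le> C b * majorant (m + 1) p"
      by metis
    define W where "W = (\<Sum>b\<in>(Basis::'y set). C b)"
    have W: "norm (slice (pderiv1 (0, b, 0) (h t)) y p) \<le> W * majorant (m + 1) p"
      if "b \<in> Basis" "t \<in> T" "y \<in> Y" for b t y p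
    proof -
      have "C b \<le> W" unfolding W_def using C(1) that by (intro member_le_sum) auto
      then show ?thesis using C(2)[OF that] majorant_nonneg by (meson mult_right_mono order_trans)
    qed
    have hd: "((\<lambda>y. \<integral>p. slice (h t) y p \<partial>lborel) has_derivative (\<lambda>v. \<Sum>b\<in>Basis. (v \<bullet> b) *\<^sub>R
        (\<integral>p. pderiv1 b (\<lambda>y. slice (h t) y p) y0 \<partial>lborel))) (at y0)" if t: "t \<in> T" and y0: "y0 \<in> Y" for t y0
    proof (rule has_derivative_parametric_integral[OF open_Y y0, where w = "\<lambda>p. W * majorant (m + 1) p"])
      show "integrable lborel (slice (h t) y)" if "y \<in> Y" for y
        by (rule slice_integrable[OF b m Suc.prems(3) t that])
      show "(\<lambda>p. pderiv1 b (\<lambda>y. slice (h t) y p) y0) \<in> borel_measurable lborel" if "b \<in> Basis" for b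
        using slice_measurable[OF symfam_bound[OF hb[OF that]] t y0]
        by (simp add: slice_pderiv1_y(2)[OF hdiff[OF t] y0])
      show "norm (pderiv1 b (\<lambda>y. slice (h t) y p) y) \<le> W * majorant (m + 1) p" if "b \<in> Basis" "y \<in> Y" for b y p
        using W[OF that(1) t that(2)] by (simp add: slice_pderiv1_y(2)[OF hdiff[OF t] that(2)])
    qed (use majorant_integrable[OF m1(2)] slice_pderiv1_y(1)[OF hdiff[OF t]] in auto)
    have "symfam T Y (\<lambda>_. 1) Basis (\<lambda>_. 0) k (0 + 0) (\<lambda>t. pderiv1 b (\<lambda>y. \<integral>p. slice (h t) y p \<partial>lborel))"
      if b: "b \<in> Basis" for b
    proof -
      interpret WY: weighted_region T Y "\<lambda>_. 1" Basis by unfold_locales (simp_all add: open_Y)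
      have "pderiv1 b (\<lambda>y. \<integral>p. slice (h t) y p \<partial>lborel) y = (\<integral>p. slice (pderiv1 (0, b, 0) (h t)) y p \<partial>lborel)"
        if "t \<in> T" "y \<in> Y" for t y
      proof -
        have "pderiv1 b (\<lambda>y. \<integral>p. slice (h t) y p \<partial>lborel) y
            = (\<Sum>b'\<in>Basis. (b \<bullet> b') *\<^sub>R (\<integral>p. slice (pderiv1 (0, b', 0) (h t)) y p \<partial>lborel))"
          using pderiv1_has_derivative[OF hd[OF that]] by (simp add: slice_pderiv1_y(2)[OF hdiff[OF that(1)] that(2)])
        also have "\<dots> = (\<Sum>b'\<in>Basis. if b' = b then (\<integral>p. slice (pderiv1 (0, b', 0) (h t)) y p \<partial>lborel) else 0)"
          using b by (intro sum.cong) (auto simp: inner_Basis)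
        also have "\<dots> = (\<integral>p. slice (pderiv1 (0, b, 0) (h t)) y p \<partial>lborel)" using b by simp
        finally show ?thesis .
      qed
      with Suc.IH[OF hb[OF b] m1(1) zb] show ?thesis
        by (auto elim!: WY.sym_cong_imp)
    qed
    moreover have "(\<lambda>y. \<integral>p. slice (h t) y p \<partial>lborel) differentiable (at y)" if "t \<in> T" "y \<in> Y" for t y
      using hd[OF that] differentiable_def by blast
    ultimately show ?case using base[OF b m Suc.prems(3)] by auto
  }
qed

text \<open>The slice of \<open>A\<close> is differentiable on the whole space, because it inherits this from \<open>A\<close> where \<open>x \<in> X\<close> and \<open>\<xi> \<noteq> 0\<close>, and
  vanishes on the open set where \<open>x \<notin> K\<close> or \<open>\<parallel>\<xi>\<parallel> < 1\<close>; these two sets cover everything.\<close>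

lemma integral_by_parts:
  assumes A: "symbol_bound T S J3 m A" "symbol_bound T S J3 m (\<lambda>t. pderiv1 (i, 0, l) (A t))"
    and m: "m < - real DIM('z)"
    and diff: "\<And>t p. t \<in> T \<Longrightarrow> p \<in> S \<Longrightarrow> A t differentiable (at p)"
    and z: "\<And>t p. t \<in> T \<Longrightarrow> p \<in> S \<Longrightarrow> fst p \<notin> K \<or> norm (snd (snd p)) < 1 \<Longrightarrow> A t p = 0"
    and t: "t \<in> T" and y: "y \<in> Y"
  shows "(\<integral>p. slice (pderiv1 (i, 0, l) (A t)) y p \<partial>lborel) = 0"
proof -
  define U where "U = X \<times> - {0::'z}"
  define V where "V = (- K) \<times> (UNIV::'z set) \<union> UNIV \<times> ball 0 1"
  have U: "open U" unfolding U_def by (rule open_XZ)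
  have V: "open V" unfolding V_def using compact_K by (auto intro!: open_Un open_Times compact_imp_closed)
  have UV: "U \<union> V = UNIV" unfolding U_def V_def using K_subset by force
  let ?D = "pderiv1 (i, 0, l) (A t)"
  have hV: "slice (A t) y p = 0" if "p \<in> V" for p
    using z[OF t, of "(fst p, y, snd p)"] that y by (auto simp: slice_def V_def mem_Times_iff)
  have DV: "slice ?D y p = 0" if "p \<in> V" for p
  proof (cases "p \<in> U")
    case True
    have "?D (fst p, y, snd p) = 0"
    proof (rule pderiv1_zero_open)
      show "open (S \<inter> ((- K) \<times> UNIV \<union> UNIV \<times> UNIV \<times> ball 0 1))"
        using compact_K open_regions(1) by (auto intro!: open_Int open_Un open_Times compact_imp_closed)
      show "(fst p, y, snd p) \<in> S \<inter> ((- K) \<times> UNIV \<union> UNIV \<times> UNIV \<times> ball 0 1)"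
        using True that y by (auto simp: U_def V_def mem_Times_iff)
      show "A t q = 0" if "q \<in> S \<inter> ((- K) \<times> UNIV \<union> UNIV \<times> UNIV \<times> ball 0 1)" for q
        using z[OF t, of q] that by (auto simp: mem_Times_iff)
    qed
    then show ?thesis by (simp add: slice_def)
  qed (simp add: slice_def U_def)
  have D: "slice (A t) y differentiable (at p) \<and> pderiv1 (i, l) (slice (A t) y) p = slice ?D y p" for p
  proof (cases "p \<in> U")
    case True
    have hd: "((\<lambda>p. (fst p, y, snd p)) has_derivative (\<lambda>p. (fst p, 0, snd p))) (at p)"
      by (auto intro!: derivative_eq_intros)
    have d: "A t differentiable (at (fst p, y, snd p))" using True y by (intro diff t) (auto simp: U_def mem_Times_iff)
    have eq: "slice (A t) y q = A t (fst q, y, snd q)" if "q \<in> U" for q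
      using that by (simp add: slice_def U_def)
    have "slice (A t) y differentiable (at p) \<longleftrightarrow> (\<lambda>q. A t (fst q, y, snd q)) differentiable (at p)"
      by (rule differentiable_cong_open[OF U True eq])
    moreover have "pderiv1 (i, l) (slice (A t) y) p = pderiv1 (i, l) (\<lambda>q. A t (fst q, y, snd q)) p"
      by (rule pderiv1_cong_open[OF U True eq])
    moreover have "slice ?D y p = ?D (fst p, y, snd p)" using True by (simp add: slice_def U_def)
    ultimately show ?thesis using pderiv1_compose[OF hd d] by simp
  next
    case False
    then have "p \<in> V" using UV by blast
    then show ?thesis
      using differentiable_cong_open[OF V _ hV, of p] pderiv1_zero_open[OF V _ hV, of p] DV[of p] by simp
  qed
  have "(\<integral>p. pderiv1 (i, l) (slice (A t) y) p \<partial>lborel) = 0"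
  proof (rule integral_pderiv1_eq_0)
    have eq: "pderiv1 (i, l) (slice (A t) y) = slice ?D y" using D by blast
    show "integrable lborel (pderiv1 (i, l) (slice (A t) y))"
      unfolding eq
    proof (rule slice_integrable[OF A(2) m _ t y])
      show "pderiv1 (i, 0, l) (A t) p = 0" if "t \<in> T" "p \<in> S" "fst p \<notin> K" for t p
        using that pderiv1_supp[of "A t" p] z[OF that(1)] by blast
    qed
    show "integrable lborel (slice (A t) y)"
      by (rule slice_integrable[OF A(1) m _ t y]) (use z in blast)
    have "continuous_on (U \<union> V) (slice ?D y)"
    proof (rule continuous_on_open_Un[OF U V])
      show "continuous_on U (slice ?D y)" unfolding U_def by (rule slice_continuous[OF A(2) t y])
      show "continuous_on V (slice ?D y)" using DV continuous_on_eq[OF continuous_on_const[of V 0]] by metis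
    qed
    then show "continuous_on UNIV (pderiv1 (i, l) (slice (A t) y))" unfolding eq UV .
  qed (use D in blast)
  then show ?thesis using D by simp
qed

abbreviation e :: "'i \<Rightarrow> 'x \<times> 'y \<times> 'z \<Rightarrow> complex"
  where "e t p \<equiv> exp (\<i> * of_real (\<Phi> t p))"

abbreviation "w1 \<equiv> wt 1 0 :: 'x \<times> 'y \<times> 'z \<Rightarrow> real"

lemma \<Phi>_diff: "t \<in> T \<Longrightarrow> p \<in> S \<Longrightarrow> \<Phi> t differentiable (at p)"
  using \<Phi>_smooth smooth_on_differentiable by blast

text \<open>Second \<open>\<xi>\<close>-derivatives of a homogeneous phase blow up at \<open>\<xi> = 0\<close>, but its \<open>y\<close>-derivatives are of order 1
  down to the origin, and they are all that differentiation under the integral sign needs.\<close>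

lemma exp_Y: "symfam T S J3 Ydirs (\<lambda>_. 1) k 0 e"
proof (rule symfam_Suc_imp, rule RY.sym_cis)
  show "RY.symb (\<lambda>_. 1) k 1 (\<lambda>t. pderiv1 b (\<Phi> t))" if "b \<in> Ydirs" for b
    using RY.sym_mono[OF symfam_pderiv1[OF \<Phi>_y that], of 1 "\<lambda>_. 1"] by simp
  show "continuous_on (T \<times> S) (\<lambda>(t, z). \<Phi> t z)"
    using symfam_bound[OF \<Phi>_y[of 0]] by (simp add: symbol_bound_def)
qed (rule \<Phi>_diff)

lemma exp_S1: "R1.symb w1 k 0 e"
proof (rule symfam_Suc_imp, rule R1.sym_cis)
  show "R1.symb w1 k (w1 b) (\<lambda>t. pderiv1 b (\<Phi> t))" if "b \<in> Basis" for b
    using R1.sym_mono[OF symfam_pderiv1[OF \<Phi>_sym that], of "w1 b" w1] by (auto simp: wt_def)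
  show "continuous_on (T \<times> S1) (\<lambda>(t, z). \<Phi> t z)"
    using symfam_bound[OF \<Phi>_sym[of 0]] by (simp add: symbol_bound_def)
  show "\<Phi> t differentiable (at p)" if "t \<in> T" "p \<in> S1" for t p
    using that by (intro \<Phi>_diff) auto
qed

abbreviation "ord \<kappa> \<equiv> d - real \<kappa> * gain"

lemma eg_Y: "symfam T S J3 Ydirs (\<lambda>_. 1) k (ord \<kappa>) (\<lambda>t p. e t p * amp_iter \<kappa> t p)"
proof (rule RY.sym_mult'[OF exp_Y])
  have "RY.symb wS k (ord \<kappa>) (amp_iter \<kappa>)"
    by (rule symfam_subset[OF amp_iter_sym]) auto
  then show "RY.symb (\<lambda>_. 1) k (ord \<kappa>) (amp_iter \<kappa>)"
    by (rule RY.sym_mono) (use \<delta> in auto)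
qed simp

lemma alpha_eg_sym:
  assumes "l \<in> Basis" shows "R.symb w1 k (ord \<kappa>) (\<lambda>t p. osc_alpha chi (\<Phi> t) l p * amp_iter \<kappa> t p * e t p)"
proof (rule symfam_glue)
  have "R1.symb wS k (ord \<kappa>) (\<lambda>t p. osc_alpha chi (\<Phi> t) l p * amp_iter \<kappa> t p)"
    by (rule symfam_subset[OF alpha_mult_sym[OF assms amp_iter_sym]]) auto
  from R1.sym_mono[OF this order_refl wt_le(2)]
  show "R1.symb w1 k (ord \<kappa>) (\<lambda>t p. osc_alpha chi (\<Phi> t) l p * amp_iter \<kappa> t p * e t p)"
    by (rule R1.sym_mult'[OF _ exp_S1]) simp
qed (use chi_1 in \<open>auto simp: osc_alpha_eq\<close>)

lemma beta_eg_sym: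
  assumes "i \<in> Basis" shows "R.symb w1 k (ord \<kappa> - 1) (\<lambda>t p. osc_beta chi (\<Phi> t) i p * amp_iter \<kappa> t p * e t p)"
proof (rule symfam_glue)
  have "R1.symb wS k (ord \<kappa> - 1) (\<lambda>t p. osc_beta chi (\<Phi> t) i p * amp_iter \<kappa> t p)"
    by (rule symfam_subset[OF beta_mult_sym[OF assms amp_iter_sym]]) auto
  from R1.sym_mono[OF this order_refl wt_le(2)]
  show "R1.symb w1 k (ord \<kappa> - 1) (\<lambda>t p. osc_beta chi (\<Phi> t) i p * amp_iter \<kappa> t p * e t p)"
    by (rule R1.sym_mult'[OF _ exp_S1]) simp
qed (use chi_1 in \<open>auto simp: osc_beta_eq\<close>)

lemma osc_r_pos: "t \<in> T \<Longrightarrow> p \<in> S \<Longrightarrow> osc_r (\<Phi> t) p > 0"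
proof -
  assume t: "t \<in> T" and p: "p \<in> S"
  obtain x y \<xi> where p: "p = (x, y, \<xi>)" "x \<in> X" "y \<in> Y" "\<xi> \<noteq> 0" using p by auto
  have "0 < (norm \<xi>)\<^sup>2 * \<alpha>" using p \<alpha>_pos by simp
  also have "\<dots> \<le> (norm \<xi>)\<^sup>2 * ((norm (grad_x (\<Phi> t) (x, y, \<xi>)))\<^sup>2 / (norm \<xi>)\<^sup>2 + (norm (grad_xi (\<Phi> t) (x, y, \<xi>)))\<^sup>2)"
    using ellip[OF t p(2,3,4)] by (intro mult_left_mono) auto
  also have "\<dots> = osc_r (\<Phi> t) p" using p by (simp add: osc_r_def algebra_simps)
  finally show ?thesis .
qed

text \<open>The coefficients are made for this: the transpose of \<open>L\<close> fixes \<open>e\<^sup>i\<^sup>\<Phi>\<close>.\<close>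

lemma transport_identity:
  assumes "t \<in> T" "p \<in> S"
  shows "(\<Sum>l\<in>Basis. osc_alpha chi (\<Phi> t) l p * (\<i> * of_real (pderiv1 (0, 0, l) (\<Phi> t) p)))
      + (\<Sum>i\<in>Basis. osc_beta chi (\<Phi> t) i p * (\<i> * of_real (pderiv1 (i, 0, 0) (\<Phi> t) p)))
      = 1 - chi (snd (snd p))"
proof -
  let ?r = "osc_r (\<Phi> t) p" and ?c = "1 - chi (snd (snd p))"
  have r: "of_real ?r \<noteq> (0::complex)" using osc_r_pos[OF assms] by simp
  have 1: "(\<Sum>l\<in>Basis. osc_alpha chi (\<Phi> t) l p * (\<i> * of_real (pderiv1 (0, 0, l) (\<Phi> t) p)))
      = of_real (inverse ?r) * ?c * of_real ((norm (snd (snd p)))\<^sup>2 * (\<Sum>l\<in>Basis. (pderiv1 (0, 0, l) (\<Phi> t) p)\<^sup>2))"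
    unfolding osc_alpha_eq of_real_mult of_real_sum sum_distrib_left
    by (intro sum.cong) (auto simp: power2_eq_square algebra_simps)
  have 2: "(\<Sum>i\<in>Basis. osc_beta chi (\<Phi> t) i p * (\<i> * of_real (pderiv1 (i, 0, 0) (\<Phi> t) p)))
      = of_real (inverse ?r) * ?c * of_real (\<Sum>i\<in>Basis. (pderiv1 (i, 0, 0) (\<Phi> t) p)\<^sup>2)"
    unfolding osc_beta_eq of_real_mult of_real_sum sum_distrib_left
    by (intro sum.cong) (auto simp: power2_eq_square algebra_simps)
  show ?thesis unfolding 1 2 distrib_left[symmetric] of_real_add[symmetric] osc_r_eq[symmetric]
    using r by simp
qed

text \<open>Expanding the divergence, the terms in which the exponential is differentiated add up to
  \<open>(1 - \<chi>) f e\<^sup>i\<^sup>\<Phi>\<close> by the transport identity, and the others are \<open>(\<chi> f - L f) e\<^sup>i\<^sup>\<Phi>\<close>, where \<open>f\<close> is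
  the \<open>\<kappa>\<close>-fold image of the amplitude.\<close>

lemma divergence_identity:
  assumes t: "t \<in> T" and p: "p \<in> S"
  shows "(\<Sum>l\<in>Basis. pderiv1 (0, 0, l) (\<lambda>p. osc_alpha chi (\<Phi> t) l p * amp_iter \<kappa> t p * e t p) p)
      + (\<Sum>i\<in>Basis. pderiv1 (i, 0, 0) (\<lambda>p. osc_beta chi (\<Phi> t) i p * amp_iter \<kappa> t p * e t p) p)
      = e t p * amp_iter \<kappa> t p - e t p * amp_iter (Suc \<kappa>) t p"
proof -
  have hd: "(e t has_derivative (\<lambda>v. \<i> * of_real (pderiv1 v (\<Phi> t) p) * e t p)) (at p)"
  proof -
    have "((\<lambda>z. \<i> * of_real (\<Phi> t z)) has_derivative (\<lambda>v. \<i> * of_real (pderiv1 v (\<Phi> t) p))) (at p)"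
      by (intro has_derivative_mult_right has_derivative_of_real differentiable_has_pderiv1 \<Phi>_diff t p)
    from has_derivative_compose[OF this DERIV_exp[unfolded has_field_derivative_def]]
    show ?thesis by (simp add: mult_ac)
  qed
  then have ed: "e t differentiable (at p)" using differentiable_def by blast
  have pe: "pderiv1 v (\<lambda>p. f p * amp_iter \<kappa> t p * e t p) p
      = e t p * pderiv1 v (\<lambda>p. f p * amp_iter \<kappa> t p) p + e t p * amp_iter \<kappa> t p * (f p * (\<i> * of_real (pderiv1 v (\<Phi> t) p)))"
    if "(\<lambda>p. f p * amp_iter \<kappa> t p) differentiable (at p)" for f v
    by (subst pderiv1_mult[OF that ed]) (simp add: pderiv1_has_derivative[OF hd] algebra_simps)
  have da: "(\<lambda>p. osc_alpha chi (\<Phi> t) l p * amp_iter \<kappa> t p) differentiable (at p)" if "l \<in> Basis" for l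
    by (rule symfam_differentiable[OF alpha_mult_sym[OF that amp_iter_sym] t p])
  have db: "(\<lambda>p. osc_beta chi (\<Phi> t) i p * amp_iter \<kappa> t p) differentiable (at p)" if "i \<in> Basis" for i
    by (rule symfam_differentiable[OF beta_mult_sym[OF that amp_iter_sym] t p])
  have "(\<Sum>l\<in>Basis. pderiv1 (0, 0, l) (\<lambda>p. osc_alpha chi (\<Phi> t) l p * amp_iter \<kappa> t p * e t p) p)
      + (\<Sum>i\<in>Basis. pderiv1 (i, 0, 0) (\<lambda>p. osc_beta chi (\<Phi> t) i p * amp_iter \<kappa> t p * e t p) p)
    = e t p * ((\<Sum>l\<in>Basis. pderiv1 (0, 0, l) (\<lambda>p. osc_alpha chi (\<Phi> t) l p * amp_iter \<kappa> t p) p)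
        + (\<Sum>i\<in>Basis. pderiv1 (i, 0, 0) (\<lambda>p. osc_beta chi (\<Phi> t) i p * amp_iter \<kappa> t p) p))
      + e t p * amp_iter \<kappa> t p * ((\<Sum>l\<in>Basis. osc_alpha chi (\<Phi> t) l p * (\<i> * of_real (pderiv1 (0, 0, l) (\<Phi> t) p)))
      + (\<Sum>i\<in>Basis. osc_beta chi (\<Phi> t) i p * (\<i> * of_real (pderiv1 (i, 0, 0) (\<Phi> t) p))))"
    by (simp add: pe da db sum.distrib distrib_left sum_distrib_left)
  also have "(\<Sum>l\<in>Basis. pderiv1 (0, 0, l) (\<lambda>p. osc_alpha chi (\<Phi> t) l p * amp_iter \<kappa> t p) p)
        + (\<Sum>i\<in>Basis. pderiv1 (i, 0, 0) (\<lambda>p. osc_beta chi (\<Phi> t) i p * amp_iter \<kappa> t p) p)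
      = chi (snd (snd p)) * amp_iter \<kappa> t p - amp_iter (Suc \<kappa>) t p"
    by (simp add: amp_iter_def osc_L_eq[of chi "\<Phi> t" "(osc_L chi (\<Phi> t) ^^ \<kappa>) (amp t)"])
  also note transport_identity[OF t p]
  finally show ?thesis by (simp add: algebra_simps)
qed

lemma integral_amp_iter_Suc:
  assumes m: "ord \<kappa> < - real DIM('z)" and t: "t \<in> T" and y: "y \<in> Y"
  shows "(\<integral>p. slice (\<lambda>p. e t p * amp_iter (Suc \<kappa>) t p) y p \<partial>lborel) = (\<integral>p. slice (\<lambda>p. e t p * amp_iter \<kappa> t p) y p \<partial>lborel)"
proof -
  let ?A = "\<lambda>l t p. osc_alpha chi (\<Phi> t) l p * amp_iter \<kappa> t p * e t p"
  let ?B = "\<lambda>i t p. osc_beta chi (\<Phi> t) i p * amp_iter \<kappa> t p * e t p"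
  have zA: "?A l t p = 0" if "t \<in> T" "p \<in> S" "fst p \<notin> K \<or> norm (snd (snd p)) < 1" for l t p
    using that amp_iter_supp[of t p] chi_1 by (auto simp: osc_alpha_eq)
  have zB: "?B l t p = 0" if "t \<in> T" "p \<in> S" "fst p \<notin> K \<or> norm (snd (snd p)) < 1" for l t p
    using that amp_iter_supp[of t p] chi_1 by (auto simp: osc_beta_eq)
  have bA: "symbol_bound T S J3 (ord \<kappa>) (\<lambda>t. pderiv1 (0, 0, l) (?A l t))" if "l \<in> Basis" for l
    using R.sym_mono[OF symfam_pderiv1[OF alpha_eg_sym[OF that, of "Suc 0" \<kappa>], of "(0, 0, l)"], of "ord \<kappa>" w1] that
    by (auto simp: nonzero_Basis)
  have bB: "symbol_bound T S J3 (ord \<kappa>) (\<lambda>t. pderiv1 (i, 0, 0) (?B i t))" if "i \<in> Basis" for i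
    using R.sym_mono[OF symfam_pderiv1[OF beta_eg_sym[OF that, of "Suc 0" \<kappa>], of "(i, 0, 0)"], of "ord \<kappa>" w1] that
    by auto
  have sA: "fst p \<notin> K \<Longrightarrow> pderiv1 v (?A l t) p = 0" "fst p \<notin> K \<Longrightarrow> pderiv1 v (?B i t) p = 0"
    if "t \<in> T" "p \<in> S" for l i t p v
    using pderiv1_supp[of "?A l t" p v] pderiv1_supp[of "?B i t" p v] zA zB that by blast+
  have iA: "integrable lborel (slice (pderiv1 (0, 0, l) (?A l t)) y)" if "l \<in> Basis" for l
    by (rule slice_integrable[OF bA[OF that] m _ t y]) (rule sA)
  have iB: "integrable lborel (slice (pderiv1 (i, 0, 0) (?B i t)) y)" if "i \<in> Basis" for i
    by (rule slice_integrable[OF bB[OF that] m _ t y]) (rule sA)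
  have IA: "(\<integral>p. slice (pderiv1 (0, 0, l) (?A l t)) y p \<partial>lborel) = 0" if "l \<in> Basis" for l
    by (rule integral_by_parts[OF symfam_bound[OF alpha_eg_sym[OF that]] bA[OF that] m
          symfam_differentiable[OF alpha_eg_sym[OF that]] zA t y])
  have IB: "(\<integral>p. slice (pderiv1 (i, 0, 0) (?B i t)) y p \<partial>lborel) = 0" if "i \<in> Basis" for i
    by (rule integral_by_parts[OF R.bnd_mono[OF symfam_bound[OF beta_eg_sym[OF that]]] bB[OF that] m
          symfam_differentiable[OF beta_eg_sym[OF that]] zB t y]) simp
  have m': "ord (Suc \<kappa>) < - real DIM('z)" using m gain_pos by (simp add: algebra_simps)
  have ig: "integrable lborel (slice (\<lambda>p. e t p * amp_iter j t p) y)" if "ord j < - real DIM('z)" for j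
    by (rule slice_integrable[OF symfam_bound[OF eg_Y] that _ t y]) (simp add: amp_iter_supp)
  have "(\<integral>p. slice (\<lambda>p. e t p * amp_iter \<kappa> t p) y p \<partial>lborel) - (\<integral>p. slice (\<lambda>p. e t p * amp_iter (Suc \<kappa>) t p) y p \<partial>lborel)
    = (\<integral>p. slice (\<lambda>p. e t p * amp_iter \<kappa> t p) y p - slice (\<lambda>p. e t p * amp_iter (Suc \<kappa>) t p) y p \<partial>lborel)"
    by (rule Bochner_Integration.integral_diff[OF ig[OF m] ig[OF m'], symmetric])
  also have "\<dots> = (\<integral>p. (\<Sum>l\<in>Basis. slice (pderiv1 (0, 0, l) (?A l t)) y p)
      + (\<Sum>i\<in>Basis. slice (pderiv1 (i, 0, 0) (?B i t)) y p) \<partial>lborel)"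
  proof (rule Bochner_Integration.integral_cong[OF refl])
    fix p :: "'x \<times> 'z"
    show "slice (\<lambda>p. e t p * amp_iter \<kappa> t p) y p - slice (\<lambda>p. e t p * amp_iter (Suc \<kappa>) t p) y p
      = (\<Sum>l\<in>Basis. slice (pderiv1 (0, 0, l) (?A l t)) y p) + (\<Sum>i\<in>Basis. slice (pderiv1 (i, 0, 0) (?B i t)) y p)"
    proof (cases "p \<in> X \<times> - {0}")
      case True
      then have "(fst p, y, snd p) \<in> S" using y by (simp add: mem_Times_iff)
      from divergence_identity[OF t this, of \<kappa>] True show ?thesis by (simp add: slice_def)
    qed (simp add: slice_def)
  qed
  also have "\<dots> = 0"
    using iA iB by (simp add: IA IB Bochner_Integration.integral_sum)
  finally show ?thesis by simp
qed

lemma integral_amp_iter_add: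
  assumes "ord \<kappa> < - real DIM('z)" "t \<in> T" "y \<in> Y"
  shows "(\<integral>p. slice (\<lambda>p. e t p * amp_iter (\<kappa> + j) t p) y p \<partial>lborel) = (\<integral>p. slice (\<lambda>p. e t p * amp_iter \<kappa> t p) y p \<partial>lborel)"
proof (induction j)
  case (Suc j)
  have "ord (\<kappa> + j) \<le> ord \<kappa>" using gain_pos by (simp add: mult_right_mono)
  then show ?case using integral_amp_iter_Suc[of "\<kappa> + j" t y] Suc assms by simp
qed simp

lemma FIO_transpose_slice:
  assumes "ord \<kappa> < - real DIM('z)" "t \<in> T" "y \<in> Y" "X \<subseteq> X0"
  shows "FIO_transpose X0 chi \<kappa> (\<Phi> t) (a t) (\<psi> t) y
    = of_real (1 / (2 * pi) ^ DIM('z)) * (\<integral>p. slice (\<lambda>p. e t p * amp_iter \<kappa> t p) y p \<partial>lborel)"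
proof -
  let ?h = "slice (\<lambda>p. e t p * amp_iter \<kappa> t p) y"
  have i: "integrable lborel ?h"
    by (rule slice_integrable[OF symfam_bound[OF eg_Y] assms(1) _ assms(2,3)]) (simp add: amp_iter_supp)
  have "(LINT \<xi>:Xi|lborel. LINT x:X0|lborel. exp (\<i> * of_real (\<Phi> t (x, y, \<xi>))) *
       (osc_L chi (\<Phi> t) ^^ \<kappa>) (\<lambda>(x, y, \<xi>). a t (x, y, \<xi>) * \<psi> t x) (x, y, \<xi>))
    = (\<integral>\<xi>. \<integral>x. ?h (x, \<xi>) \<partial>lborel \<partial>lborel)"
    unfolding set_lebesgue_integral_def
  proof (rule Bochner_Integration.integral_cong[OF refl])
    fix \<xi> :: 'z
    have "indicator X0 x *\<^sub>R (exp (\<i> * of_real (\<Phi> t (x, y, \<xi>))) *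
       (osc_L chi (\<Phi> t) ^^ \<kappa>) (\<lambda>(x, y, \<xi>). a t (x, y, \<xi>) * \<psi> t x) (x, y, \<xi>)) = ?h (x, \<xi>)"
      if "\<xi> \<noteq> 0" for x
    proof -
      have "(osc_L chi (\<Phi> t) ^^ \<kappa>) (\<lambda>(x, y, \<xi>). a t (x, y, \<xi>) * \<psi> t x) (x, y, \<xi>) = amp_iter \<kappa> t (x, y, \<xi>)"
        by (simp add: amp_iter_def amp_def)
      then show ?thesis
        using that amp_iter_supp[OF assms(2), of "(x, y, \<xi>)" \<kappa>] assms(4)
        by (cases "x \<in> K") (use K_subset in \<open>auto simp: slice_def split: split_indicator\<close>)
    qed
    then show "indicator Xi \<xi> *\<^sub>R (\<integral>x. indicator X0 x *\<^sub>R (exp (\<i> * of_real (\<Phi> t (x, y, \<xi>))) *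
       (osc_L chi (\<Phi> t) ^^ \<kappa>) (\<lambda>(x, y, \<xi>). a t (x, y, \<xi>) * \<psi> t x) (x, y, \<xi>)) \<partial>lborel)
      = (\<integral>x. ?h (x, \<xi>) \<partial>lborel)"
      by (cases "\<xi> = 0") (auto simp: slice_def)
  qed
  also have "\<dots> = (\<integral>p. ?h p \<partial>lborel)"
    using lborel_pair.integral_snd[of "\<lambda>x \<xi>. ?h (x, \<xi>)"] i by (simp add: lborel_prod)
  finally show ?thesis by (simp add: FIO_transpose_def)
qed

text \<open>For \<open>N\<close> derivatives in \<open>y\<close> the number of integrations by parts is raised from \<open>\<kappa>\<close> to \<open>\<kappa> + j\<close>, which
  does not change the integral but lowers the order of its integrand by at least \<open>N\<close>.\<close>

lemma FIO_transpose_family: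
  assumes m: "ord \<kappa> < - real DIM('z)" and X0: "X \<subseteq> X0"
  shows "smooth_family T Y N (\<lambda>t. FIO_transpose X0 chi \<kappa> (\<Phi> t) (a t) (\<psi> t))"
proof -
  interpret WY: weighted_region T Y "\<lambda>_. 1" Basis by unfold_locales (simp_all add: open_Y)
  obtain j where j: "real N \<le> real j * gain"
    using ex_less_of_nat_mult[OF gain_pos, of "real N"] less_imp_le by blast
  have "ord (\<kappa> + j) + real N < - real DIM('z)" using m j by (simp add: algebra_simps)
  from integral_family[OF eg_Y this]
  have "WY.symb (\<lambda>_. 0) N 0 (\<lambda>t y. \<integral>p. slice (\<lambda>p. e t p * amp_iter (\<kappa> + j) t p) y p \<partial>lborel)"
    by (simp add: amp_iter_supp)
  from WY.sym_mult'[OF WY.sym_const this, of 0 0 "of_real (1 / (2 * pi) ^ DIM('z))"]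
  show ?thesis
    by (auto simp: FIO_transpose_slice[OF m _ _ X0] integral_amp_iter_add[OF m] elim!: WY.sym_cong_imp)
qed

lemma amp_iter_linear:
  assumes t: "t1 \<in> T" "t2 \<in> T" "t3 \<in> T" and eq: "\<Phi> t1 = \<Phi> t3" "\<Phi> t2 = \<Phi> t3" "a t1 = a t3" "a t2 = a t3"
    and \<psi>: "\<And>x. \<psi> t3 x = c * \<psi> t1 x + \<psi> t2 x" and p: "p \<in> S"
  shows "amp_iter \<kappa> t3 p = c * amp_iter \<kappa> t1 p + amp_iter \<kappa> t2 p"
  using p
proof (induction \<kappa> arbitrary: p)
  case 0
  then show ?case by (auto simp: amp_iter_def amp_def \<psi> eq algebra_simps)
next
  case (Suc \<kappa>)
  have L: "bounded_linear ((*) c)" by (rule bounded_linear_mult_right)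
  have *: "pderiv1 v (\<lambda>p. f p * amp_iter \<kappa> t3 p) p
      = c * pderiv1 v (\<lambda>p. f p * amp_iter \<kappa> t1 p) p + pderiv1 v (\<lambda>p. f p * amp_iter \<kappa> t2 p) p"
    if "(\<lambda>p. f p * amp_iter \<kappa> t1 p) differentiable (at p)" "(\<lambda>p. f p * amp_iter \<kappa> t2 p) differentiable (at p)" for f v
  proof -
    have "pderiv1 v (\<lambda>p. f p * amp_iter \<kappa> t3 p) p = pderiv1 v (\<lambda>p. c * (f p * amp_iter \<kappa> t1 p) + f p * amp_iter \<kappa> t2 p) p"
      by (rule pderiv1_cong_open[OF open_regions(1) Suc.prems]) (simp add: Suc.IH algebra_simps)
    then show ?thesis
      using that by (simp add: pderiv1_add differentiable_linear_comp[OF L] pderiv1_linear_comp[OF L])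
  qed
  have da: "(\<lambda>p. osc_alpha chi (\<Phi> t3) l p * amp_iter \<kappa> t p) differentiable (at p)" if "l \<in> Basis" "t \<in> {t1, t2}" for l t
    using symfam_differentiable[OF alpha_mult_sym[OF that(1) amp_iter_sym], of t p] that Suc.prems t eq by auto
  have db: "(\<lambda>p. osc_beta chi (\<Phi> t3) i p * amp_iter \<kappa> t p) differentiable (at p)" if "i \<in> Basis" "t \<in> {t1, t2}" for i t
    using symfam_differentiable[OF beta_mult_sym[OF that(1) amp_iter_sym], of t p] that Suc.prems t eq by auto
  have gS: "amp_iter (Suc \<kappa>) t = osc_L chi (\<Phi> t) (amp_iter \<kappa> t)" for t by (simp add: amp_iter_def)
  have "(\<Sum>l\<in>Basis. pderiv1 (0, 0, l) (\<lambda>p. osc_alpha chi (\<Phi> t3) l p * amp_iter \<kappa> t3 p) p)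
    = c * (\<Sum>l\<in>Basis. pderiv1 (0, 0, l) (\<lambda>p. osc_alpha chi (\<Phi> t3) l p * amp_iter \<kappa> t1 p) p)
      + (\<Sum>l\<in>Basis. pderiv1 (0, 0, l) (\<lambda>p. osc_alpha chi (\<Phi> t3) l p * amp_iter \<kappa> t2 p) p)"
    unfolding sum_distrib_left sum.distrib[symmetric] by (intro sum.cong refl * da) auto
  moreover have "(\<Sum>i\<in>Basis. pderiv1 (i, 0, 0) (\<lambda>p. osc_beta chi (\<Phi> t3) i p * amp_iter \<kappa> t3 p) p)
    = c * (\<Sum>i\<in>Basis. pderiv1 (i, 0, 0) (\<lambda>p. osc_beta chi (\<Phi> t3) i p * amp_iter \<kappa> t1 p) p)
      + (\<Sum>i\<in>Basis. pderiv1 (i, 0, 0) (\<lambda>p. osc_beta chi (\<Phi> t3) i p * amp_iter \<kappa> t2 p) p)"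
    unfolding sum_distrib_left sum.distrib[symmetric] by (intro sum.cong refl * db) auto
  ultimately show ?case
    unfolding gS osc_L_eq eq by (simp add: Suc.IH[OF Suc.prems] algebra_simps)
qed

text \<open>Linearity in the test function, formulated for three members of one family that share their
  phase and amplitude, so that integrability is at hand for all of them.\<close>

lemma FIO_transpose_linear:
  assumes t: "t1 \<in> T" "t2 \<in> T" "t3 \<in> T" and eq: "\<Phi> t1 = \<Phi> t3" "\<Phi> t2 = \<Phi> t3" "a t1 = a t3" "a t2 = a t3"
    and \<psi>: "\<And>x. \<psi> t3 x = c * \<psi> t1 x + \<psi> t2 x"
    and m: "ord \<kappa> < - real DIM('z)" and y: "y \<in> Y" and X0: "X \<subseteq> X0"
  shows "FIO_transpose X0 chi \<kappa> (\<Phi> t3) (a t3) (\<psi> t3) y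
    = c * FIO_transpose X0 chi \<kappa> (\<Phi> t1) (a t1) (\<psi> t1) y + FIO_transpose X0 chi \<kappa> (\<Phi> t2) (a t2) (\<psi> t2) y"
proof -
  have i: "integrable lborel (slice (\<lambda>p. e t p * amp_iter \<kappa> t p) y)" if "t \<in> T" for t
    by (rule slice_integrable[OF symfam_bound[OF eg_Y] m _ that y]) (simp add: amp_iter_supp)
  have "slice (\<lambda>p. e t3 p * amp_iter \<kappa> t3 p) y p = c * slice (\<lambda>p. e t1 p * amp_iter \<kappa> t1 p) y p + slice (\<lambda>p. e t2 p * amp_iter \<kappa> t2 p) y p" for p
  proof (cases "p \<in> X \<times> - {0}")
    case True
    then have "(fst p, y, snd p) \<in> S" using y by (simp add: mem_Times_iff)
    from amp_iter_linear[OF t eq \<psi> this, of \<kappa>] True show ?thesis by (simp add: slice_def eq algebra_simps)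
  qed (simp add: slice_def)
  then have "(\<integral>p. slice (\<lambda>p. e t3 p * amp_iter \<kappa> t3 p) y p \<partial>lborel)
    = c * (\<integral>p. slice (\<lambda>p. e t1 p * amp_iter \<kappa> t1 p) y p \<partial>lborel) + (\<integral>p. slice (\<lambda>p. e t2 p * amp_iter \<kappa> t2 p) y p \<partial>lborel)"
    using i[OF t(1)] i[OF t(2)] by simp
  then show ?thesis
    using t by (simp add: FIO_transpose_slice[OF m _ y X0] algebra_simps)
qed

end

section \<open>Convergent sequences as families\<close>

definition seq_param :: "nat \<Rightarrow> real" where "seq_param n = inverse (real (Suc n))"

text \<open>A compact set with a single limit point: a sequence together with its limit is the same as a
  family over it that is continuous in the parameter.\<close>

definition seqT :: "real set" where "seqT = insert 0 (range seq_param)"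

definition seq_fam :: "'a \<Rightarrow> (nat \<Rightarrow> 'a) \<Rightarrow> real \<Rightarrow> 'a"
  where "seq_fam f0 f t = (if t = 0 then f0 else f (THE n. t = seq_param n))"

lemma seq_param_pos: "seq_param n > 0" by (simp add: seq_param_def)

lemma seq_param_less_iff [simp]: "seq_param m < seq_param n \<longleftrightarrow> n < m"
  by (simp add: seq_param_def)

lemma seq_param_eq_iff [simp]: "seq_param m = seq_param n \<longleftrightarrow> m = n"
  by (simp add: seq_param_def)

lemma seq_fam_0 [simp]: "seq_fam f0 f 0 = f0" by (simp add: seq_fam_def)

lemma seq_fam_param [simp]: "seq_fam f0 f (seq_param n) = f n"
  using seq_param_pos[of n] by (simp add: seq_fam_def)

lemma seqT_cases:
  assumes "t \<in> seqT" obtains "t = 0" | n where "t = seq_param n"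
  using assms by (auto simp: seqT_def)

lemma seqT_mem [simp]: "0 \<in> seqT" "seq_param n \<in> seqT" by (auto simp: seqT_def)

lemma seq_param_tendsto: "seq_param \<longlonglongrightarrow> 0"
  unfolding seq_param_def[abs_def] by (rule LIMSEQ_inverse_real_of_nat)

lemma compact_seqT: "compact seqT"
  unfolding seqT_def by (rule compact_sequence_with_limit[OF seq_param_tendsto])

text \<open>Continuity of each member suffices at the isolated parameters; at 0 the rate \<open>1 / (n + 1)\<close> supplies the
  joint continuity.  The finitely many members not covered by the rate enlarge the constant.\<close>

lemma symbol_bound_seq:
  fixes F :: "real \<Rightarrow> 'e::euclidean_space \<Rightarrow> 'b::real_normed_vector"
  assumes J: "continuous_on S J" "\<And>z. z \<in> S \<Longrightarrow> J z \<ge> 1"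
    and cont: "\<And>t. t \<in> seqT \<Longrightarrow> continuous_on S (F t)"
    and bnd: "\<And>t. t \<in> seqT \<Longrightarrow> \<exists>C. \<forall>z\<in>S. norm (F t z) \<le> C * J z powr m"
    and conv: "\<And>n z. n \<ge> N \<Longrightarrow> z \<in> S \<Longrightarrow> norm (F (seq_param n) z - F 0 z) \<le> seq_param n * (c * J z powr m)"
  shows "symbol_bound seqT S J m F"
  unfolding symbol_bound_def
proof
  have "\<forall>t\<in>seqT. \<exists>C. C \<ge> 0 \<and> (\<forall>z\<in>S. norm (F t z) \<le> C * J z powr m)"
  proof
    fix t assume "t \<in> seqT"
    then obtain C where C: "\<forall>z\<in>S. norm (F t z) \<le> C * J z powr m" using bnd by blast
    have "norm (F t z) \<le> \<bar>C\<bar> * J z powr m" if "z \<in> S" for z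
      using C that by (meson abs_ge_self mult_right_mono order_trans powr_ge_zero)
    then show "\<exists>C. C \<ge> 0 \<and> (\<forall>z\<in>S. norm (F t z) \<le> C * J z powr m)" by (intro exI[of _ "\<bar>C\<bar>"]) auto
  qed
  then obtain C where C: "\<And>t. t \<in> seqT \<Longrightarrow> C t \<ge> 0"
    "\<And>t z. t \<in> seqT \<Longrightarrow> z \<in> S \<Longrightarrow> norm (F t z) \<le> C t * J z powr m"
    by metis
  define B where "B = C 0 + \<bar>c\<bar> + (\<Sum>n<N. C (seq_param n))"
  have sum0: "(\<Sum>n<N. C (seq_param n)) \<ge> 0" using C(1) by (intro sum_nonneg) auto
  have "norm (F t z) \<le> B * J z powr m" if "t \<in> seqT" "z \<in> S" for t z
    using that(1)
  proof (cases rule: seqT_cases)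
    case 1
    have "C 0 \<le> B" using sum0 by (simp add: B_def)
    then show ?thesis using C(2)[of 0 z] that 1 by (meson mult_right_mono order_trans powr_ge_zero seqT_mem(1))
  next
    case (2 n)
    show ?thesis
    proof (cases "n < N")
      case True
      have "C (seq_param n) \<le> (\<Sum>n<N. C (seq_param n))"
        using True C(1) by (intro member_le_sum) auto
      then have "C (seq_param n) \<le> B" using C(1)[of 0] by (simp add: B_def)
      then show ?thesis using C(2)[of t z] that 2 by (meson mult_right_mono order_trans powr_ge_zero)
    next
      case False
      have s1: "seq_param n \<le> 1" by (simp add: seq_param_def field_simps)
      have "norm (F t z) \<le> norm (F 0 z) + norm (F t z - F 0 z)" by (metis norm_triangle_sub)
      also have "\<dots> \<le> C 0 * J z powr m + seq_param n * (c * J z powr m)"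
        using C(2)[of 0 z] conv[of n z] False that 2 by (intro add_mono) auto
      also have "seq_param n * (c * J z powr m) \<le> 1 * (\<bar>c\<bar> * J z powr m)"
      proof -
        have "seq_param n * (c * J z powr m) \<le> seq_param n * (\<bar>c\<bar> * J z powr m)"
          using seq_param_pos[of n] by (intro mult_left_mono mult_right_mono) auto
        also have "\<dots> \<le> 1 * (\<bar>c\<bar> * J z powr m)" using s1 by (intro mult_right_mono) auto
        finally show ?thesis .
      qed
      also have "C 0 * J z powr m + 1 * (\<bar>c\<bar> * J z powr m) \<le> B * J z powr m"
        using sum0 by (simp add: B_def distrib_right)
      finally show ?thesis by simp
    qed
  qed
  then show "\<exists>C. \<forall>t\<in>seqT. \<forall>z\<in>S. norm (F t z) \<le> C * J z powr m" by blast
  show "continuous_on (seqT \<times> S) (\<lambda>(t, z). F t z)"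
    unfolding continuous_on_def
  proof clarify
    fix t0 z0 assume t0: "t0 \<in> seqT" and z0: "z0 \<in> S"
    let ?at = "at (t0, z0) within seqT \<times> S"
    have tfst: "(fst \<longlongrightarrow> t0) ?at" and tsnd: "(snd \<longlongrightarrow> z0) ?at"
      using tendsto_fst[OF tendsto_ident_at] tendsto_snd[OF tendsto_ident_at] by fastforce+
    have inS: "eventually (\<lambda>q. q \<in> seqT \<times> S) ?at" by (simp add: eventually_at_topological) blast
    have lim: "((\<lambda>q. G (snd q)) \<longlongrightarrow> G z0) ?at" if "continuous_on S G" for G :: "'e \<Rightarrow> 'c::topological_space"
    proof -
      have "continuous_on (seqT \<times> S) (\<lambda>q. G (snd q))"
        by (rule continuous_on_compose2[OF that]) (auto intro!: continuous_intros)
      then show ?thesis using t0 z0 unfolding continuous_on_def by force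
    qed
    show "((\<lambda>(t, z). F t z) \<longlongrightarrow> F t0 z0) ?at"
      using t0
    proof (cases rule: seqT_cases)
      case 1
      have Jl: "((\<lambda>q. J (snd q) powr m) \<longlongrightarrow> J z0 powr m) ?at"
        using lim[OF J(1)] J(2)[OF z0] by (intro tendsto_powr tendsto_const) auto
      have "((\<lambda>q. F (fst q) (snd q) - F 0 (snd q)) \<longlongrightarrow> 0) ?at"
      proof (rule Lim_null_comparison)
        have "eventually (\<lambda>q. fst q < seq_param N) ?at"
          using order_tendstoD(2)[OF tfst] 1 seq_param_pos by simp
        then show "eventually (\<lambda>q. norm (F (fst q) (snd q) - F 0 (snd q)) \<le> fst q * (c * J (snd q) powr m)) ?at"
          using inS
        proof eventually_elim
          case (elim q)
          then have "fst q \<in> seqT" "snd q \<in> S" by auto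
          from this(1) show ?case
          proof (cases rule: seqT_cases)
            case (2 n)
            then show ?thesis using elim conv[of n "snd q"] \<open>snd q \<in> S\<close> by auto
          qed simp
        qed
        have "((\<lambda>q. fst q * (c * J (snd q) powr m)) \<longlongrightarrow> t0 * (c * J z0 powr m)) ?at"
          by (intro tendsto_mult tendsto_const tfst Jl)
        then show "((\<lambda>q. fst q * (c * J (snd q) powr m)) \<longlongrightarrow> 0) ?at" using 1 by simp
      qed
      from tendsto_add[OF lim[OF cont[of 0]] this] 1 show ?thesis by (simp add: case_prod_unfold)
    next
      case (2 n)
      (* A neighbourhood of t0 that contains no other parameter. *)
      define U where "U = {seq_param (Suc n)<..} - (seq_param ` {..n} - {seq_param n})"
      have U: "open U" unfolding U_def by (intro open_Diff open_greaterThan finite_imp_closed) auto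
      have nU: "t0 \<in> U" using 2 by (auto simp: U_def)
      have TU: "t = t0" if "t \<in> seqT" "t \<in> U" for t
        using that(1)
      proof (cases rule: seqT_cases)
        case 1 then show ?thesis using that(2) seq_param_pos[of "Suc n"] by (simp add: U_def)
      next
        case (2 m)
        then have "m \<le> n" using that(2) by (simp add: U_def)
        then show ?thesis using that(2) 2 \<open>t0 = seq_param n\<close> by (auto simp: U_def)
      qed
      have "eventually (\<lambda>q. fst q \<in> U) ?at" by (rule topological_tendstoD[OF tfst U nU])
      then have "eventually (\<lambda>q. F t0 (snd q) = (\<lambda>(t, z). F t z) q) ?at"
        using inS
      proof eventually_elim
        case (elim q)
        then have "fst q = t0" using TU[of "fst q"] by auto
        then show ?case by (simp add: case_prod_unfold)
      qed
      from Lim_transform_eventually[OF lim[OF cont[OF t0]] this] show ?thesis .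
    qed
  qed
qed

section \<open>Homogeneous phases, amplitudes and their seminorms\<close>

lemma split_directions:
  assumes "vs \<in> lists (Basis :: ('x::euclidean_space \<times> 'y::euclidean_space \<times> 'z::euclidean_space) set)"
  obtains js ks ls where "js \<in> lists Basis" "ks \<in> lists Basis" "ls \<in> lists Basis"
    "mset vs = mset (map (\<lambda>i. (i, 0, 0)) js @ map (\<lambda>i. (0, i, 0)) ks @ map (\<lambda>i. (0, 0, i)) ls)"
    "\<And>\<mu> \<nu>. sum_list (map (wt \<mu> \<nu>) vs) = \<mu> * real (length js + length ks) + \<nu> * real (length ls)"
    "length vs = length js + length ks + length ls"
proof -
  have "\<exists>js ks ls. js \<in> lists Basis \<and> ks \<in> lists Basis \<and> ls \<in> lists Basis \<and>
    mset vs = mset (map (\<lambda>i. (i, 0, 0)) js @ map (\<lambda>i. (0, i, 0)) ks @ map (\<lambda>i. (0, 0, i)) ls) \<and>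
    (\<forall>\<mu> \<nu>. sum_list (map (wt \<mu> \<nu>) vs) = \<mu> * real (length js + length ks) + \<nu> * real (length ls)) \<and>
    length vs = length js + length ks + length ls"
    using assms
  proof (induction vs)
    case Nil then show ?case by (intro exI[of _ "[]"]) auto
  next
    case (Cons v vs)
    then obtain js ks ls where IH: "js \<in> lists Basis" "ks \<in> lists Basis" "ls \<in> lists Basis"
      "mset vs = mset (map (\<lambda>i. (i, 0, 0)) js @ map (\<lambda>i. (0, i, 0)) ks @ map (\<lambda>i. (0, 0, i)) ls)"
      "\<And>\<mu> \<nu>. sum_list (map (wt \<mu> \<nu>) vs) = \<mu> * real (length js + length ks) + \<nu> * real (length ls)"
      "length vs = length js + length ks + length ls" by auto
    have "v \<in> Basis" using Cons.hyps by simp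
    then show ?case
    proof (cases rule: Basis3_cases)
      case (x i)
      show ?thesis
        by (intro exI[of _ "i # js"] exI[of _ ks] exI[of _ ls]) (use x IH in \<open>auto simp: algebra_simps\<close>)
    next
      case (y i)
      show ?thesis
        by (intro exI[of _ js] exI[of _ "i # ks"] exI[of _ ls]) (use y IH in \<open>auto simp: algebra_simps\<close>)
    next
      case (xi i)
      show ?thesis
        by (intro exI[of _ js] exI[of _ ks] exI[of _ "i # ls"])
          (use xi IH nonzero_Basis[OF xi(1)] in \<open>auto simp: algebra_simps\<close>)
    qed
  qed
  then show thesis using that by blast
qed

text \<open>Chain rule for the dilation \<open>(x, y, \<xi>) \<mapsto> (x, y, t \<xi>)\<close>, whose derivative fixes the first two groups of
  directions and multiplies the third by \<open>t\<close>.\<close>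

lemma pderiv1_homogeneous:
  fixes f :: "'x::euclidean_space \<times> 'y::euclidean_space \<times> 'z::euclidean_space \<Rightarrow> real"
  assumes S: "open X" "open Y"
    and diff: "\<And>p. p \<in> phase_dom X Y \<Longrightarrow> f differentiable (at p)"
    and hom: "\<And>x y \<xi> t. x \<in> X \<Longrightarrow> y \<in> Y \<Longrightarrow> \<xi> \<noteq> 0 \<Longrightarrow> t > 0 \<Longrightarrow> f (x, y, t *\<^sub>R \<xi>) = t powr s * f (x, y, \<xi>)"
    and p: "x \<in> X" "y \<in> Y" "\<xi> \<noteq> 0" and t: "t > 0"
  shows "pderiv1 (i, j, 0) f (x, y, t *\<^sub>R \<xi>) = t powr s * pderiv1 (i, j, 0) f (x, y, \<xi>)"
    and "pderiv1 (0, 0, l) f (x, y, t *\<^sub>R \<xi>) = t powr (s - 1) * pderiv1 (0, 0, l) f (x, y, \<xi>)"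
proof -
  let ?\<sigma> = "\<lambda>p. (fst p, fst (snd p), t *\<^sub>R snd (snd p)) :: 'x \<times> 'y \<times> 'z"
  have hd: "(?\<sigma> has_derivative ?\<sigma>) (at p)" for p by (auto intro!: derivative_eq_intros)
  have oS: "open (phase_dom X Y :: ('x \<times> 'y \<times> 'z) set)" using S by (auto intro!: open_Times)
  have pS: "(x, y, \<xi>) \<in> phase_dom X Y" "?\<sigma> (x, y, \<xi>) \<in> phase_dom X Y" using p t by auto
  note d1 = diff[OF pS(1)] and d2 = diff[OF pS(2)]
  have eq: "pderiv1 (?\<sigma> v) f (x, y, t *\<^sub>R \<xi>) = t powr s * pderiv1 v f (x, y, \<xi>)" for v
  proof -
    have "pderiv1 (?\<sigma> v) f (x, y, t *\<^sub>R \<xi>) = pderiv1 v (\<lambda>p. f (?\<sigma> p)) (x, y, \<xi>)"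
      using pderiv1_compose(1)[OF hd d2, of v] by simp
    also have "\<dots> = pderiv1 v (\<lambda>p. t powr s * f p) (x, y, \<xi>)"
    proof (rule pderiv1_cong_open[OF oS pS(1)])
      show "f (?\<sigma> q) = t powr s * f q" if "q \<in> phase_dom X Y" for q
        using hom[of "fst q" "fst (snd q)" "snd (snd q)" t] that t by (simp add: mem_Times_iff)
    qed
    also have "\<dots> = t powr s * pderiv1 v f (x, y, \<xi>)"
      by (rule pderiv1_linear_comp[OF bounded_linear_mult_right d1])
    finally show ?thesis .
  qed
  from eq[of "(i, j, 0)"] show "pderiv1 (i, j, 0) f (x, y, t *\<^sub>R \<xi>) = t powr s * pderiv1 (i, j, 0) f (x, y, \<xi>)"
    by simp
  have "t *\<^sub>R pderiv1 (0, 0, l) f (x, y, t *\<^sub>R \<xi>) = pderiv1 (t *\<^sub>R (0, 0, l)) f (x, y, t *\<^sub>R \<xi>)"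
    using linear_cmul[OF pderiv1_direction_diff[OF d2], of t "(0, 0, l)"] by simp
  also have "\<dots> = t powr s * pderiv1 (0, 0, l) f (x, y, \<xi>)" using eq[of "(0, 0, l)"] by simp
  finally show "pderiv1 (0, 0, l) f (x, y, t *\<^sub>R \<xi>) = t powr (s - 1) * pderiv1 (0, 0, l) f (x, y, \<xi>)"
    using t by (simp add: powr_diff field_simps)
qed

lemma pderivs_homogeneous:
  fixes \<Phi> :: "'x::euclidean_space \<times> 'y::euclidean_space \<times> 'z::euclidean_space \<Rightarrow> real"
  assumes S: "open X" "open Y" and \<Phi>: "\<Phi> \<in> phases_hg X Y" and "vs \<in> lists Basis"
    and "x \<in> X" "y \<in> Y" "\<xi> \<noteq> 0" "t > 0"
  shows "pderivs vs \<Phi> (x, y, t *\<^sub>R \<xi>)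
    = t powr (1 + sum_list (map (wt 0 (-1)) vs)) * pderivs vs \<Phi> (x, y, \<xi>)"
  using assms(4-)
proof (induction vs arbitrary: x y \<xi> t)
  case Nil
  then show ?case using \<Phi> by (simp add: phases_hg_def)
next
  case (Cons v vs)
  have diff: "pderivs vs \<Phi> differentiable (at p)" if "p \<in> phase_dom X Y" for p
  proof (rule smooth_on_pderivs_differentiable[OF _ _ that])
    show "smooth_on (phase_dom X Y) \<Phi>" using \<Phi> by (simp add: phases_hg_def)
    show "vs \<in> lists Basis" by (rule Cons.hyps)
  qed
  note IH = pderiv1_homogeneous[OF S diff Cons.IH]
  have "v \<in> Basis" using Cons.hyps by simp
  then show ?case
  proof (cases rule: Basis3_cases)
    case (xi i)
    then show ?thesis using IH(2)[of x y \<xi> t i] Cons.prems nonzero_Basis[OF xi(1)] by (simp add: algebra_simps)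
  next
    case (x i)
    then show ?thesis using IH(1)[of _ y \<xi> t i 0] Cons.prems by simp
  next
    case (y i)
    then show ?thesis using IH(1)[of x _ \<xi> t 0 i] Cons.prems by simp
  qed
qed

text \<open>By homogeneity it is enough to bound the derivative on the compact set
  \<open>K \<times> L \<times> {\<xi>. \<parallel>\<xi>\<parallel> = 1}\<close>.\<close>

lemma phase_bound:
  fixes \<Phi> :: "'x::euclidean_space \<times> 'y::euclidean_space \<times> 'z::euclidean_space \<Rightarrow> real"
  assumes S: "open X" "open Y" and \<Phi>: "\<Phi> \<in> phases_hg X Y" and vs: "vs \<in> lists Basis"
    and K: "compact K" "K \<subseteq> X" "compact L" "L \<subseteq> Y"
  obtains C where "C \<ge> 0" "\<And>x y \<xi>. x \<in> K \<Longrightarrow> y \<in> L \<Longrightarrow> \<xi> \<noteq> 0 \<Longrightarrow>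
    \<bar>pderivs vs \<Phi> (x, y, \<xi>)\<bar> \<le> C * norm \<xi> powr (1 + sum_list (map (wt 0 (-1)) vs))"
proof -
  have "smooth_on (phase_dom X Y) (pderivs vs \<Phi>)"
    using \<Phi> vs by (intro smooth_on_pderivs) (auto simp: phases_hg_def)
  then have "continuous_on (K \<times> L \<times> sphere 0 1) (pderivs vs \<Phi>)"
    using K by (intro continuous_on_subset[OF smooth_on_continuous]) auto
  then have "compact (pderivs vs \<Phi> ` (K \<times> L \<times> sphere 0 1))"
    using K by (intro compact_continuous_image compact_Times) auto
  then obtain C where C: "C > 0" "\<forall>r\<in>pderivs vs \<Phi> ` (K \<times> L \<times> sphere 0 1). norm r \<le> C"
    using bounded_pos compact_imp_bounded by metis
  have "\<bar>pderivs vs \<Phi> (x, y, \<xi>)\<bar> \<le> C * norm \<xi> powr (1 + sum_list (map (wt 0 (-1)) vs))"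
    if "x \<in> K" "y \<in> L" "\<xi> \<noteq> 0" for x y \<xi>
  proof -
    let ?u = "inverse (norm \<xi>) *\<^sub>R \<xi>"
    have u: "?u \<noteq> 0" "norm ?u = 1" using that by auto
    have "\<bar>pderivs vs \<Phi> (x, y, ?u)\<bar> \<le> C" using C(2) that u by auto
    moreover have "pderivs vs \<Phi> (x, y, \<xi>)
        = norm \<xi> powr (1 + sum_list (map (wt 0 (-1)) vs)) * pderivs vs \<Phi> (x, y, ?u)"
      using pderivs_homogeneous[OF S \<Phi> vs, of x y ?u "norm \<xi>"] that K u by auto
    ultimately show ?thesis by (simp add: abs_mult mult.commute[of C] mult_left_mono)
  qed
  then show thesis using that C(1) by (meson less_imp_le)
qed

lemma compact_subset_exhaust:
  assumes "open Z" "compact K" "K \<subseteq> Z"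
  obtains N where "N \<ge> 1" "\<And>n. n \<ge> N \<Longrightarrow> K \<subseteq> exhaust Z n"
proof -
  obtain e where e: "e > 0" "\<And>x z. x \<in> K \<Longrightarrow> z \<in> - Z \<Longrightarrow> e \<le> dist x z"
    using separate_compact_closed[of K "- Z"] assms by blast
  obtain B where B: "\<And>x. x \<in> K \<Longrightarrow> norm x \<le> B"
    using compact_imp_bounded[OF assms(2)] bounded_iff by blast
  define N where "N = nat \<lceil>max B (1 / e)\<rceil> + 1"
  have N: "real N \<ge> B" "real N \<ge> 1 / e" unfolding N_def by linarith+
  have "K \<subseteq> exhaust Z n" if n: "n \<ge> N" for n
  proof
    fix x assume x: "x \<in> K"
    have "real n \<ge> 1 / e" using n N by linarith
    then have "1 / real n \<le> e" using e n N_def by (simp add: field_simps)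
    then show "x \<in> exhaust Z n"
      using e(2)[OF x] B[OF x] x assms(3) n N unfolding exhaust_def by fastforce
  qed
  then show thesis by (intro that[of N]) (auto simp: N_def)
qed

abbreviation phase_near ::
  "'x::euclidean_space set \<Rightarrow> 'y::euclidean_space set \<Rightarrow> nat
    \<Rightarrow> ('x \<times> 'y \<times> 'z::euclidean_space \<Rightarrow> real) \<Rightarrow> ('x \<times> 'y \<times> 'z \<Rightarrow> real) \<Rightarrow> bool"
  where "phase_near X Y n \<Phi> \<Phi>0 \<equiv>
    phase_seminorm X Y (Suc n) (\<lambda>p. \<Phi> p - \<Phi>0 p) < ennreal (seq_param n)"

abbreviation amplitude_near ::
  "'x::euclidean_space set \<Rightarrow> 'y::euclidean_space set \<Rightarrow> real \<Rightarrow> real \<Rightarrow> real \<Rightarrow> nat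
    \<Rightarrow> ('x \<times> 'y \<times> 'z::euclidean_space \<Rightarrow> complex) \<Rightarrow> ('x \<times> 'y \<times> 'z \<Rightarrow> complex) \<Rightarrow> bool"
  where "amplitude_near X Y d \<rho> \<delta> n a a0 \<equiv>
    amplitude_seminorm X Y d \<rho> \<delta> (Suc n) (\<lambda>p. a p - a0 p) < ennreal (seq_param n)"

lemma phase_seminorm_pointwise:
  assumes "phase_seminorm X Y m f < ennreal \<epsilon>" "(js, ks, ls) \<in> multi_indices3 m"
    "x \<in> exhaust X m" "y \<in> exhaust Y m" "\<xi> \<noteq> 0"
  shows "\<bar>pderivs3 js ks ls f (x, y, \<xi>)\<bar> \<le> \<epsilon> * norm \<xi> powr (1 - real (length ls))"
proof -
  let ?v = "norm \<xi> powr (real (length ls) - 1) * \<bar>pderivs3 js ks ls f (x, y, \<xi>)\<bar>"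
  have "ennreal ?v \<le> (SUP (x, y, \<xi>) \<in> exhaust X m \<times> exhaust Y m \<times> Xi.
       ennreal (norm \<xi> powr (real (length ls) - 1) * \<bar>pderivs3 js ks ls f (x, y, \<xi>)\<bar>))"
    using assms by (intro SUP_upper2[of "(x, y, \<xi>)"]) auto
  also have "\<dots> \<le> phase_seminorm X Y m f"
    unfolding phase_seminorm_def using assms by (intro SUP_upper2[of "(js, ks, ls)"]) auto
  finally have "ennreal ?v < ennreal \<epsilon>" using assms(1) by (rule le_less_trans)
  then have "?v < \<epsilon>" by (rule ennreal_less_iff[THEN iffD1, rotated]) simp
  define r where "r = 1 - real (length ls)"
  have r: "norm \<xi> powr (real (length ls) - 1) = inverse (norm \<xi> powr r)"
    by (simp add: r_def flip: powr_minus)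
  have "\<bar>pderivs3 js ks ls f (x, y, \<xi>)\<bar> = norm \<xi> powr r * ?v"
    using assms(5) by (simp add: r)
  also have "\<dots> \<le> norm \<xi> powr r * \<epsilon>" using \<open>?v < \<epsilon>\<close> by (intro mult_left_mono) auto
  finally show ?thesis by (simp add: r_def mult.commute)
qed

lemma amplitude_seminorm_pointwise:
  assumes "amplitude_seminorm X Y d \<rho> \<delta> m f < ennreal \<epsilon>" "(js, ks, ls) \<in> multi_indices3 m"
    "x \<in> exhaust X m" "y \<in> exhaust Y m" "\<xi> \<noteq> 0"
  shows "norm (pderivs3 js ks ls f (x, y, \<xi>))
    \<le> \<epsilon> * jbracket \<xi> powr (d - \<rho> * real (length ls) + \<delta> * real (length js + length ks))"
proof -
  define r where "r = d - \<rho> * real (length ls) + \<delta> * real (length js + length ks)"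
  have r: "- d + \<rho> * real (length ls) - \<delta> * real (length js + length ks) = - r" by (simp add: r_def)
  let ?v = "jbracket \<xi> powr (- r) * norm (pderivs3 js ks ls f (x, y, \<xi>))"
  have "ennreal ?v \<le> (SUP (x, y, \<xi>) \<in> exhaust X m \<times> exhaust Y m \<times> Xi.
       ennreal (jbracket \<xi> powr (- r) * norm (pderivs3 js ks ls f (x, y, \<xi>))))"
    using assms by (intro SUP_upper2[of "(x, y, \<xi>)"]) auto
  also have "\<dots> \<le> amplitude_seminorm X Y d \<rho> \<delta> m f"
    unfolding amplitude_seminorm_def by (rule SUP_upper2[OF assms(2)]) (simp only: prod.case r order_refl)
  finally have "ennreal ?v < ennreal \<epsilon>" using assms(1) by (rule le_less_trans)
  then have v: "?v < \<epsilon>" by (rule ennreal_less_iff[THEN iffD1, rotated]) simp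
  have "jbracket \<xi> \<noteq> 0" using jbracket_ge1[of \<xi>] by linarith
  then have "norm (pderivs3 js ks ls f (x, y, \<xi>)) = jbracket \<xi> powr r * ?v"
    by (simp add: powr_minus)
  also have "\<dots> \<le> jbracket \<xi> powr r * \<epsilon>" using v by (intro mult_left_mono) auto
  finally show ?thesis by (simp add: r_def mult.commute)
qed

lemma continuous_J3: "continuous_on S J3"
  unfolding J3_def[abs_def] by (rule continuous_on_compose2[OF continuous_jbracket[of UNIV]]) (auto intro!: continuous_intros)

lemma pderivs_eq_pderivs3:
  fixes vs :: "('x::euclidean_space \<times> 'y::euclidean_space \<times> 'z::euclidean_space) list"
  assumes "vs \<in> lists Basis"
  obtains js ks ls where "(js, ks, ls) \<in> multi_indices3 (length vs)"
    "js \<in> lists Basis" "ks \<in> lists Basis" "ls \<in> lists Basis"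
    "\<And>\<mu> \<nu>. sum_list (map (wt \<mu> \<nu>) vs) = \<mu> * real (length js + length ks) + \<nu> * real (length ls)"
    "\<And>S (f :: 'x \<times> 'y \<times> 'z \<Rightarrow> 'b::euclidean_space) z. open S \<Longrightarrow> z \<in> S \<Longrightarrow> smooth_on S f \<Longrightarrow>
      pderivs vs f z = pderivs3 js ks ls f z"
proof -
  obtain js ks ls where *: "js \<in> lists Basis" "ks \<in> lists Basis" "ls \<in> lists Basis"
    "mset vs = mset (map (\<lambda>i. (i, 0, 0)) js @ map (\<lambda>i. (0, i, 0)) ks @ map (\<lambda>i. (0, 0, i)) ls)"
    "\<And>\<mu> \<nu>. sum_list (map (wt \<mu> \<nu>) vs) = \<mu> * real (length js + length ks) + \<nu> * real (length ls)"
    "length vs = length js + length ks + length ls"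
    using split_directions[OF assms] by metis
  show thesis
  proof
    show "(js, ks, ls) \<in> multi_indices3 (length vs)" using * by (simp only: multi_indices3_def) simp
    show "pderivs vs f z = pderivs3 js ks ls f z" if "open S" "z \<in> S" "smooth_on S f"
      for S and f :: "'x \<times> 'y \<times> 'z \<Rightarrow> 'b" and z
      unfolding pderivs3_def by (rule pderivs_mset_eq[OF that assms *(4)])
  qed (use * in auto)
qed

lemma multi_indices3_mono: "m \<le> n \<Longrightarrow> p \<in> multi_indices3 m \<Longrightarrow> p \<in> multi_indices3 n"
  by (auto simp: multi_indices3_def)

lemma open_phase_dom: "open X \<Longrightarrow> open Y \<Longrightarrow> open (phase_dom X Y :: ('x::euclidean_space \<times> 'y::euclidean_space \<times> 'z::euclidean_space) set)"
  by (auto intro!: open_Times)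

lemma phase_convergence:
  fixes \<Phi> :: "nat \<Rightarrow> 'x::euclidean_space \<times> 'y::euclidean_space \<times> 'z::euclidean_space \<Rightarrow> real"
  assumes S: "open X" "open Y" and \<Phi>0: "\<Phi>0 \<in> phases_hg X Y" and \<Phi>: "\<And>n. \<Phi> n \<in> phases_hg X Y"
    and conv: "\<And>n. phase_near X Y n (\<Phi> n) \<Phi>0"
    and K: "compact K" "K \<subseteq> X" "compact L" "L \<subseteq> Y" and vs: "vs \<in> lists Basis"
  obtains N where "\<And>n x y \<xi>. n \<ge> N \<Longrightarrow> x \<in> K \<Longrightarrow> y \<in> L \<Longrightarrow> \<xi> \<noteq> 0 \<Longrightarrow>
    \<bar>pderivs vs (\<Phi> n) (x, y, \<xi>) - pderivs vs \<Phi>0 (x, y, \<xi>)\<bar>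
      \<le> seq_param n * norm \<xi> powr (1 + sum_list (map (wt 0 (-1)) vs))"
proof -
  obtain N1 where N1: "\<And>n. n \<ge> N1 \<Longrightarrow> K \<subseteq> exhaust X n" using compact_subset_exhaust[OF S(1) K(1,2)] by metis
  obtain N2 where N2: "\<And>n. n \<ge> N2 \<Longrightarrow> L \<subseteq> exhaust Y n" using compact_subset_exhaust[OF S(2) K(3,4)] by metis
  obtain js ks ls where mi: "(js, ks, ls) \<in> multi_indices3 (length vs)"
    and w: "\<And>\<mu> \<nu>. sum_list (map (wt \<mu> \<nu>) vs) = \<mu> * real (length js + length ks) + \<nu> * real (length ls)"
    and eq: "\<And>S (f :: 'x \<times> 'y \<times> 'z \<Rightarrow> real) z. open S \<Longrightarrow> z \<in> S \<Longrightarrow> smooth_on S f \<Longrightarrow>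
      pderivs vs f z = pderivs3 js ks ls f z"
    using pderivs_eq_pderivs3[OF vs, where 'b = real] by metis
  note o = open_phase_dom[OF S]
  have sm: "smooth_on (phase_dom X Y) \<Phi>0" "smooth_on (phase_dom X Y) (\<Phi> n)" for n
    using \<Phi>0 \<Phi>[of n] by (auto simp: phases_hg_def)
  have smd: "smooth_on (phase_dom X Y) (\<lambda>p. \<Phi> n p - \<Phi>0 p)" for n
    using smooth_on_linear[OF o sm, of "-1"] by simp
  show thesis
  proof (rule that)
    fix n x y \<xi> assume n: "n \<ge> max (length vs) (max N1 N2)" and x: "x \<in> K" "y \<in> L" and xi: "\<xi> \<noteq> (0::'z)"
    have p: "(x, y, \<xi>) \<in> phase_dom X Y" using x xi K by auto
    have "\<bar>pderivs3 js ks ls (\<lambda>p. \<Phi> n p - \<Phi>0 p) (x, y, \<xi>)\<bar> \<le> seq_param n * norm \<xi> powr (1 - real (length ls))"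
      using n x N1[of "Suc n"] N2[of "Suc n"]
      by (intro phase_seminorm_pointwise[OF conv multi_indices3_mono[OF _ mi] _ _ xi]) auto
    moreover have "pderivs3 js ks ls (\<lambda>p. \<Phi> n p - \<Phi>0 p) (x, y, \<xi>)
        = pderivs vs (\<Phi> n) (x, y, \<xi>) - pderivs vs \<Phi>0 (x, y, \<xi>)"
      using eq[OF o p smd] pderivs_diff[OF o sm(2) sm(1) vs p] by simp
    ultimately show "\<bar>pderivs vs (\<Phi> n) (x, y, \<xi>) - pderivs vs \<Phi>0 (x, y, \<xi>)\<bar>
        \<le> seq_param n * norm \<xi> powr (1 + sum_list (map (wt 0 (-1)) vs))"
      by (simp add: w)
  qed
qed

text \<open>For \<open>\<parallel>\<xi>\<parallel> > 1/2\<close> one has \<open>\<parallel>\<xi>\<parallel> \<le> \<langle>\<xi>\<rangle> \<le> 3 \<parallel>\<xi>\<parallel>\<close>; which of the two inequalities is used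
  depends on the sign of the exponent.\<close>

lemma powr_norm_le_jbracket:
  assumes "norm \<xi> > 1/2" shows "norm \<xi> powr s \<le> 3 powr \<bar>s\<bar> * jbracket \<xi> powr s"
proof (cases "s \<ge> 0")
  case True
  have "norm \<xi> powr s \<le> jbracket \<xi> powr s" using jbracket_bounds(1)[of \<xi>] True by (intro powr_mono2) auto
  also have "\<dots> \<le> 3 powr \<bar>s\<bar> * jbracket \<xi> powr s"
    using mult_right_mono[of 1 "3 powr \<bar>s\<bar>" "jbracket \<xi> powr s"] by (simp add: ge_one_powr_ge_zero)
  finally show ?thesis .
next
  case False
  have j: "jbracket \<xi> > 0" "jbracket \<xi> \<le> 3 * norm \<xi>"
    using jbracket_ge1[of \<xi>] jbracket_bounds(2)[of \<xi>] assms by linarith+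
  then have "norm \<xi> powr s \<le> (jbracket \<xi> / 3) powr s" using False by (intro powr_mono2') auto
  also have "\<dots> = 3 powr \<bar>s\<bar> * jbracket \<xi> powr s"
  proof -
    have "\<bar>s\<bar> = - s" using False by simp
    then have "3 powr \<bar>s\<bar> = inverse (3 powr s)" by (simp only: powr_minus)
    moreover have "(jbracket \<xi> / 3) powr s = jbracket \<xi> powr s / 3 powr s" by (rule powr_divide)
    ultimately show ?thesis by (simp only: divide_inverse mult.commute)
  qed
  finally show ?thesis .
qed

lemma phase_symfam:
  fixes \<Phi> :: "nat \<Rightarrow> 'x::euclidean_space \<times> 'y::euclidean_space \<times> 'z::euclidean_space \<Rightarrow> real"
  assumes S: "open X" "open Y" and \<Phi>0: "\<Phi>0 \<in> phases_hg X Y" and \<Phi>: "\<And>n. \<Phi> n \<in> phases_hg X Y"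
    and conv: "\<And>n. phase_near X Y n (\<Phi> n) \<Phi>0"
    and K: "compact K" "K \<subseteq> X" "compact L" "L \<subseteq> Y" and U: "open U" "U \<subseteq> K" "open V" "V \<subseteq> L"
  shows "symfam seqT (U \<times> V \<times> {\<xi>. 1/2 < norm \<xi>}) J3 Basis (wt 0 (-1)) k 1 (seq_fam \<Phi>0 \<Phi>)"
    and "symfam seqT (phase_dom U V) J3 ((\<lambda>i. (0, i, 0)) ` Basis) (\<lambda>_. 0) k 1 (seq_fam \<Phi>0 \<Phi>)"
proof -
  let ?F = "seq_fam \<Phi>0 \<Phi>"
  have hg: "?F t \<in> phases_hg X Y" if "t \<in> seqT" for t
    using that \<Phi>0 \<Phi> by (cases rule: seqT_cases) auto
  have UX: "U \<subseteq> X" "V \<subseteq> Y" using U K by auto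
  have sm: "smooth_on (phase_dom U V) (?F t)" if "t \<in> seqT" for t
  proof (rule smooth_on_subset)
    show "smooth_on (phase_dom X Y) (?F t)" using hg[OF that] by (simp add: phases_hg_def)
  qed (use UX in auto)
  have diff: "pderivs vs (?F t) differentiable (at p)"
    if "vs \<in> lists Basis" "t \<in> seqT" "p \<in> phase_dom U V" for vs t p
    by (rule smooth_on_pderivs_differentiable[OF sm[OF that(2)] that(1,3)])
  have bound: "symbol_bound seqT R J3 (1 + sum_list (map (wt 0 (-1)) vs)) (\<lambda>t. pderivs vs (?F t))"
    if vs: "vs \<in> lists Basis" and R: "R \<subseteq> phase_dom U V"
      and c: "\<And>x y \<xi>. (x, y, \<xi>) \<in> R \<Longrightarrow> norm \<xi> powr (1 + sum_list (map (wt 0 (-1)) vs))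
        \<le> c * jbracket \<xi> powr (1 + sum_list (map (wt 0 (-1)) vs))" for vs R c
  proof -
    let ?s = "1 + sum_list (map (wt 0 (-1)) vs)"
    obtain N where N: "\<And>n x y \<xi>. n \<ge> N \<Longrightarrow> x \<in> K \<Longrightarrow> y \<in> L \<Longrightarrow> \<xi> \<noteq> 0 \<Longrightarrow>
      \<bar>pderivs vs (\<Phi> n) (x, y, \<xi>) - pderivs vs \<Phi>0 (x, y, \<xi>)\<bar> \<le> seq_param n * norm \<xi> powr ?s"
      using phase_convergence[OF S \<Phi>0 \<Phi> conv K vs] by blast
    have R': "\<exists>x y \<xi>. p = (x, y, \<xi>) \<and> x \<in> K \<and> y \<in> L \<and> \<xi> \<noteq> 0" if "p \<in> R" for p
    proof (cases p)
      case (fields x y \<xi>)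
      then have "(x, y, \<xi>) \<in> phase_dom U V" using R that by blast
      then show ?thesis using fields U by auto
    qed
    show ?thesis
    proof (rule symbol_bound_seq[where N = N and c = c])
      show "continuous_on R (pderivs vs (?F t))" if "t \<in> seqT" for t
        by (rule continuous_on_subset[OF smooth_on_continuous[OF smooth_on_pderivs[OF sm[OF that] vs]] R])
      show "\<exists>C. \<forall>p\<in>R. norm (pderivs vs (?F t) p) \<le> C * J3 p powr ?s" if t: "t \<in> seqT" for t
      proof -
        obtain C where C: "C \<ge> 0" "\<And>x y \<xi>. x \<in> K \<Longrightarrow> y \<in> L \<Longrightarrow> \<xi> \<noteq> 0 \<Longrightarrow>
            \<bar>pderivs vs (?F t) (x, y, \<xi>)\<bar> \<le> C * norm \<xi> powr ?s"
          using phase_bound[OF S hg[OF t] vs K] by blast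
        have "norm (pderivs vs (?F t) p) \<le> (C * c) * J3 p powr ?s" if pR: "p \<in> R" for p
        proof -
          obtain x y \<xi> where p: "p = (x, y, \<xi>)" "x \<in> K" "y \<in> L" "\<xi> \<noteq> 0" using R'[OF pR] by blast
          have "\<bar>pderivs vs (?F t) (x, y, \<xi>)\<bar> \<le> C * norm \<xi> powr ?s" by (rule C(2)[OF p(2-4)])
          also have "\<dots> \<le> C * (c * jbracket \<xi> powr ?s)" using c that p C(1) by (intro mult_left_mono) auto
          finally show ?thesis by (simp add: p J3_def mult.assoc)
        qed
        then show ?thesis by blast
      qed
      show "norm (pderivs vs (?F (seq_param n)) p - pderivs vs (?F 0) p) \<le> seq_param n * (c * J3 p powr ?s)"
        if "n \<ge> N" and pR: "p \<in> R" for n p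
      proof -
        obtain x y \<xi> where p: "p = (x, y, \<xi>)" "x \<in> K" "y \<in> L" "\<xi> \<noteq> 0" using R'[OF pR] by blast
        have "\<bar>pderivs vs (\<Phi> n) (x, y, \<xi>) - pderivs vs \<Phi>0 (x, y, \<xi>)\<bar> \<le> seq_param n * norm \<xi> powr ?s"
          by (rule N[OF that(1) p(2-4)])
        also have "\<dots> \<le> seq_param n * (c * jbracket \<xi> powr ?s)"
          using c that p seq_param_pos[of n] by (intro mult_left_mono) auto
        finally show ?thesis by (simp add: p J3_def)
      qed
    qed (auto intro: continuous_J3 J3_ge1)
  qed
  have o1: "open (U \<times> V \<times> {\<xi>::'z. 1/2 < norm \<xi>})"
    using U by (auto intro!: open_Times open_Collect_less continuous_intros)
  have sub: "U \<times> V \<times> {\<xi>::'z. 1/2 < norm \<xi>} \<subseteq> phase_dom U V" by auto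
  interpret R1: weighted_region seqT "U \<times> V \<times> {\<xi>::'z. 1/2 < norm \<xi>}" J3 Basis
    by (rule weighted_region_J3[OF o1])
  show "R1.symb (wt 0 (-1)) k 1 ?F"
  proof (rule R1.sym_pderivsI)
    show "R1.bnd (1 + sum_list (map (wt 0 (-1)) vs)) (\<lambda>t. pderivs vs (?F t))" if "vs \<in> lists Basis" for vs
      by (rule bound[OF that sub powr_norm_le_jbracket]) auto
  qed (use diff sub in blast)
  interpret R2: weighted_region seqT "phase_dom U V" J3 "(\<lambda>i. (0, i, 0)) ` Basis :: ('x \<times> 'y \<times> 'z) set"
    by (rule weighted_region_J3[OF open_phase_dom[OF U(1,3)]])
  have B: "(\<lambda>i. (0, i, 0)) ` Basis \<subseteq> (Basis :: ('x \<times> 'y \<times> 'z) set)" by auto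
  show "R2.symb (\<lambda>_. 0) k 1 ?F"
  proof (rule R2.sym_pderivsI)
    fix vs :: "('x \<times> 'y \<times> 'z) list" assume vs: "vs \<in> lists ((\<lambda>i. (0, i, 0)) ` Basis)"
    then have vs': "vs \<in> lists Basis" using lists_mono[OF B] by blast
    have w: "sum_list (map (wt 0 (-1)) vs) = 0"
      using vs by (induction vs) auto
    have "R2.bnd (1 + sum_list (map (wt 0 (-1)) vs)) (\<lambda>t. pderivs vs (?F t))"
      by (rule bound[OF vs', where c = 1]) (auto simp: w intro: order_trans[OF jbracket_bounds(1) abs_ge_self])
    then show "R2.bnd (1 + sum_list (map (\<lambda>_. 0) vs)) (\<lambda>t. pderivs vs (?F t))" using w by simp
    show "pderivs vs (?F t) differentiable (at p)" if "t \<in> seqT" "p \<in> phase_dom U V" for t p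
      by (rule diff[OF vs' that])
  qed
qed

lemma amplitudeE:
  fixes a :: "'x::euclidean_space \<times> 'y::euclidean_space \<times> 'z::euclidean_space \<Rightarrow> complex"
  assumes S: "open X" "open Y" and a: "a \<in> amplitudes X Y d \<rho> \<delta>"
  shows "smooth_on (phase_dom X Y) a"
    and "vs \<in> lists Basis \<Longrightarrow> compact K \<Longrightarrow> K \<subseteq> X \<Longrightarrow> compact L \<Longrightarrow> L \<subseteq> Y \<Longrightarrow>
      \<exists>C. \<forall>x\<in>K. \<forall>y\<in>L. \<forall>\<xi>\<in>Xi. norm (pderivs vs a (x, y, \<xi>))
        \<le> C * jbracket \<xi> powr (d + sum_list (map (wt \<delta> (-\<rho>)) vs))"
proof -
  obtain b where b: "b \<in> hoermander_class X Y d \<rho> \<delta>" and ab: "a = restrict b (phase_dom X Y)"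
    using a by (auto simp: amplitudes_def)
  have sb: "smooth_on (phase_dom X Y) b"
  proof (rule smooth_on_subset)
    show "smooth_on (X \<times> Y \<times> UNIV) b" using b by (simp only: hoermander_class_def mem_Collect_eq)
  qed auto
  note o = open_phase_dom[OF S]
  show sa: "smooth_on (phase_dom X Y) a"
    using smooth_on_cong[OF o, of a b] sb by (simp add: ab)
  assume vs: "vs \<in> lists Basis" and K: "compact K" "K \<subseteq> X" "compact L" "L \<subseteq> Y"
  obtain js ks ls where jkl: "js \<in> lists Basis" "ks \<in> lists Basis" "ls \<in> lists Basis"
    and w: "\<And>\<mu> \<nu>. sum_list (map (wt \<mu> \<nu>) vs) = \<mu> * real (length js + length ks) + \<nu> * real (length ls)"
    and eq: "\<And>S (f :: 'x \<times> 'y \<times> 'z \<Rightarrow> complex) z. open S \<Longrightarrow> z \<in> S \<Longrightarrow> smooth_on S f \<Longrightarrow>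
      pderivs vs f z = pderivs3 js ks ls f z"
    using pderivs_eq_pderivs3[OF vs, where 'b = complex] by metis
  have "compact (K \<times> L)" "K \<times> L \<subseteq> X \<times> Y" using K by (auto intro: compact_Times)
  then obtain C where C: "\<forall>(x, y) \<in> K \<times> L. \<forall>\<xi>. norm (pderivs3 js ks ls b (x, y, \<xi>)) \<le>
          C * jbracket \<xi> powr (d - \<rho> * real (length ls) + \<delta> * real (length js + length ks))"
    using b jkl unfolding hoermander_class_def by blast
  have "norm (pderivs vs a (x, y, \<xi>)) \<le> C * jbracket \<xi> powr (d + sum_list (map (wt \<delta> (-\<rho>)) vs))"
    if "x \<in> K" "y \<in> L" "\<xi> \<noteq> 0" for x y \<xi>
  proof -
    have p: "(x, y, \<xi>) \<in> phase_dom X Y" using that K by auto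
    have "pderivs vs a (x, y, \<xi>) = pderivs vs b (x, y, \<xi>)"
      by (rule pderivs_cong_open[OF o p]) (simp add: ab)
    also have "\<dots> = pderivs3 js ks ls b (x, y, \<xi>)" by (rule eq[OF o p sb])
    finally show ?thesis using C that by (auto simp: w algebra_simps)
  qed
  then show "\<exists>C. \<forall>x\<in>K. \<forall>y\<in>L. \<forall>\<xi>\<in>Xi. norm (pderivs vs a (x, y, \<xi>))
        \<le> C * jbracket \<xi> powr (d + sum_list (map (wt \<delta> (-\<rho>)) vs))" by auto
qed

text \<open>Each member is bounded by the definition of the Hoermander class on compact sets, and the
  differences from the limit by the seminorms.\<close>

lemma amplitude_symfam:
  fixes a :: "nat \<Rightarrow> 'x::euclidean_space \<times> 'y::euclidean_space \<times> 'z::euclidean_space \<Rightarrow> complex"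
  assumes S: "open X" "open Y" and a0: "a0 \<in> amplitudes X Y d \<rho> \<delta>" and a: "\<And>n. a n \<in> amplitudes X Y d \<rho> \<delta>"
    and conv: "\<And>n. amplitude_near X Y d \<rho> \<delta> n (a n) a0"
    and K: "compact K" "K \<subseteq> X" "compact L" "L \<subseteq> Y" and U: "open U" "U \<subseteq> K" "open V" "V \<subseteq> L"
  shows "symfam seqT (phase_dom U V) J3 Basis (wt \<delta> (-\<rho>)) k d (seq_fam a0 a)"
proof -
  let ?F = "seq_fam a0 a"
  have am: "?F t \<in> amplitudes X Y d \<rho> \<delta>" if "t \<in> seqT" for t
    using that a0 a by (cases rule: seqT_cases) auto
  have UX: "phase_dom U V \<subseteq> phase_dom X Y" using U K by auto
  note o = open_phase_dom[OF S]
  have sm: "smooth_on (phase_dom U V) (?F t)" if "t \<in> seqT" for t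
    by (rule smooth_on_subset[OF amplitudeE(1)[OF S am[OF that]] UX])
  interpret R: weighted_region seqT "phase_dom U V" J3 "Basis :: ('x \<times> 'y \<times> 'z) set"
    by (rule weighted_region_J3[OF open_phase_dom[OF U(1,3)]])
  show ?thesis
  proof (rule R.sym_pderivsI)
    fix vs :: "('x \<times> 'y \<times> 'z) list" assume vs: "vs \<in> lists Basis"
    show "pderivs vs (?F t) differentiable (at p)" if "t \<in> seqT" "p \<in> phase_dom U V" for t p
      by (rule smooth_on_pderivs_differentiable[OF sm[OF that(1)] vs that(2)])
    let ?s = "d + sum_list (map (wt \<delta> (-\<rho>)) vs)"
    obtain N1 where N1: "\<And>n. n \<ge> N1 \<Longrightarrow> K \<subseteq> exhaust X n" using compact_subset_exhaust[OF S(1) K(1,2)] by metis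
    obtain N2 where N2: "\<And>n. n \<ge> N2 \<Longrightarrow> L \<subseteq> exhaust Y n" using compact_subset_exhaust[OF S(2) K(3,4)] by metis
    obtain js ks ls where mi: "(js, ks, ls) \<in> multi_indices3 (length vs)"
      and w: "\<And>\<mu> \<nu>. sum_list (map (wt \<mu> \<nu>) vs) = \<mu> * real (length js + length ks) + \<nu> * real (length ls)"
      and eq: "\<And>S (f :: 'x \<times> 'y \<times> 'z \<Rightarrow> complex) z. open S \<Longrightarrow> z \<in> S \<Longrightarrow> smooth_on S f \<Longrightarrow>
        pderivs vs f z = pderivs3 js ks ls f z"
      using pderivs_eq_pderivs3[OF vs, where 'b = complex] by metis
    show "R.bnd ?s (\<lambda>t. pderivs vs (?F t))"
    proof (rule symbol_bound_seq[where N = "max (length vs) (max N1 N2)" and c = 1])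
      show "continuous_on (phase_dom U V) (pderivs vs (?F t))" if "t \<in> seqT" for t
        by (rule smooth_on_continuous[OF smooth_on_pderivs[OF sm[OF that] vs]])
      show "\<exists>C. \<forall>p\<in>phase_dom U V. norm (pderivs vs (?F t) p) \<le> C * J3 p powr ?s" if t: "t \<in> seqT" for t
      proof -
        obtain C where C: "\<forall>x\<in>K. \<forall>y\<in>L. \<forall>\<xi>\<in>Xi. norm (pderivs vs (?F t) (x, y, \<xi>)) \<le> C * jbracket \<xi> powr ?s"
          using amplitudeE(2)[OF S am[OF t] vs K] by blast
        have "norm (pderivs vs (?F t) p) \<le> C * J3 p powr ?s" if pR: "p \<in> phase_dom U V" for p
        proof -
          obtain x y \<xi> where p: "p = (x, y, \<xi>)" "x \<in> K" "y \<in> L" "\<xi> \<in> Xi" using pR U by blast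
          then show ?thesis using C by (simp add: J3_def)
        qed
        then show ?thesis by blast
      qed
      show "norm (pderivs vs (?F (seq_param n)) p - pderivs vs (?F 0) p) \<le> seq_param n * (1 * J3 p powr ?s)"
        if n: "n \<ge> max (length vs) (max N1 N2)" and pR: "p \<in> phase_dom U V" for n p
      proof -
        obtain x y \<xi> where p: "p = (x, y, \<xi>)" "x \<in> K" "y \<in> L" "\<xi> \<noteq> 0" using pR U by blast
        have pX: "p \<in> phase_dom X Y" using p K by auto
        have "norm (pderivs3 js ks ls (\<lambda>p. a n p - a0 p) (x, y, \<xi>))
            \<le> seq_param n * jbracket \<xi> powr (d - \<rho> * real (length ls) + \<delta> * real (length js + length ks))"
          using n p N1[of "Suc n"] N2[of "Suc n"]
          by (intro amplitude_seminorm_pointwise[OF conv multi_indices3_mono[OF _ mi] _ _ p(4)]) auto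
        moreover have "pderivs3 js ks ls (\<lambda>p. a n p - a0 p) p = pderivs vs (a n) p - pderivs vs a0 p"
        proof -
          have sa: "smooth_on (phase_dom X Y) (a n)" "smooth_on (phase_dom X Y) a0"
            using amplitudeE(1)[OF S] a a0 by blast+
          have "smooth_on (phase_dom X Y) (\<lambda>p. a n p - a0 p)"
            using smooth_on_linear[OF o sa(2,1), of "-1"] by simp
          then show ?thesis using eq[OF o pX] pderivs_diff[OF o sa vs pX] by simp
        qed
        moreover have "?s = d - \<rho> * real (length ls) + \<delta> * real (length js + length ks)"
          by (simp add: w)
        ultimately show ?thesis
          by (simp only: p J3_def snd_conv seq_fam_param seq_fam_0 mult_1)
      qed
    qed (auto intro: continuous_J3 J3_ge1)
  qed
qed

section \<open>Test functions and cutoffs\<close>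

lemma test_function_bounded:
  assumes "smooth_on UNIV \<psi>" "compact K" "\<And>x. x \<notin> K \<Longrightarrow> \<psi> x = 0" "vs \<in> lists Basis"
  shows "\<exists>C. \<forall>x. norm (pderivs vs \<psi> x) \<le> C" and "x \<notin> K \<Longrightarrow> pderivs vs \<psi> x = 0"
proof -
  have z: "pderivs vs \<psi> x = 0" if "x \<notin> K" for x
  proof -
    have "pderivs vs \<psi> x = pderivs vs (\<lambda>_. 0) x"
      using assms(2,3) that by (intro pderivs_cong_open[of "- K"]) (auto intro: compact_imp_closed)
    also have "pderivs vs (\<lambda>_. 0) = (\<lambda>_. 0)"
      using pderivs_zero .
    finally show ?thesis by simp
  qed
  then show "x \<notin> K \<Longrightarrow> pderivs vs \<psi> x = 0" .
  have "compact (pderivs vs \<psi> ` K)"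
    using assms by (intro compact_continuous_image continuous_on_subset[OF smooth_on_continuous[OF smooth_on_pderivs]]) auto
  then obtain C where C: "C > 0" "\<forall>r\<in>pderivs vs \<psi> ` K. norm r \<le> C"
    using bounded_pos compact_imp_bounded by metis
  have "norm (pderivs vs \<psi> x) \<le> C" for x
    using C z by (cases "x \<in> K") auto
  then show "\<exists>C. \<forall>x. norm (pderivs vs \<psi> x) \<le> C" by blast
qed

lemma weighted_region_1: "open S \<Longrightarrow> weighted_region S (\<lambda>_. 1)"
  by unfold_locales simp_all

lemma test_symfam:
  fixes \<psi> :: "nat \<Rightarrow> 'x::euclidean_space \<Rightarrow> complex"
  assumes sm: "smooth_on UNIV \<psi>0" "\<And>n. smooth_on UNIV (\<psi> n)"
    and K: "compact K" "\<And>x. x \<notin> K \<Longrightarrow> \<psi>0 x = 0" "\<And>n x. x \<notin> K \<Longrightarrow> \<psi> n x = 0"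
    and conv: "\<And>vs. vs \<in> lists Basis \<Longrightarrow> \<exists>N. \<forall>n\<ge>N. \<forall>x. norm (pderivs vs (\<psi> n) x - pderivs vs \<psi>0 x) \<le> seq_param n"
  shows "smooth_family seqT UNIV k (seq_fam \<psi>0 \<psi>)"
proof -
  let ?F = "seq_fam \<psi>0 \<psi>"
  interpret R: weighted_region seqT UNIV "\<lambda>_. 1" Basis by (rule weighted_region_1) simp
  have F: "smooth_on UNIV (?F t)" "\<And>x. x \<notin> K \<Longrightarrow> ?F t x = 0" if "t \<in> seqT" for t
    using that sm K by (auto elim!: seqT_cases)
  have w: "sum_list (map (\<lambda>_. 0) vs) = (0::real)" for vs :: "'x list" by (induction vs) auto
  show ?thesis
  proof (rule R.sym_pderivsI, goal_cases)
    case (1 vs)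
    obtain N where N: "\<And>n x. n \<ge> N \<Longrightarrow> norm (pderivs vs (\<psi> n) x - pderivs vs \<psi>0 x) \<le> seq_param n"
      using conv[OF 1] by blast
    have "R.bnd 0 (\<lambda>t. pderivs vs (?F t))"
    proof (rule symbol_bound_seq[where N = N and c = 1])
      show "continuous_on UNIV (pderivs vs (?F t))" if "t \<in> seqT" for t
        by (rule smooth_on_continuous[OF smooth_on_pderivs[OF F(1)[OF that] 1]])
      show "\<exists>C. \<forall>z\<in>UNIV. norm (pderivs vs (?F t) z) \<le> C * 1 powr 0" if "t \<in> seqT" for t
        using test_function_bounded(1)[OF F(1)[OF that] K(1) F(2)[OF that] 1] by simp
    qed (use N in auto)
    then show ?case by (simp add: w)
  next
    case (2 vs t x)
    then show ?case using F(1)[OF 2(2)] by (intro smooth_on_pderivs_differentiable[of UNIV]) auto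
  qed
qed

lemma test_symfam_const:
  fixes \<psi> :: "'x::euclidean_space \<Rightarrow> complex"
  assumes "smooth_on UNIV \<psi>" "compact K" "\<And>x. x \<notin> K \<Longrightarrow> \<psi> x = 0"
  shows "smooth_family seqT UNIV k (\<lambda>_. \<psi>)"
proof -
  have "smooth_family seqT UNIV k (seq_fam \<psi> (\<lambda>_. \<psi>))"
    using assms by (intro test_symfam[of _ _ K]) (auto intro: less_imp_le[OF seq_param_pos])
  moreover have "seq_fam \<psi> (\<lambda>_. \<psi>) = (\<lambda>_. \<psi>)" by (auto simp: seq_fam_def)
  ultimately show ?thesis by simp
qed

lemma compact_open_neighbourhood:
  fixes K :: "'a::euclidean_space set"
  assumes "compact K" "open X" "K \<subseteq> X"
  obtains U C where "open U" "K \<subseteq> U" "U \<subseteq> C" "compact C" "C \<subseteq> X"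
proof (cases "K = {}")
  case True
  then show thesis using that[of "{}" "{}"] by auto
next
  case False
  obtain e where e: "e > 0" "\<And>x z. x \<in> K \<Longrightarrow> z \<in> - X \<Longrightarrow> e \<le> dist x z"
    using separate_compact_closed[of K "- X"] assms by blast
  have inf: "\<exists>k\<in>K. infdist x K = dist x k" for x
    using infdist_attains_inf[OF compact_imp_closed[OF assms(1)] False] by metis
  show thesis
  proof
    show "open {x. infdist x K < e / 2}" by (intro open_Collect_less continuous_intros)
    show "compact {x. infdist x K \<le> e / 2}" using compact_infdist_le[OF False assms(1), of "e / 2"] e(1) by simp
    show "K \<subseteq> {x. infdist x K < e / 2}" using e by auto
    show "{x. infdist x K \<le> e / 2} \<subseteq> X"
    proof clarify
      fix x assume x: "infdist x K \<le> e / 2"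
      obtain k where k: "k \<in> K" "infdist x K = dist x k" using inf by blast
      show "x \<in> X" using e(2)[OF k(1), of x] x k e(1) by (force simp: dist_commute)
    qed
  qed auto
qed

text \<open>Composition of \<open>F\<close> with a curve along a coordinate axis.  The derivative of \<open>F (q y e)\<close> is
  \<open>\<partial>q \<cdot> (\<partial>\<^sub>e F)(q y e)\<close>, of the same form with \<open>\<partial>\<^sub>e F\<close> in place of \<open>F\<close>.\<close>

lemma symfam_compose_line:
  fixes F :: "'z::euclidean_space \<Rightarrow> complex" and q :: "'y::euclidean_space \<Rightarrow> real"
  assumes S: "open S" and q: "\<And>k. smooth_family seqT S k (\<lambda>_. q)"
    and e: "e \<in> Basis" and F: "smooth_on UNIV F"
  shows "smooth_family seqT S k (\<lambda>_ y. F (q y *\<^sub>R e))"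
  using F
proof (induction k arbitrary: F)
  interpret R: weighted_region seqT S "\<lambda>_. 1" Basis by (rule weighted_region_1[OF S])
  have base: "R.bnd 0 (\<lambda>_ y. F (q y *\<^sub>R e))" if F: "smooth_on UNIV F" for F :: "'z \<Rightarrow> complex"
  proof -
    have qb: "R.bnd 0 (\<lambda>_. q)" using q[of 0] by simp
    obtain B where B: "\<And>y. y \<in> S \<Longrightarrow> \<bar>q y\<bar> \<le> B"
      using symbol_boundE[OF qb] seqT_mem(1) by (metis mult_cancel_left1 powr_one_eq_one real_norm_def mult.right_neutral)
    have c: "continuous_on UNIV F" by (rule smooth_on_continuous[OF F])
    have "compact (F ` cball 0 B)" by (intro compact_continuous_image continuous_on_subset[OF c]) auto
    then obtain C where C: "C > 0" "\<forall>r\<in>F ` cball 0 B. norm r \<le> C"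
      using bounded_pos compact_imp_bounded by metis
    have "norm (F (q y *\<^sub>R e)) \<le> C * 1 powr 0" if "y \<in> S" for y
      using C(2) B[OF that] e by simp
    moreover have "continuous_on (seqT \<times> S) (\<lambda>(t, y). F (q y *\<^sub>R e))"
    proof -
      have "continuous_on (seqT \<times> S) (\<lambda>p. q (snd p))" using qb by (simp add: symbol_bound_def case_prod_unfold)
      then have "continuous_on (seqT \<times> S) (\<lambda>p. q (snd p) *\<^sub>R e)" by (intro continuous_intros)
      from continuous_on_compose2[OF c this] show ?thesis by (simp add: case_prod_unfold)
    qed
    ultimately show ?thesis unfolding symbol_bound_def by blast
  qed
  {
    case 0 then show ?case using base by simp
  next
    case (Suc k)
    have hd: "((\<lambda>y. F (q y *\<^sub>R e)) has_derivative (\<lambda>v. of_real (pderiv1 v q y) * pderiv1 e F (q y *\<^sub>R e))) (at y)"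
      if "y \<in> S" for y
    proof -
      have "q differentiable (at y)" using symfam_differentiable[OF q[of "Suc 0"] seqT_mem(1) that] .
      then have "((\<lambda>y. q y *\<^sub>R e) has_derivative (\<lambda>v. pderiv1 v q y *\<^sub>R e)) (at y)"
        by (intro has_derivative_scaleR_left differentiable_has_pderiv1)
      moreover have Fd: "F differentiable (at (q y *\<^sub>R e))" using smooth_on_differentiable[OF Suc.prems] by simp
      ultimately have "((\<lambda>y. F (q y *\<^sub>R e)) has_derivative (\<lambda>v. pderiv1 (pderiv1 v q y *\<^sub>R e) F (q y *\<^sub>R e))) (at y)"
        using has_derivative_compose differentiable_has_pderiv1 by fast
      then show ?thesis
        using linear_cmul[OF pderiv1_direction_diff[OF Fd], of _ e] by (simp add: scaleR_conv_of_real)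
    qed
    have "R.symb (\<lambda>_. 0) k (0 + 0) (\<lambda>_. pderiv1 b (\<lambda>y. F (q y *\<^sub>R e)))" if b: "b \<in> Basis" for b
    proof (rule R.sym_cong_imp[OF R.sym_mult[of _ _ 0 _ 0]])
      have "R.symb (\<lambda>_. 0) k 0 (\<lambda>_. pderiv1 b q)" using symfam_pderiv1[OF q b] by simp
      then show "R.symb (\<lambda>_. 0) k 0 (\<lambda>_ y. of_real (pderiv1 b q y) :: complex)"
        by (rule R.sym_linear[OF bounded_linear_of_real])
      show "R.symb (\<lambda>_. 0) k 0 (\<lambda>_ y. pderiv1 e F (q y *\<^sub>R e))"
        by (rule Suc.IH[OF smooth_on_pderiv1[OF Suc.prems e]])
    qed (simp add: pderiv1_has_derivative[OF hd])
    moreover have "(\<lambda>y. F (q y *\<^sub>R e)) differentiable (at y)" if "y \<in> S" for y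
      using hd[OF that] differentiable_def by blast
    ultimately show ?case using base[OF Suc.prems] by auto
  }
qed

lemma symfam_component:
  assumes "open S" "bounded S" "b \<in> Basis"
  shows "smooth_family seqT S k (\<lambda>_ y. y \<bullet> b)"
proof -
  interpret R: weighted_region seqT S "\<lambda>_. 1" Basis by (rule weighted_region_1[OF assms(1)])
  have hd: "((\<lambda>y. y \<bullet> b) has_derivative (\<lambda>y. y \<bullet> b)) (at y)" for y by (auto intro!: derivative_eq_intros)
  obtain B where B: "\<And>y. y \<in> S \<Longrightarrow> norm y \<le> B" using assms(2) bounded_iff by blast
  have bound: "R.bnd 0 (\<lambda>_ y. y \<bullet> b)"
  proof -
    have "norm (y \<bullet> b) \<le> B * 1 powr 0" if "y \<in> S" for y
      using B[OF that] Basis_le_norm[OF assms(3), of y] by simp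
    moreover have "continuous_on (seqT \<times> S) (\<lambda>(t, y). y \<bullet> b)"
      by (auto simp: case_prod_unfold intro!: continuous_intros)
    ultimately show ?thesis unfolding symbol_bound_def by blast
  qed
  show ?thesis
  proof (cases k)
    case (Suc k')
    have "R.symb (\<lambda>_. 0) k' 0 (\<lambda>_. pderiv1 c (\<lambda>y. y \<bullet> b))" if "c \<in> Basis" for c
      by (rule R.sym_cong_imp[OF R.sym_const[of 0 _ _ "c \<bullet> b"]]) (auto simp: pderiv1_has_derivative[OF hd])
    moreover have "(\<lambda>y. y \<bullet> b) differentiable (at y)" for y using hd differentiable_def by blast
    ultimately show ?thesis using bound Suc by auto
  qed (use bound in simp)
qed

text \<open>The restriction of \<open>\<chi>\<close> to a coordinate axis is a bump function of one variable; inserting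
  \<open>\<parallel>y - c\<parallel>\<^sup>2 / r\<^sup>2\<close> gives one on \<open>'y\<close>.\<close>

lemma bump_exists:
  fixes chi :: "'z::euclidean_space \<Rightarrow> complex" and c :: "'y::euclidean_space"
  assumes chi: "smooth_on UNIV chi" "\<And>\<xi>. norm \<xi> < 1 \<Longrightarrow> chi \<xi> = 1" "\<And>\<xi>. norm \<xi> > 2 \<Longrightarrow> chi \<xi> = 0"
    and r: "r > 0"
  obtains \<eta> :: "'y \<Rightarrow> complex" where "smooth_on UNIV \<eta>" "\<And>y. y \<in> ball c r \<Longrightarrow> \<eta> y = 1"
    "\<And>y. y \<notin> cball c (2 * r) \<Longrightarrow> \<eta> y = 0"
proof -
  define e :: 'z where "e = (SOME b. b \<in> Basis)"
  have e: "e \<in> Basis" unfolding e_def by (rule someI_ex) (use nonempty_Basis in blast)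
  define q where "q y = inverse (r\<^sup>2) * (\<Sum>b\<in>Basis. (y \<bullet> b - c \<bullet> b) * (y \<bullet> b - c \<bullet> b))" for y
  define \<eta> where "\<eta> y = chi (q y *\<^sub>R e)" for y
  have q_eq: "q y = (norm (y - c))\<^sup>2 / r\<^sup>2" for y
    unfolding q_def by (subst norm_sq_Basis) (simp add: inner_diff_left power2_eq_square divide_inverse mult.commute)
  have nq: "norm (q y *\<^sub>R e) = (dist c y / r)\<^sup>2" for y
    using e by (simp add: q_eq dist_norm norm_minus_commute power_divide)
  have one: "\<eta> y = 1" if "y \<in> ball c r" for y
  proof -
    have "dist c y / r < 1" using that r by simp
    then have "(dist c y / r)\<^sup>2 < 1" using r by (intro power_less_one_iff[THEN iffD2]) (auto simp: abs_square_less_1)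
    then show ?thesis unfolding \<eta>_def by (intro chi(2)) (simp only: nq)
  qed
  have zero: "\<eta> y = 0" if "y \<notin> cball c (2 * r)" for y
  proof -
    have "dist c y / r > 2" using that r by (simp add: field_simps)
    then have "(dist c y / r)\<^sup>2 > 2\<^sup>2" by (intro power_strict_mono) auto
    then show ?thesis unfolding \<eta>_def by (intro chi(3)) (simp only: nq, simp)
  qed
  let ?S = "ball c (3 * r)"
  interpret R: weighted_region seqT ?S "\<lambda>_. 1" Basis by (rule weighted_region_1) simp
  have q: "R.symb (\<lambda>_. 0) k 0 (\<lambda>_. q)" for k
    unfolding q_def
    by (intro R.sym_mult'[of _ _ 0 _ 0 _ 0] R.sym_sum R.sym_diff R.sym_const symfam_component) auto
  have "R.symb (\<lambda>_. 0) k 0 (\<lambda>_. \<eta>)" for k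
    unfolding \<eta>_def by (rule symfam_compose_line[OF _ q e chi(1)]) simp
  from R.sym_smooth_on[OF this refl seqT_mem(1)] have "smooth_on ?S \<eta>" .
  moreover have "smooth_on (- cball c (2 * r)) \<eta>"
  proof -
    have "smooth_on (- cball c (2 * r)) (\<lambda>_. 0 :: complex)"
    proof -
      show ?thesis by (simp add: smooth_on_def pderivs_zero)
    qed
    then show ?thesis using smooth_on_cong[of "- cball c (2 * r)" \<eta> "\<lambda>_. 0"] zero by auto
  qed
  moreover have "UNIV = ?S \<union> - cball c (2 * r)" using r by auto
  ultimately have "smooth_on UNIV \<eta>" unfolding smooth_on_def by (metis UnE UNIV_I)
  then show thesis using that one zero by blast
qed

text \<open>Finitely many bumps \<open>\<eta>\<^sub>c\<close> whose cores cover \<open>K\<close> are combined to \<open>1 - \<Prod>(1 - \<eta>\<^sub>c)\<close>.\<close>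

lemma cutoff_exists:
  fixes chi :: "'z::euclidean_space \<Rightarrow> complex" and K :: "'y::euclidean_space set"
  assumes chi: "smooth_on UNIV chi" "\<And>\<xi>. norm \<xi> < 1 \<Longrightarrow> chi \<xi> = 1" "\<And>\<xi>. norm \<xi> > 2 \<Longrightarrow> chi \<xi> = 0"
    and Y: "open Y" "compact K" "K \<subseteq> Y"
  obtains \<theta> V where "\<theta> \<in> test_functions Y" "open V" "K \<subseteq> V" "\<And>y. y \<in> V \<Longrightarrow> \<theta> y = 1"
proof -
  have "\<forall>c\<in>K. \<exists>r>0. cball c (2 * r) \<subseteq> Y"
  proof
    fix c assume "c \<in> K"
    then obtain e where "e > 0" "cball c e \<subseteq> Y" using Y open_contains_cball by blast
    then show "\<exists>r>0. cball c (2 * r) \<subseteq> Y" by (intro exI[of _ "e / 2"]) auto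
  qed
  then obtain r where r: "\<And>c. c \<in> K \<Longrightarrow> r c > 0" "\<And>c. c \<in> K \<Longrightarrow> cball c (2 * r c) \<subseteq> Y" by metis
  have cover: "K \<subseteq> (\<Union>c\<in>K. ball c (r c))" using r(1) by (meson UN_I centre_in_ball subsetI)
  obtain A where A: "A \<subseteq> K" "finite A" "K \<subseteq> (\<Union>c\<in>A. ball c (r c))"
    by (rule compactE_image[OF Y(2) _ cover]) auto
  have "\<forall>c\<in>A. \<exists>\<eta> :: 'y \<Rightarrow> complex. smooth_on UNIV \<eta> \<and> (\<forall>y\<in>ball c (r c). \<eta> y = 1) \<and> (\<forall>y. y \<notin> cball c (2 * r c) \<longrightarrow> \<eta> y = 0)"
    using bump_exists[OF chi] r(1) A(1) by (metis subsetD)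
  then obtain \<eta> :: "'y \<Rightarrow> 'y \<Rightarrow> complex" where \<eta>: "\<And>c. c \<in> A \<Longrightarrow> smooth_on UNIV (\<eta> c)"
    "\<And>c y. c \<in> A \<Longrightarrow> y \<in> ball c (r c) \<Longrightarrow> \<eta> c y = 1"
    "\<And>c y. c \<in> A \<Longrightarrow> y \<notin> cball c (2 * r c) \<Longrightarrow> \<eta> c y = 0" by metis
  define \<theta> where "\<theta> y = 1 - (\<Prod>c\<in>A. 1 - \<eta> c y)" for y
  interpret R: weighted_region seqT "UNIV :: 'y set" "\<lambda>_. 1" Basis by (rule weighted_region_1) simp
  have "R.symb (\<lambda>_. 0) k 0 (\<lambda>_ y. \<Prod>c\<in>B. 1 - \<eta> c y)" if "B \<subseteq> A" for B k
    using finite_subset[OF that A(2)] that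
  proof (induction B rule: finite_induct)
    case empty show ?case by (simp add: R.sym_const)
  next
    case (insert c B)
    have "R.symb (\<lambda>_. 0) k 0 (\<lambda>_. \<eta> c)"
      using insert by (intro test_symfam_const[of _ "cball c (2 * r c)"] \<eta>) auto
    then have "R.symb (\<lambda>_. 0) k 0 (\<lambda>_ y. (1 - \<eta> c y) * (\<Prod>c\<in>B. 1 - \<eta> c y))"
      using insert by (intro R.sym_mult'[of _ _ 0 _ 0 _ 0] R.sym_diff R.sym_const) auto
    then show ?case using insert by simp
  qed
  then have "R.symb (\<lambda>_. 0) k 0 (\<lambda>_. \<theta>)" for k
    unfolding \<theta>_def by (intro R.sym_diff R.sym_const) auto
  then have sm: "smooth_on UNIV \<theta>" using R.sym_smooth_on[of "\<lambda>_. 0" 0 "\<lambda>_. \<theta>" 0] by simp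
  let ?C = "\<Union>c\<in>A. cball c (2 * r c)"
  have C: "compact ?C" "?C \<subseteq> Y" using A r(2) by (auto intro!: compact_UN)
  have "\<theta> y = 0" if "y \<notin> ?C" for y using \<eta>(3) that by (simp add: \<theta>_def)
  then have "supp \<theta> \<subseteq> ?C"
    unfolding supp_def by (intro closure_minimal compact_imp_closed[OF C(1)]) blast
  then have "\<theta> \<in> test_functions Y"
    using sm C by (auto simp: test_functions_def supp_def compact_closure intro: bounded_subset compact_imp_bounded)
      (metis bounded_subset closure_subset compact_imp_bounded order_trans)
  moreover have "\<theta> y = 1" if "y \<in> (\<Union>c\<in>A. ball c (r c))" for y
  proof -
    have "(\<Prod>c\<in>A. 1 - \<eta> c y) = 0" using that A(2) \<eta>(2) by (auto simp: prod_zero_iff)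
    then show ?thesis by (simp add: \<theta>_def)
  qed
  ultimately show thesis using that[of \<theta> "\<Union>c\<in>A. ball c (r c)"] A(3) by auto
qed

lemma test_functionsI:
  assumes "smooth_on UNIV \<psi>" "compact K" "K \<subseteq> X" "\<And>x. x \<notin> K \<Longrightarrow> \<psi> x = 0"
  shows "\<psi> \<in> test_functions X" "supp \<psi> \<subseteq> K"
proof -
  show s: "supp \<psi> \<subseteq> K"
    unfolding supp_def using assms(4) by (intro closure_minimal compact_imp_closed[OF assms(2)]) blast
  have "closed (supp \<psi>)" by (simp add: supp_def)
  with s have "compact (supp \<psi>)" using compact_Int_closed[OF assms(2)] by (metis inf.absorb2)
  then show "\<psi> \<in> test_functions X" using assms s by (auto simp: test_functions_def)
qed

lemma test_functionsD:
  assumes "\<psi> \<in> test_functions X"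
  shows "smooth_on UNIV \<psi>" "compact (supp \<psi>)" "supp \<psi> \<subseteq> X" "x \<notin> supp \<psi> \<Longrightarrow> \<psi> x = 0"
proof -
  show "x \<notin> supp \<psi> \<Longrightarrow> \<psi> x = 0" unfolding supp_def using closure_subset by (metis (mono_tags) mem_Collect_eq subsetD)
qed (use assms in \<open>auto simp: test_functions_def\<close>)

lemma test_functions_linear:
  assumes "\<phi> \<in> test_functions X" "\<psi> \<in> test_functions X"
  shows "(\<lambda>x. c * \<phi> x + \<psi> x) \<in> test_functions X"
proof (rule test_functionsI(1))
  show "smooth_on UNIV (\<lambda>x. c * \<phi> x + \<psi> x)"
    using assms by (intro smooth_on_linear test_functionsD(1)) auto
  show "compact (supp \<phi> \<union> supp \<psi>)" using assms by (intro compact_Un test_functionsD(2)) auto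
  show "supp \<phi> \<union> supp \<psi> \<subseteq> X" using assms by (simp add: test_functionsD(3))
  show "c * \<phi> x + \<psi> x = 0" if "x \<notin> supp \<phi> \<union> supp \<psi>" for x
    using that test_functionsD(4)[OF assms(1)] test_functionsD(4)[OF assms(2)] by simp
qed

lemma zero_test_function: "(\<lambda>_. 0) \<in> test_functions X"
  by (rule test_functionsI(1)[of _ "{}"]) (auto simp: smooth_on_def pderivs_zero)

lemma scale_test_function:
  "\<psi> \<in> test_functions X \<Longrightarrow> (\<lambda>x. c * \<psi> x) \<in> test_functions X"
  using test_functions_linear[OF _ zero_test_function, of \<psi> X c] by simp

lemma distribution_linear:
  assumes "u \<in> distributions X" "\<phi> \<in> test_functions X" "\<psi> \<in> test_functions X"
  shows "u (\<lambda>x. c * \<phi> x + \<psi> x) = c * u \<phi> + u \<psi>"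
  using assms scale_test_function[OF assms(2), of c] unfolding distributions_def by simp

section \<open>Continuity\<close>

locale fio_setting =
  fixes X :: "'x::euclidean_space set" and Y :: "'y::euclidean_space set"
    and chi :: "'z::euclidean_space \<Rightarrow> complex"
    and \<alpha> d \<rho> \<delta> :: real and \<kappa> :: nat
    and u :: "('y \<Rightarrow> complex) \<Rightarrow> complex"
  assumes open_X: "open X" and open_Y: "open Y"
    and \<alpha>_pos: "\<alpha> > 0" and \<delta>: "0 \<le> \<delta>" "\<delta> < 1" and \<rho>: "0 < \<rho>" "\<rho> \<le> 1"
    and chi_test: "chi \<in> test_functions UNIV"
    and chi_1: "\<And>\<xi>. norm \<xi> < 1 \<Longrightarrow> chi \<xi> = 1" and chi_0: "\<And>\<xi>. norm \<xi> > 2 \<Longrightarrow> chi \<xi> = 0"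
    and order: "d - real \<kappa> * min \<rho> (1 - \<delta>) < - real DIM('z)"
    and u: "u \<in> compact_distributions Y"
begin

lemma chi_smooth: "smooth_on UNIV chi" using chi_test by (rule test_functionsD(1))

lemma u_distribution: "u \<in> distributions Y" using u by (simp add: compact_distributions_def)

definition \<theta> :: "'y \<Rightarrow> complex" where "\<theta> = (SOME \<theta>. is_cutoff Y u \<theta>)"

lemma \<theta>_test: "\<theta> \<in> test_functions Y"
proof -
  have "compact (dist_supp Y u)" using u by (simp add: compact_distributions_def)
  moreover have "dist_supp Y u \<subseteq> Y" by (auto simp: dist_supp_def)
  ultimately obtain \<theta> V where "\<theta> \<in> test_functions Y" "open V" "dist_supp Y u \<subseteq> V" "\<And>y. y \<in> V \<Longrightarrow> \<theta> y = 1"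
    using cutoff_exists[OF chi_smooth chi_1 chi_0 open_Y] by metis
  then have "is_cutoff Y u \<theta>" unfolding is_cutoff_def by blast
  then have "is_cutoff Y u (SOME \<theta>. is_cutoff Y u \<theta>)" by (rule someI[of "is_cutoff Y u"])
  then show ?thesis by (simp add: is_cutoff_def \<theta>_def)
qed

lemma pairing_eq: "pairing Y u f = u (\<lambda>y. \<theta> y * f y)"
  by (simp add: pairing_def \<theta>_def)

text \<open>Convergence at the rate \<open>1 / (n + 1)\<close>, with supports of the test functions in a common compact set \<open>K\<close>.
  For the test functions each derivative has to keep this rate only from some index on, so that
  any finitely many members can be prescribed.\<close>

definition converges ::
  "('x \<times> 'y \<times> 'z \<Rightarrow> real) \<Rightarrow> (nat \<Rightarrow> 'x \<times> 'y \<times> 'z \<Rightarrow> real) \<Rightarrow> ('x \<times> 'y \<times> 'z \<Rightarrow> complex)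
    \<Rightarrow> (nat \<Rightarrow> 'x \<times> 'y \<times> 'z \<Rightarrow> complex) \<Rightarrow> 'x set \<Rightarrow> ('x \<Rightarrow> complex) \<Rightarrow> (nat \<Rightarrow> 'x \<Rightarrow> complex) \<Rightarrow> bool"
  where "converges \<Phi>0 \<Phi> a0 a K \<psi>0 \<psi> \<longleftrightarrow>
    \<Phi>0 \<in> phases X Y \<alpha> \<and> (\<forall>n. \<Phi> n \<in> phases X Y \<alpha> \<and>
      phase_near X Y n (\<Phi> n) \<Phi>0) \<and>
    a0 \<in> amplitudes X Y d \<rho> \<delta> \<and> (\<forall>n. a n \<in> amplitudes X Y d \<rho> \<delta> \<and>
      amplitude_near X Y d \<rho> \<delta> n (a n) a0) \<and>
    compact K \<and> K \<subseteq> X \<and> smooth_on UNIV \<psi>0 \<and> (\<forall>x. x \<notin> K \<longrightarrow> \<psi>0 x = 0) \<and>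
    (\<forall>n. smooth_on UNIV (\<psi> n) \<and> (\<forall>x. x \<notin> K \<longrightarrow> \<psi> n x = 0)) \<and>
    (\<forall>vs\<in>lists Basis. \<exists>N. \<forall>n\<ge>N. \<forall>x. norm (pderivs vs (\<psi> n) x - pderivs vs \<psi>0 x) \<le> seq_param n)"

text \<open>Shrinking \<open>X\<close> and \<open>Y\<close> to relatively compact neighbourhoods of \<open>K\<close> and \<open>L\<close> turns bounds on compact sets
  into uniform ones.\<close>

lemma converges_family:
  assumes c: "converges \<Phi>0 \<Phi> a0 a K \<psi>0 \<psi>" and L: "compact L" "L \<subseteq> Y"
  obtains X' Y' where "X' \<subseteq> X" "L \<subseteq> Y'"
    "fio_family seqT X' Y' K chi \<alpha> d \<rho> \<delta> (seq_fam \<Phi>0 \<Phi>) (seq_fam a0 a) (seq_fam \<psi>0 \<psi>)"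
proof -
  have K: "compact K" "K \<subseteq> X" using c by (auto simp: converges_def)
  obtain U C where U: "open U" "K \<subseteq> U" "U \<subseteq> C" "compact C" "C \<subseteq> X"
    by (rule compact_open_neighbourhood[OF K(1) open_X K(2)])
  obtain V D where V: "open V" "L \<subseteq> V" "V \<subseteq> D" "compact D" "D \<subseteq> Y"
    by (rule compact_open_neighbourhood[OF L(1) open_Y L(2)])
  have ph: "\<Phi>0 \<in> phases_hg X Y" "\<Phi> n \<in> phases_hg X Y" for n using c by (auto simp: converges_def phases_def)
  have pht: "seq_fam \<Phi>0 \<Phi> t \<in> phases X Y \<alpha>" if "t \<in> seqT" for t
    using that c by (cases rule: seqT_cases) (auto simp: converges_def)
  have pc: "phase_near X Y n (\<Phi> n) \<Phi>0" for n
    using c by (auto simp: converges_def)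
  have am: "a0 \<in> amplitudes X Y d \<rho> \<delta>" "a n \<in> amplitudes X Y d \<rho> \<delta>" for n using c by (auto simp: converges_def)
  have ac: "amplitude_near X Y d \<rho> \<delta> n (a n) a0" for n
    using c by (auto simp: converges_def)
  have ps: "smooth_family seqT UNIV k (seq_fam \<psi>0 \<psi>)" for k
    using c by (intro test_symfam[of _ _ K]) (auto simp: converges_def)
  note side = U(4,5) V(4,5) U(1,3) V(1,3)
  have "fio_family seqT U V K chi \<alpha> d \<rho> \<delta> (seq_fam \<Phi>0 \<Phi>) (seq_fam a0 a) (seq_fam \<psi>0 \<psi>)"
  proof
    show "smooth_on (phase_dom U V) (seq_fam \<Phi>0 \<Phi> t)" if "t \<in> seqT" for t
    proof (rule smooth_on_subset)
      show "smooth_on (phase_dom X Y) (seq_fam \<Phi>0 \<Phi> t)" using pht[OF that] by (simp add: phases_def phases_hg_def)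
    qed (use U V in blast)
    show "\<alpha> \<le> (norm (grad_x (seq_fam \<Phi>0 \<Phi> t) (x, y, \<xi>)))\<^sup>2 / (norm \<xi>)\<^sup>2 +
        (norm (grad_xi (seq_fam \<Phi>0 \<Phi> t) (x, y, \<xi>)))\<^sup>2"
      if "t \<in> seqT" "x \<in> U" "y \<in> V" "\<xi> \<noteq> 0" for t x y \<xi>
    proof -
      have "x \<in> X" "y \<in> Y" "\<xi> \<in> - {0}" using that U V by auto
      then show ?thesis using pht[OF that(1)] unfolding phases_def by blast
    qed
    show "smooth_family seqT U k (seq_fam \<psi>0 \<psi>)" for k
      by (rule symfam_subset[OF ps]) auto
    show "seq_fam \<psi>0 \<psi> t x = 0" if "t \<in> seqT" "x \<notin> K" for t x
      using that c by (cases rule: seqT_cases) (auto simp: converges_def)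
  qed (use K U V \<alpha>_pos \<delta> \<rho> chi_smooth chi_1 chi_0
      phase_symfam[OF open_X open_Y ph pc side] amplitude_symfam[OF open_X open_Y am ac side] in auto)
  then show thesis using that[of U V] U V by blast
qed

text \<open>Smooth near the support of \<open>\<theta>\<close>, and zero off this support.\<close>

lemma cut_transpose_family:
  assumes c: "converges \<Phi>0 \<Phi> a0 a K \<psi>0 \<psi>"
  defines "H \<equiv> \<lambda>t y. \<theta> y * FIO_transpose X chi \<kappa> (seq_fam \<Phi>0 \<Phi> t) (seq_fam a0 a t) (seq_fam \<psi>0 \<psi> t) y"
  shows "smooth_family seqT UNIV k H"
proof -
  note L = test_functionsD[OF \<theta>_test]
  obtain X' Y' where XY: "X' \<subseteq> X" "supp \<theta> \<subseteq> Y'"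
    and F: "fio_family seqT X' Y' K chi \<alpha> d \<rho> \<delta> (seq_fam \<Phi>0 \<Phi>) (seq_fam a0 a) (seq_fam \<psi>0 \<psi>)"
    by (rule converges_family[OF c L(2,3)])
  interpret F: fio_family seqT X' Y' K chi \<alpha> d \<rho> \<delta> "seq_fam \<Phi>0 \<Phi>" "seq_fam a0 a" "seq_fam \<psi>0 \<psi>" by (rule F)
  interpret WY: weighted_region seqT Y' "\<lambda>_. 1" Basis by (rule weighted_region_1[OF F.open_Y])
  have cl: "open (- supp \<theta>)" using compact_imp_closed[OF L(2)] by blast
  interpret WN: weighted_region seqT "- supp \<theta>" "\<lambda>_. 1" Basis by (rule weighted_region_1[OF cl])
  have "WY.symb (\<lambda>_. 0) k 0 (\<lambda>t. FIO_transpose X chi \<kappa> (seq_fam \<Phi>0 \<Phi> t) (seq_fam a0 a t) (seq_fam \<psi>0 \<psi> t))"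
    using F.FIO_transpose_family[OF _ XY(1)] order by (simp add: F.gain_def)
  moreover have "WY.symb (\<lambda>_. 0) k 0 (\<lambda>_. \<theta>)"
    by (rule symfam_subset[OF test_symfam_const[OF L(1,2,4)]]) auto
  ultimately have 1: "WY.symb (\<lambda>_. 0) k 0 H" unfolding H_def by (intro WY.sym_mult'[of _ _ 0 _ 0 _ 0]) auto
  have 2: "WN.symb (\<lambda>_. 0) k 0 H"
    by (rule WN.sym_cong_imp[OF WN.sym_zero]) (simp add: H_def L(4))
  have "Y' \<union> - supp \<theta> = UNIV" using XY by auto
  with symfam_Un[OF 1 2 F.open_Y cl] show ?thesis by simp
qed

lemma cut_transpose_test:
  assumes c: "converges \<Phi>0 \<Phi> a0 a K \<psi>0 \<psi>" and t: "t \<in> seqT"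
  defines "H \<equiv> \<lambda>y. \<theta> y * FIO_transpose X chi \<kappa> (seq_fam \<Phi>0 \<Phi> t) (seq_fam a0 a t) (seq_fam \<psi>0 \<psi> t) y"
  shows "H \<in> test_functions Y" "supp H \<subseteq> supp \<theta>"
proof -
  interpret W: weighted_region seqT UNIV "\<lambda>_. 1" Basis by (rule weighted_region_1) simp
  note L = test_functionsD[OF \<theta>_test]
  have "smooth_on UNIV H"
    unfolding H_def by (rule W.sym_smooth_on[OF cut_transpose_family[OF c] refl t])
  then show "H \<in> test_functions Y" "supp H \<subseteq> supp \<theta>"
    using test_functionsI[OF _ L(2,3)] by (auto simp: H_def L(4))
qed

text \<open>Derivatives of \<open>\<theta> \<cdot> \<^sup>tA\<^sub>t[\<psi>\<^sub>t]\<close> are jointly continuous in \<open>(t, y)\<close>, hence uniformly continuous over the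
  compact support of \<open>\<theta>\<close>; so they converge uniformly in \<open>y\<close> as \<open>t \<rightarrow> 0\<close>, and \<open>u\<close> is
  dominated by finitely many of their sup norms.\<close>

lemma pairing_tendsto:
  assumes c: "converges \<Phi>0 \<Phi> a0 a K \<psi>0 \<psi>"
  shows "(\<lambda>n. pairing Y u (FIO_transpose X chi \<kappa> (\<Phi> n) (a n) (\<psi> n)))
    \<longlonglongrightarrow> pairing Y u (FIO_transpose X chi \<kappa> \<Phi>0 a0 \<psi>0)"
proof -
  define H where "H t y = \<theta> y * FIO_transpose X chi \<kappa> (seq_fam \<Phi>0 \<Phi> t) (seq_fam a0 a t) (seq_fam \<psi>0 \<psi> t) y" for t y
  note L = test_functionsD[OF \<theta>_test]
  have Ht: "H t \<in> test_functions Y" "supp (H t) \<subseteq> supp \<theta>" if "t \<in> seqT" for t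
    using cut_transpose_test[OF c that] by (simp_all add: H_def[abs_def])
  have Hz: "H t y = 0" if "y \<notin> supp \<theta>" for t y using L(4)[OF that] by (simp add: H_def)
  have Hsym: "smooth_family seqT UNIV k H" for k
    using cut_transpose_family[OF c] by (simp add: H_def[abs_def])
  (* The difference to the limit, in the form to which linearity of u applies. *)
  define W where "W n y = -1 * H 0 y + H (seq_param n) y" for n y
  have Wt: "W n \<in> test_functions Y" for n
    unfolding W_def[abs_def] by (intro test_functions_linear Ht) auto
  have Ws: "supp (W n) \<subseteq> supp \<theta>" for n
    using test_functionsI(2)[OF test_functionsD(1)[OF Wt] L(2,3)] Hz by (simp add: W_def)
  have uW: "u (W n) = u (H (seq_param n)) - u (H 0)" for n
    using distribution_linear[OF u_distribution Ht(1) Ht(1), of 0 "seq_param n" "-1"] by (simp add: W_def[abs_def])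
  have "\<forall>K. compact K \<and> K \<subseteq> Y \<longrightarrow> (\<exists>C N. \<forall>\<psi> \<in> test_functions Y. supp \<psi> \<subseteq> K \<longrightarrow>
        norm (u \<psi>) \<le> C * (\<Sum>vs | vs \<in> lists Basis \<and> length vs \<le> N. SUP x. norm (pderivs vs \<psi> x)))"
    using u_distribution unfolding distributions_def mem_Collect_eq by (elim conjE)
  from this[rule_format, OF conjI[OF L(2,3)]]
  obtain C N where CN: "\<And>\<psi>. \<psi> \<in> test_functions Y \<Longrightarrow> supp \<psi> \<subseteq> supp \<theta> \<Longrightarrow>
      norm (u \<psi>) \<le> C * (\<Sum>vs | vs \<in> lists Basis \<and> length vs \<le> N. SUP x. norm (pderivs vs \<psi> x))"
    by (elim exE) blast
  have sup: "(\<lambda>n. SUP x. norm (pderivs vs (W n) x)) \<longlonglongrightarrow> 0" if vs: "vs \<in> lists Basis" for vs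
  proof (rule LIMSEQ_I)
    fix \<epsilon> :: real assume \<epsilon>: "\<epsilon> > 0"
    interpret R: weighted_region seqT UNIV "\<lambda>_. 1" Basis by (rule weighted_region_1) simp
    have "continuous_on (seqT \<times> UNIV) (\<lambda>(t, y). pderivs vs (H t) y)"
      using symfam_bound[OF R.sym_pderivsD[OF Hsym[of "length vs"] vs order_refl]]
      by (simp add: symbol_bound_def)
    then have "continuous_on (seqT \<times> supp \<theta>) (\<lambda>(t, y). pderivs vs (H t) y)"
      by (rule continuous_on_subset) auto
    then have "uniformly_continuous_on (seqT \<times> supp \<theta>) (\<lambda>(t, y). pderivs vs (H t) y)"
      by (rule compact_uniformly_continuous) (intro compact_Times compact_seqT L(2))
    then obtain e where e: "e > 0" "\<And>p p'. p \<in> seqT \<times> supp \<theta> \<Longrightarrow> p' \<in> seqT \<times> supp \<theta> \<Longrightarrow> dist p' p < e \<Longrightarrow>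
        dist ((\<lambda>(t, y). pderivs vs (H t) y) p') ((\<lambda>(t, y). pderivs vs (H t) y) p) < \<epsilon> / 2"
      unfolding uniformly_continuous_on_def using \<epsilon> by (metis half_gt_zero)
    obtain n0 where n0: "\<And>n. n \<ge> n0 \<Longrightarrow> seq_param n < e"
      using order_tendstoD(2)[OF seq_param_tendsto e(1)] by (auto simp: eventually_sequentially)
    show "\<exists>n0. \<forall>n\<ge>n0. norm ((SUP x. norm (pderivs vs (W n) x)) - 0) < \<epsilon>"
    proof (intro exI allI impI)
      fix n assume n: "n \<ge> n0"
      have sm: "smooth_on UNIV (H t)" if "t \<in> seqT" for t using Ht(1)[OF that] by (rule test_functionsD(1))
      have eq: "pderivs vs (W n) y = pderivs vs (H (seq_param n)) y - pderivs vs (H 0) y" for y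
        unfolding W_def[abs_def]
        using pderivs_linear(1)[of UNIV "H 0" "H (seq_param n)" vs y "-1"] sm vs by simp
      have b: "norm (pderivs vs (W n) y) \<le> \<epsilon> / 2" for y
      proof (cases "y \<in> supp \<theta>")
        case True
        have "dist (seq_param n, y) (0, y) < e" using n0[OF n] seq_param_pos[of n] by (simp add: dist_Pair_Pair)
        from e(2)[OF _ _ this] True show ?thesis by (simp add: eq dist_norm less_imp_le)
      next
        case False
        then have "pderivs vs (H t) y = 0" if "t \<in> seqT" for t
          using test_function_bounded(2)[OF sm[OF that] L(2) Hz vs] by blast
        then show ?thesis using \<epsilon> by (simp add: eq)
      qed
      have "(SUP x. norm (pderivs vs (W n) x)) \<le> \<epsilon> / 2" by (rule cSUP_least) (use b in auto)
      moreover have "0 \<le> (SUP x. norm (pderivs vs (W n) x))"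
        by (rule cSUP_upper2[of _ _ undefined]) (use b in \<open>auto intro!: bdd_aboveI[of _ "\<epsilon> / 2"] simp del: le_divide_eq_numeral1\<close>)
      ultimately show "norm ((SUP x. norm (pderivs vs (W n) x)) - 0) < \<epsilon>" using \<epsilon> by simp
    qed
  qed
  have "(\<lambda>n. C * (\<Sum>vs | vs \<in> lists Basis \<and> length vs \<le> N. SUP x. norm (pderivs vs (W n) x))) \<longlonglongrightarrow> C * 0"
    by (intro tendsto_mult tendsto_const tendsto_null_sum sup) auto
  then have "(\<lambda>n. C * (\<Sum>vs | vs \<in> lists Basis \<and> length vs \<le> N. SUP x. norm (pderivs vs (W n) x))) \<longlonglongrightarrow> 0" by simp
  then have "(\<lambda>n. u (H (seq_param n)) - u (H 0)) \<longlonglongrightarrow> 0"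
    by (rule Lim_null_comparison[rotated]) (use CN[OF Wt Ws] in \<open>simp add: uW\<close>)
  then have "(\<lambda>n. u (H (seq_param n))) \<longlonglongrightarrow> u (H 0)" by (simp add: LIM_zero_iff)
  then show ?thesis by (simp add: pairing_eq H_def[abs_def])
qed

lemma seminorm_zero:
  "phase_seminorm X Y m (\<lambda>p :: 'x \<times> 'y \<times> 'z. 0) = 0"
  "amplitude_seminorm X Y d \<rho> \<delta> m (\<lambda>p :: 'x \<times> 'y \<times> 'z. 0) = 0"
proof -
  have sup0: "(SUP x\<in>A. 0) = (0::ennreal)" for A :: "'c set"
    by (cases "A = {}") (auto simp: bot_ennreal)
  have z: "pderivs3 js ks ls (\<lambda>p. 0 :: real) = (\<lambda>p. 0)" "pderivs3 js ks ls (\<lambda>p. 0 :: complex) = (\<lambda>p. 0)"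
    for js :: "'x list" and ks :: "'y list" and ls :: "'z list"
    unfolding pderivs3_def by (rule pderivs_zero)+
  show "phase_seminorm X Y m (\<lambda>p :: 'x \<times> 'y \<times> 'z. 0) = 0"
    "amplitude_seminorm X Y d \<rho> \<delta> m (\<lambda>p :: 'x \<times> 'y \<times> 'z. 0) = 0"
    unfolding phase_seminorm_def amplitude_seminorm_def by (simp_all add: z sup0 case_prod_unfold)
qed

lemma converges_const:
  assumes "\<Phi>0 \<in> phases X Y \<alpha>" "a0 \<in> amplitudes X Y d \<rho> \<delta>" "compact K" "K \<subseteq> X"
    "smooth_on UNIV \<psi>0" "\<And>x. x \<notin> K \<Longrightarrow> \<psi>0 x = 0"
    "\<And>n. smooth_on UNIV (\<psi> n)" "\<And>n x. x \<notin> K \<Longrightarrow> \<psi> n x = 0"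
    "\<And>vs. vs \<in> lists Basis \<Longrightarrow> \<exists>N. \<forall>n\<ge>N. \<forall>x. norm (pderivs vs (\<psi> n) x - pderivs vs \<psi>0 x) \<le> seq_param n"
  shows "converges \<Phi>0 (\<lambda>_. \<Phi>0) a0 (\<lambda>_. a0) K \<psi>0 \<psi>"
  using assms seq_param_pos by (simp add: converges_def seminorm_zero)

text \<open>The sequence \<open>\<phi>, \<psi>, c \<phi> + \<psi>, c \<phi> + \<psi>, \<dots>\<close> puts the three test functions into one convergent family.\<close>

lemma pairing_linear:
  assumes \<Phi>: "\<Phi>0 \<in> phases X Y \<alpha>" and a: "a0 \<in> amplitudes X Y d \<rho> \<delta>"
    and \<phi>: "\<phi> \<in> test_functions X" and \<psi>: "\<psi> \<in> test_functions X"
  shows "pairing Y u (FIO_transpose X chi \<kappa> \<Phi>0 a0 (\<lambda>x. c * \<phi> x + \<psi> x))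
    = c * pairing Y u (FIO_transpose X chi \<kappa> \<Phi>0 a0 \<phi>) + pairing Y u (FIO_transpose X chi \<kappa> \<Phi>0 a0 \<psi>)"
proof -
  let ?K = "supp \<phi> \<union> supp \<psi>"
  let ?\<psi>0 = "\<lambda>x. c * \<phi> x + \<psi> x"
  (* Finitely many exceptional members do not affect convergence. *)
  define \<psi>' where "\<psi>' n = (if n = 0 then \<phi> else if n = Suc 0 then \<psi> else ?\<psi>0)" for n :: nat
  note P = test_functionsD[OF \<phi>] and Q = test_functionsD[OF \<psi>]
    and R = test_functionsD(1)[OF test_functions_linear[OF \<phi> \<psi>, of c]]
  have z: "?\<psi>0 x = 0" "\<psi>' n x = 0" if "x \<notin> ?K" for n x
    using P(4) Q(4) that by (auto simp: \<psi>'_def)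
  have c: "converges \<Phi>0 (\<lambda>_. \<Phi>0) a0 (\<lambda>_. a0) ?K ?\<psi>0 \<psi>'"
  proof (rule converges_const[OF \<Phi> a])
    show "\<exists>N. \<forall>n\<ge>N. \<forall>x. norm (pderivs vs (\<psi>' n) x - pderivs vs ?\<psi>0 x) \<le> seq_param n" for vs
      by (intro exI[of _ 2]) (auto simp: \<psi>'_def less_imp_le[OF seq_param_pos])
  qed (use P Q R z in \<open>auto simp: \<psi>'_def intro: compact_Un\<close>)
  note L = test_functionsD[OF \<theta>_test]
  obtain X' Y' where XY: "X' \<subseteq> X" "supp \<theta> \<subseteq> Y'"
    and F: "fio_family seqT X' Y' ?K chi \<alpha> d \<rho> \<delta> (seq_fam \<Phi>0 (\<lambda>_. \<Phi>0)) (seq_fam a0 (\<lambda>_. a0)) (seq_fam ?\<psi>0 \<psi>')"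
    by (rule converges_family[OF c L(2,3)])
  interpret F: fio_family seqT X' Y' ?K chi \<alpha> d \<rho> \<delta> "seq_fam \<Phi>0 (\<lambda>_. \<Phi>0)" "seq_fam a0 (\<lambda>_. a0)" "seq_fam ?\<psi>0 \<psi>'"
    by (rule F)
  have lin: "FIO_transpose X chi \<kappa> \<Phi>0 a0 ?\<psi>0 y
      = c * FIO_transpose X chi \<kappa> \<Phi>0 a0 \<phi> y + FIO_transpose X chi \<kappa> \<Phi>0 a0 \<psi> y" if y: "y \<in> Y'" for y
  proof -
    have "F.ord \<kappa> < - real DIM('z)" using order by (simp add: F.gain_def)
    from F.FIO_transpose_linear[of "seq_param 0" "seq_param (Suc 0)" 0 c, OF _ _ _ _ _ _ _ _ this y XY(1)]
    show ?thesis by (simp add: seq_fam_def[of _ "\<lambda>_. _"] \<psi>'_def)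
  qed
  let ?H = "\<lambda>\<psi> y. \<theta> y * FIO_transpose X chi \<kappa> \<Phi>0 a0 \<psi> y"
  have H: "?H \<phi> \<in> test_functions Y" "?H \<psi> \<in> test_functions Y"
    using cut_transpose_test(1)[OF c, of "seq_param 0"] cut_transpose_test(1)[OF c, of "seq_param (Suc 0)"]
    by (simp_all add: \<psi>'_def)
  have "?H ?\<psi>0 = (\<lambda>y. c * ?H \<phi> y + ?H \<psi> y)"
  proof
    fix y show "?H ?\<psi>0 y = c * ?H \<phi> y + ?H \<psi> y"
      by (cases "y \<in> supp \<theta>") (use lin[of y] XY(2) L(4)[of y] in \<open>auto simp: algebra_simps\<close>)
  qed
  then show ?thesis
    unfolding pairing_eq using distribution_linear[OF u_distribution H, of c] by simp
qed

text \<open>If the seminorm estimate failed on a compact set for every constant and order, there would be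
  test functions \<open>\<phi>\<^sub>n\<close> with value 1 whose derivatives up to order \<open>n\<close> are at most \<open>1 / (n + 1)\<close>.
  They tend to zero, whereas their values do not.\<close>

lemma FIO_distribution:
  assumes \<Phi>: "\<Phi>0 \<in> phases X Y \<alpha>" and a: "a0 \<in> amplitudes X Y d \<rho> \<delta>"
  shows "FIO X Y chi \<kappa> \<Phi>0 a0 u \<in> distributions X"
proof -
  let ?A = "FIO X Y chi \<kappa> \<Phi>0 a0 u"
  have A: "?A \<psi> = pairing Y u (FIO_transpose X chi \<kappa> \<Phi>0 a0 \<psi>)" if "\<psi> \<in> test_functions X" for \<psi>
    using that by (simp add: FIO_def)
  have lin: "?A (\<lambda>x. c * \<phi> x + \<psi> x) = c * ?A \<phi> + ?A \<psi>"
    if "\<phi> \<in> test_functions X" "\<psi> \<in> test_functions X" for c \<phi> \<psi>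
    using pairing_linear[OF \<Phi> a that, of c] that test_functions_linear[OF that, of c] by (simp add: A)
  have z: "?A (\<lambda>_. 0) = 0"
    using lin[OF zero_test_function zero_test_function, of 1] by simp
  have scale: "?A (\<lambda>x. c * \<psi> x) = c * ?A \<psi>" if "\<psi> \<in> test_functions X" for c \<psi>
    using lin[OF that zero_test_function, of c] z by simp
  have bound: "\<exists>C N. \<forall>\<psi> \<in> test_functions X. supp \<psi> \<subseteq> K \<longrightarrow>
      norm (?A \<psi>) \<le> C * (\<Sum>vs | vs \<in> lists Basis \<and> length vs \<le> N. SUP x. norm (pderivs vs \<psi> x))"
    if K: "compact K" "K \<subseteq> X" for K
  proof (rule ccontr)
    assume "\<not> ?thesis"
    then have "\<forall>n. \<exists>\<psi>. \<psi> \<in> test_functions X \<and> supp \<psi> \<subseteq> K \<and>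
      inverse (seq_param n) * (\<Sum>vs | vs \<in> lists Basis \<and> length vs \<le> n. SUP x. norm (pderivs vs \<psi> x)) < norm (?A \<psi>)"
      by (meson not_le)
    from choice[OF this] obtain \<psi> where \<psi>: "\<And>n. \<psi> n \<in> test_functions X" "\<And>n. supp (\<psi> n) \<subseteq> K"
      "\<And>n. inverse (seq_param n) * (\<Sum>vs | vs \<in> lists Basis \<and> length vs \<le> n. SUP x. norm (pderivs vs (\<psi> n) x)) < norm (?A (\<psi> n))"
      by blast
    note P = test_functionsD[OF \<psi>(1)]
    have bdd: "bdd_above (range (\<lambda>x. norm (pderivs vs (\<psi> n) x)))" if vs: "vs \<in> lists Basis" for vs n
    proof -
      obtain C where "\<forall>x. norm (pderivs vs (\<psi> n) x) \<le> C"
        using test_function_bounded(1)[OF P(1,2,4) vs] by blast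
      then show ?thesis by (intro bdd_aboveI[of _ C]) auto
    qed
    have le: "norm (pderivs vs (\<psi> n) x) \<le> (SUP x. norm (pderivs vs (\<psi> n) x))" if "vs \<in> lists Basis" for vs n x
      by (rule cSUP_upper[OF _ bdd[OF that]]) simp
    have ge0: "0 \<le> (SUP x. norm (pderivs vs (\<psi> n) x))" if "vs \<in> lists Basis" for vs n
      using le[OF that] by (meson norm_ge_zero order_trans)
    have fin: "finite {vs. vs \<in> lists (Basis :: 'x set) \<and> length vs \<le> n}" for n
    proof -
      have "{vs. vs \<in> lists (Basis :: 'x set) \<and> length vs \<le> n} = {vs. set vs \<subseteq> Basis \<and> length vs \<le> n}" by auto
      then show ?thesis using finite_lists_length_le[of "Basis :: 'x set" n] by simp
    qed
    have sum_ge0: "0 \<le> (\<Sum>vs | vs \<in> lists Basis \<and> length vs \<le> n. SUP x. norm (pderivs vs (\<psi> n) x))" for n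
      by (rule sum_nonneg) (use ge0 in auto)
    have pos: "norm (?A (\<psi> n)) > 0" for n
      using \<psi>(3)[of n] sum_ge0[of n] seq_param_pos[of n]
      by (meson inverse_nonnegative_iff_nonnegative le_less_trans less_imp_le mult_nonneg_nonneg)
    define \<phi> where "\<phi> n x = inverse (?A (\<psi> n)) * \<psi> n x" for n x
    have \<phi>t: "\<phi> n \<in> test_functions X" for n
      unfolding \<phi>_def[abs_def] by (rule scale_test_function[OF \<psi>(1)])
    have one: "?A (\<phi> n) = 1" for n
      unfolding \<phi>_def[abs_def] using pos[of n] by (subst scale[OF \<psi>(1)]) auto
    have small: "norm (pderivs vs (\<phi> n) x) \<le> seq_param n" if vs: "vs \<in> lists Basis" and n: "n \<ge> length vs" for vs n x
    proof -
      have s0: "smooth_on UNIV (\<lambda>_::'x. 0::complex)" by (rule test_functionsD(1)[OF zero_test_function])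
      have "pderivs vs (\<phi> n) x = inverse (?A (\<psi> n)) * pderivs vs (\<psi> n) x"
        using pderivs_linear(1)[OF _ P(1) s0 vs, of x "inverse (?A (\<psi> n))" n]
        by (simp add: \<phi>_def[abs_def] pderivs_zero)
      then have eq: "norm (pderivs vs (\<phi> n) x) = norm (pderivs vs (\<psi> n) x) / norm (?A (\<psi> n))"
        by (simp add: norm_mult norm_inverse divide_inverse mult.commute)
      have "norm (pderivs vs (\<psi> n) x) \<le> (SUP x. norm (pderivs vs (\<psi> n) x))" by (rule le[OF vs])
      also have "\<dots> \<le> (\<Sum>vs | vs \<in> lists Basis \<and> length vs \<le> n. SUP x. norm (pderivs vs (\<psi> n) x))"
        by (rule member_le_sum) (use vs n ge0 fin in auto)
      also have "\<dots> \<le> seq_param n * norm (?A (\<psi> n))"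
        using \<psi>(3)[of n] seq_param_pos[of n] by (simp add: field_simps)
      finally show ?thesis using pos[of n] by (simp add: eq pos_divide_le_eq)
    qed
    have "converges \<Phi>0 (\<lambda>_. \<Phi>0) a0 (\<lambda>_. a0) K (\<lambda>_. 0) \<phi>"
    proof (rule converges_const[OF \<Phi> a K])
      show "smooth_on UNIV (\<lambda>_::'x. 0::complex)" by (rule test_functionsD(1)[OF zero_test_function])
      show "smooth_on UNIV (\<phi> n)" for n by (rule test_functionsD(1)[OF \<phi>t])
      show "\<phi> n x = 0" if "x \<notin> K" for n x using P(4)[of x n] \<psi>(2)[of n] that by (auto simp: \<phi>_def)
      show "\<exists>N. \<forall>n\<ge>N. \<forall>x. norm (pderivs vs (\<phi> n) x - pderivs vs (\<lambda>_. 0) x) \<le> seq_param n"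
        if "vs \<in> lists Basis" for vs
        using small[OF that] by (intro exI[of _ "length vs"]) (simp add: pderivs_zero)
    qed simp
    from pairing_tendsto[OF this] have "(\<lambda>n. ?A (\<phi> n)) \<longlonglongrightarrow> ?A (\<lambda>_. 0)"
      by (simp add: A \<phi>t zero_test_function)
    then have "(\<lambda>n. 1 :: complex) \<longlonglongrightarrow> 0" by (simp add: one z)
    then show False using LIMSEQ_unique tendsto_const zero_neq_one by metis
  qed
  have "?A \<in> extensional (test_functions X)" by (simp add: FIO_def)
  moreover have "?A (\<lambda>x. \<phi> x + \<psi> x) = ?A \<phi> + ?A \<psi>" if "\<phi> \<in> test_functions X" "\<psi> \<in> test_functions X" for \<phi> \<psi>
    using lin[OF that, of 1] by simp
  ultimately show ?thesis
    unfolding distributions_def mem_Collect_eq using scale bound by blast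
qed

lemma topspace_FIO:
  fixes \<Phi> :: "'x \<times> 'y \<times> 'z \<Rightarrow> real" and a :: "'x \<times> 'y \<times> 'z \<Rightarrow> complex"
  assumes "(\<Phi>, a) \<in> topspace (FIO_topology X Y \<alpha> d \<rho> \<delta>)"
  shows "\<Phi> \<in> phases X Y \<alpha>" "a \<in> amplitudes X Y d \<rho> \<delta>"
  using assms
  by (auto simp: FIO_topology_def phases_topology_def amplitudes_topology_def seminorm_topology_def
      topology_generated_by_topspace)

lemma FIO_neighbourhood:
  fixes \<Phi>0 :: "'x \<times> 'y \<times> 'z \<Rightarrow> real" and a0 :: "'x \<times> 'y \<times> 'z \<Rightarrow> complex"
  assumes "\<Phi>0 \<in> phases X Y \<alpha>" "a0 \<in> amplitudes X Y d \<rho> \<delta>"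
  defines "U \<equiv> \<lambda>n. ({\<Phi>\<in>phases_hg X Y. phase_near X Y n \<Phi> \<Phi>0} \<inter> phases X Y \<alpha>)
    \<times> {a\<in>amplitudes X Y d \<rho> \<delta>. amplitude_near X Y d \<rho> \<delta> n a a0}"
  shows "openin (FIO_topology X Y \<alpha> d \<rho> \<delta>) (U n)" "(\<Phi>0, a0) \<in> U n"
proof -
  have p: "\<Phi>0 \<in> phases_hg X Y" using assms(1) by (simp add: phases_def)
  have "openin (seminorm_topology (phases_hg X Y) (phase_seminorm X Y))
     {\<Phi>\<in>phases_hg X Y. phase_near X Y n \<Phi> \<Phi>0}"
    unfolding seminorm_topology_def
    by (rule topology_generated_by_Basis) (use p seq_param_pos in force)
  moreover have "openin (seminorm_topology (amplitudes X Y d \<rho> \<delta>) (amplitude_seminorm X Y d \<rho> \<delta>))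
     {a\<in>amplitudes X Y d \<rho> \<delta>. amplitude_near X Y d \<rho> \<delta> n a a0}"
    unfolding seminorm_topology_def
    by (rule topology_generated_by_Basis) (use assms(2) seq_param_pos in force)
  ultimately show "openin (FIO_topology X Y \<alpha> d \<rho> \<delta>) (U n)"
    unfolding U_def FIO_topology_def phases_topology_def amplitudes_topology_def
    by (simp add: openin_prod_Times_iff openin_subtopology_Int)
  show "(\<Phi>0, a0) \<in> U n"
    using assms(1,2) p seq_param_pos by (simp add: U_def seminorm_zero)
qed

text \<open>Otherwise the sets of \<open>FIO_neighbourhood\<close> would contain points violating continuity, and these form a
  sequence to which \<open>pairing_tendsto\<close> applies.\<close>

lemma continuous_pairing:
  assumes \<psi>: "\<psi> \<in> test_functions X"
  shows "continuous_map (FIO_topology X Y \<alpha> d \<rho> \<delta>) euclidean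
    (\<lambda>(\<Phi>, a). pairing Y u (FIO_transpose X chi \<kappa> \<Phi> a \<psi>))" (is "continuous_map ?T _ ?f")
  unfolding mtopology_is_euclidean[symmetric] Met_TC.continuous_map_to_metric
proof (intro ballI allI impI, rule ccontr)
  fix p0 and \<epsilon> :: real
  assume p0: "p0 \<in> topspace ?T" and \<epsilon>: "\<epsilon> > 0"
    and no: "\<not> (\<exists>U. openin ?T U \<and> p0 \<in> U \<and> (\<forall>q\<in>U. ?f q \<in> Met_TC.mball (?f p0) \<epsilon>))"
  obtain \<Phi>0 a0 where [simp]: "p0 = (\<Phi>0, a0)" by (cases p0)
  note P = topspace_FIO[OF p0[simplified]]
  note N = FIO_neighbourhood[OF P]
  have "\<forall>n. \<exists>\<Phi> a. \<Phi> \<in> phases X Y \<alpha> \<and> phase_near X Y n \<Phi> \<Phi>0 \<and>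
    a \<in> amplitudes X Y d \<rho> \<delta> \<and> amplitude_near X Y d \<rho> \<delta> n a a0 \<and>
    \<not> dist (?f (\<Phi>0, a0)) (?f (\<Phi>, a)) < \<epsilon>"
  proof
    fix n
    have "\<not> (\<forall>q \<in> ({\<Phi>\<in>phases_hg X Y. phase_near X Y n \<Phi> \<Phi>0} \<inter> phases X Y \<alpha>)
      \<times> {a\<in>amplitudes X Y d \<rho> \<delta>. amplitude_near X Y d \<rho> \<delta> n a a0}.
      ?f q \<in> Met_TC.mball (?f p0) \<epsilon>)"
      using no N[of n] unfolding \<open>p0 = (\<Phi>0, a0)\<close> by blast
    then show "\<exists>\<Phi> a. \<Phi> \<in> phases X Y \<alpha> \<and> phase_near X Y n \<Phi> \<Phi>0 \<and>
      a \<in> amplitudes X Y d \<rho> \<delta> \<and> amplitude_near X Y d \<rho> \<delta> n a a0 \<and>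
      \<not> dist (?f (\<Phi>0, a0)) (?f (\<Phi>, a)) < \<epsilon>" by auto
  qed
  from choice[OF this] obtain \<Phi> where "\<forall>n. \<exists>a. \<Phi> n \<in> phases X Y \<alpha> \<and>
    phase_near X Y n (\<Phi> n) \<Phi>0 \<and>
    a \<in> amplitudes X Y d \<rho> \<delta> \<and> amplitude_near X Y d \<rho> \<delta> n a a0 \<and>
    \<not> dist (?f (\<Phi>0, a0)) (?f (\<Phi> n, a)) < \<epsilon>" ..
  from choice[OF this] obtain a where S: "\<And>n. \<Phi> n \<in> phases X Y \<alpha>"
    "\<And>n. phase_near X Y n (\<Phi> n) \<Phi>0"
    "\<And>n. a n \<in> amplitudes X Y d \<rho> \<delta>"
    "\<And>n. amplitude_near X Y d \<rho> \<delta> n (a n) a0"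
    "\<And>n. \<not> dist (?f (\<Phi>0, a0)) (?f (\<Phi> n, a n)) < \<epsilon>"
    by blast
  have "converges \<Phi>0 \<Phi> a0 a (supp \<psi>) \<psi> (\<lambda>_. \<psi>)"
    using P S(1-4) test_functionsD[OF \<psi>] unfolding converges_def
    by (auto simp: less_imp_le[OF seq_param_pos])
  from pairing_tendsto[OF this] have "(\<lambda>n. ?f (\<Phi> n, a n)) \<longlonglongrightarrow> ?f (\<Phi>0, a0)" by simp
  then have "eventually (\<lambda>n. dist (?f (\<Phi> n, a n)) (?f (\<Phi>0, a0)) < \<epsilon>) sequentially"
    using \<epsilon> by (rule tendstoD)
  then obtain n where "dist (?f (\<Phi> n, a n)) (?f (\<Phi>0, a0)) < \<epsilon>"
    by (auto simp: eventually_sequentially)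
  then show False using S(5)[of n] by (simp add: dist_commute)
qed

end

theorem corollary3p12:
  fixes X :: "'x::euclidean_space set" and Y :: "'y::euclidean_space set"
    and chi :: "'z::euclidean_space \<Rightarrow> complex"
    and \<alpha> d \<rho> \<delta> :: real and \<kappa> :: nat
    and u :: "('y \<Rightarrow> complex) \<Rightarrow> complex"
  assumes "open X" and "open Y"
    and "\<alpha> > 0" and "0 \<le> \<delta>" and "\<delta> < 1" and "0 < \<rho>" and "\<rho> \<le> 1"
    and "chi \<in> test_functions UNIV"
    and "\<And>\<xi>. norm \<xi> < 1 \<Longrightarrow> chi \<xi> = 1" and "\<And>\<xi>. norm \<xi> > 2 \<Longrightarrow> chi \<xi> = 0"
    and "d - real \<kappa> * min \<rho> (1 - \<delta>) < - real DIM('z)"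
    and "u \<in> compact_distributions Y"
  shows "continuous_map (FIO_topology X Y \<alpha> d \<rho> \<delta>) (weak_star_topology X)
           (\<lambda>(\<Phi>, a). FIO X Y chi \<kappa> \<Phi> a u)"
proof -
  interpret fio_setting X Y chi \<alpha> d \<rho> \<delta> \<kappa> u
    using assms by unfold_locales
  show ?thesis
    unfolding weak_star_topology_def continuous_map_in_subtopology continuous_map_componentwise
  proof (intro conjI ballI)
    show "(\<lambda>(\<Phi>, a). FIO X Y chi \<kappa> \<Phi> a u) ` topspace (FIO_topology X Y \<alpha> d \<rho> \<delta>) \<subseteq> extensional (test_functions X)"
      by (auto simp: FIO_def)
    show "(\<lambda>(\<Phi>, a). FIO X Y chi \<kappa> \<Phi> a u) \<in> topspace (FIO_topology X Y \<alpha> d \<rho> \<delta>) \<rightarrow> distributions X"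
      using FIO_distribution topspace_FIO by auto
    show "continuous_map (FIO_topology X Y \<alpha> d \<rho> \<delta>) euclidean (\<lambda>p. (case p of (\<Phi>, a) \<Rightarrow> FIO X Y chi \<kappa> \<Phi> a u) \<psi>)"
      if "\<psi> \<in> test_functions X" for \<psi>
      using continuous_pairing[OF that] that by (simp add: FIO_def case_prod_unfold)
  qed
qed

end
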